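(* For every fixed integer $d\ge 3$, the following problem is NP-hard: given a graph $G$ of maximum degree $d+1$, decide whether the spectral degeneracy of $G$ is at least $d$.
   Context: All graphs are finite and simple. $\Delta(H)$ is the maximum degree of $H$; $\rho(H)$ is the spectral radius of $H$, i.e. the largest eigenvalue of its adjacency matrix. A graph $G$ is spectrally $d$-degenerate if every subgraph $H\subseteq G$ satisfies $\rho(H)\le\sqrt{d\,\Delta(H)}$. The spectral degeneracy of $G$ is the least real $d\ge0$ such that $G$ is spectrally $d$-degenerate; for a graph with at least one edge it equals the maximum of $\rho(H)^2/\Delta(H)$ over all subgraphs $H\subseteq G$ with at least one edge. Hardness is with respect to polynomial-time reductions. *)

theory Defs
  imports
    "Graph_Theory.Graph_Theory"
    "Jordan_Normal_Form.Char_Poly"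
begin

section \<open>Spectral degeneracy\<close>

text \<open>
  A finite simple graph is a symmetric loop-free pair digraph: the edge \<open>uv\<close> is the pair of
  arcs \<open>(u, v)\<close>, \<open>(v, u)\<close>, so \<open>out_degree\<close> is the usual degree. Graphs have at least one vertex;
  the maximum degree and the spectral radius of the null graph are meaningless.
\<close>

definition simple_graph :: "'a pair_pre_digraph \<Rightarrow> bool" where
  "simple_graph G \<longleftrightarrow> pair_graph G \<and> pverts G \<noteq> {}"

definition max_degree :: "'a pair_pre_digraph \<Rightarrow> nat" where
  "max_degree G = Max (out_degree (with_proj G) ` pverts G)"

text \<open>
  The rows are ordered by the linear order of the vertices; the spectrum does not depend on
  this choice.
\<close>

definition adjacency_matrix :: "'a::linorder pair_pre_digraph \<Rightarrow> real mat" where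
  "adjacency_matrix G =
     (let vs = sorted_list_of_set (pverts G)
      in mat (length vs) (length vs) (\<lambda>(i, j). if (vs ! i, vs ! j) \<in> parcs G then 1 else 0))"

definition graph_spectral_radius :: "'a::linorder pair_pre_digraph \<Rightarrow> real" where
  "graph_spectral_radius G = Max {k. eigenvalue (adjacency_matrix G) k}"

definition spectrally_degenerate :: "real \<Rightarrow> 'a::linorder pair_pre_digraph \<Rightarrow> bool" where
  "spectrally_degenerate d G \<longleftrightarrow>
     (\<forall>H. simple_graph H \<and> subgraph (with_proj H) (with_proj G) \<longrightarrow>
        graph_spectral_radius H \<le> sqrt (d * real (max_degree H)))"

definition spectral_degeneracy :: "'a::linorder pair_pre_digraph \<Rightarrow> real" where
  "spectral_degeneracy G = (LEAST d. 0 \<le> d \<and> spectrally_degenerate d G)"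


section \<open>Multitape Turing machines\<close>

text \<open>
  Deterministic machines with finitely many two-way infinite tapes. Tape symbols are
  \<open>0, \<dots>, symbols M - 1\<close>, where \<open>0\<close> is the blank and \<open>1\<close>, \<open>2\<close> stand for the input bits
  \<open>False\<close>, \<open>True\<close>. Non-halting states are \<open>0, \<dots>, states M - 1\<close>, with initial state \<open>0\<close>;
  the state \<open>states M\<close> is the halting state. Given the state and the list of scanned symbols,
  \<open>delta M\<close> yields the next state and, for each tape, the symbol to write and the head movement.
\<close>

datatype move = MoveLeft | Stay | MoveRight

record turing_machine =
  tapes :: nat
  symbols :: nat
  states :: nat
  delta :: "nat \<Rightarrow> nat list \<Rightarrow> nat \<times> (nat \<times> move) list"

definition wf_turing_machine :: "turing_machine \<Rightarrow> bool" where
  "wf_turing_machine M \<longleftrightarrow>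
     1 \<le> tapes M \<and> 3 \<le> symbols M \<and> 1 \<le> states M \<and>
     (\<forall>q ss. q < states M \<and> length ss = tapes M \<and> set ss \<subseteq> {..<symbols M} \<longrightarrow>
        (case delta M q ss of (q', as) \<Rightarrow>
           q' \<le> states M \<and> length as = tapes M \<and> fst ` set as \<subseteq> {..<symbols M}))"

text \<open>A tape is its content together with the position of the head.\<close>

type_synonym tape = "(int \<Rightarrow> nat) \<times> int"

type_synonym config = "nat \<times> tape list"

definition read_tape :: "tape \<Rightarrow> nat" where
  "read_tape T = fst T (snd T)"

definition act_tape :: "nat \<times> move \<Rightarrow> tape \<Rightarrow> tape" where
  "act_tape a T =
     ((fst T)(snd T := fst a),
      (case snd a of MoveLeft \<Rightarrow> snd T - 1 | Stay \<Rightarrow> snd T | MoveRight \<Rightarrow> snd T + 1))"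

definition step :: "turing_machine \<Rightarrow> config \<Rightarrow> config" where
  "step M c =
     (case c of (q, Ts) \<Rightarrow>
        if q = states M then c
        else (case delta M q (map read_tape Ts) of (q', as) \<Rightarrow> (q', map2 act_tape as Ts)))"

definition word_content :: "bool list \<Rightarrow> int \<Rightarrow> nat" where
  "word_content w i =
     (if 0 \<le> i \<and> i < int (length w) then (if w ! nat i then 2 else 1) else 0)"

text \<open>The input words are placed on the first tapes; all remaining tapes are blank.\<close>

definition init_config :: "turing_machine \<Rightarrow> bool list list \<Rightarrow> config" where
  "init_config M ws =
     (0, map (\<lambda>w. (word_content w, 0)) (ws @ replicate (tapes M - length ws) []))"

text \<open>
  The output is read off the first tape, from cell \<open>0\<close> up to (excluding) the first blank.
\<close>

definition halts_with :: "turing_machine \<Rightarrow> config \<Rightarrow> bool list \<Rightarrow> bool" where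
  "halts_with M c y \<longleftrightarrow>
     fst c = states M \<and>
     (\<forall>i \<le> length y. fst (hd (snd c)) (int i) = word_content y (int i))"

definition poly_time_computable :: "nat \<Rightarrow> (bool list list \<Rightarrow> bool list) \<Rightarrow> bool" where
  "poly_time_computable k F \<longleftrightarrow>
     (\<exists>M p. wf_turing_machine M \<and> k \<le> tapes M \<and>
        (\<forall>ws. length ws = k \<longrightarrow>
           (\<exists>t \<le> poly (p :: nat poly) (sum_list (map length ws)).
              halts_with M ((step M ^^ t) (init_config M ws)) (F ws))))"


section \<open>NP and NP-hardness\<close>

definition in_NP :: "bool list set \<Rightarrow> bool" where
  "in_NP L \<longleftrightarrow>
     (\<exists>R p. poly_time_computable 2 (\<lambda>ws. [R (ws ! 0) (ws ! 1)]) \<and>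
        (\<forall>x. x \<in> L \<longleftrightarrow> (\<exists>w. length w \<le> poly (p :: nat poly) (length x) \<and> R x w)))"

text \<open>
  The decision problem ``given an instance in \<open>I\<close>, decide whether it satisfies \<open>Y\<close>'', where
  instances are presented to a machine through the encoding \<open>enc\<close>. Reductions are polynomial-time
  many-one reductions, and every word is mapped to the encoding of an actual instance: it is not
  permitted to map a word outside \<open>L\<close> to a word that encodes no instance.
\<close>

definition NP_hard :: "('i \<Rightarrow> bool list) \<Rightarrow> 'i set \<Rightarrow> ('i \<Rightarrow> bool) \<Rightarrow> bool" where
  "NP_hard enc I Y \<longleftrightarrow>
     (\<forall>L. in_NP L \<longrightarrow>
        (\<exists>f. poly_time_computable 1 (\<lambda>ws. f (ws ! 0)) \<and>
           (\<forall>x. \<exists>G \<in> I. f x = enc G \<and> (x \<in> L \<longleftrightarrow> Y G))))"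


section \<open>Graphs as inputs\<close>

text \<open>
  Input graphs have vertex set \<open>{0, \<dots>, n - 1}\<close> and are encoded by the \<open>n * n\<close> entries of
  the adjacency matrix, row by row.
\<close>

definition encode_graph :: "nat pair_pre_digraph \<Rightarrow> bool list" where
  "encode_graph G =
     (let n = card (pverts G)
      in concat (map (\<lambda>i. map (\<lambda>j. (i, j) \<in> parcs G) [0..<n]) [0..<n]))"

definition graphs_of_max_degree :: "nat \<Rightarrow> nat pair_pre_digraph set" where
  "graphs_of_max_degree D =
     {G. simple_graph G \<and> (\<exists>n. pverts G = {0..<n}) \<and> max_degree G = D}"

end

theory Submission
  imports Defs "Jordan_Normal_Form.Spectral_Radius"
begin

text \<open>
  In a graph with a positive vertex weight \<open>y\<close> such that the weights of the neighbours of any vertex \<open>v\<close> sum up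
  to at most \<open>l * y v\<close>, every subgraph has spectral radius at most \<open>l\<close>. If the graph has maximum degree
  \<open>d + 1\<close> and \<open>l\<^sup>2 < d * (d + 1)\<close>, then the only subgraphs that can witness a spectral degeneracy of at least
  \<open>d\<close> are the \<open>d\<close>-regular ones. In such a subgraph a vertex of degree \<open>d\<close> uses all its edges or none,
  so that long chains of these vertices act as Boolean variables, and a vertex of degree \<open>d + 1\<close> omits exactly
  one of its edges if it is used at all. This expresses exact cover problems, these express
  tilings of a grid, and those the accepting computations of a verifier. The adjacency relation of the
  resulting graph is an arithmetic formula in the numbers of the two vertices, the length of the input and
  single input bits, which a counter machine evaluates for all pairs of vertices.
\<close>

section \<open>Structured programs for multitape machines\<close>

text \<open>Let \<open>D > 0\<close> be the maximum degree of a subgraph that witnesses degeneracy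
  at least \<open>d\<close>. Its squared spectral radius is at least \<open>d * D\<close> and at
  most \<open>D * D\<close>, so \<open>D < d\<close> is impossible, and only
  \<open>D = d + 1\<close> has to be excluded. This is why vertices of degree \<open>d + 1\<close>
  are kept sparse: no two are adjacent, and a vertex of degree \<open>d\<close> sees at most one of
  them. The price is a poor vocabulary: such a vertex can only say "none of my edges, or all but
  one", which the empty selection always satisfies. One distinguished wire is therefore attached to
  every constraint with multiplicity \<open>d - 2\<close> or \<open>d - 1\<close> and shown to lie
  in every nonempty solution; what remains is "exactly one is absent" among two or three wires.
  Cover conditions of unbounded length are broken into chains of such small conditions. On the
  machine side all numbers are polynomial in the input length, so unary counters suffice. Since a
  reduction has to produce a genuine instance for every word, the maximum degree must be exactly
  \<open>d + 1\<close> for every input.\<close>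

datatype prog =
    Done
  | Act nat nat "nat \<Rightarrow> nat \<Rightarrow> nat \<times> move"
  | Seq prog prog
  | While nat "nat \<Rightarrow> bool" prog

text \<open>The control states of the machine for a program are its residual programs.\<close>

fun nxt :: "prog \<Rightarrow> (nat \<Rightarrow> nat) \<Rightarrow> prog" where
  "nxt Done sc = Done"
| "nxt (Act s r g) sc = Done"
| "nxt (Seq P Q) sc = (if P = Done then Q else Seq (nxt P sc) Q)"
| "nxt (While r b P) sc = (if b (sc r) then Seq P (While r b P) else Done)"

fun acts :: "prog \<Rightarrow> (nat \<Rightarrow> nat) \<Rightarrow> nat \<Rightarrow> nat \<times> move" where
  "acts (Act s r g) sc = (\<lambda>r'. if r' = r then g (sc s) (sc r) else (sc r', Stay))"
| "acts (Seq P Q) sc = acts P sc"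
| "acts _ sc = (\<lambda>r'. (sc r', Stay))"

text \<open>The bound \<open>4\<close> is the alphabet size of the compiled machine: blank, the two
  bits, and a mark \<open>3\<close> by which a counter recognises zero.\<close>

fun prog_wf :: "nat \<Rightarrow> prog \<Rightarrow> bool" where
  "prog_wf K Done \<longleftrightarrow> True"
| "prog_wf K (Act s r g) \<longleftrightarrow> s < K \<and> r < K \<and> (\<forall>a<4. \<forall>b<4. fst (g a b) < 4)"
| "prog_wf K (Seq P Q) \<longleftrightarrow> prog_wf K P \<and> prog_wf K Q"
| "prog_wf K (While r b P) \<longleftrightarrow> r < K \<and> prog_wf K P"

text \<open>Finite and closed under \<open>nxt\<close>: the body of a loop returns to the very
  program it came from, so unrolling creates nothing new. Hence it can serve as a set of control
  states.\<close>

fun residuals :: "prog \<Rightarrow> prog set" where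
  "residuals Done = {Done}"
| "residuals (Act s r g) = {Act s r g, Done}"
| "residuals (Seq P Q) = (\<lambda>P'. Seq P' Q) ` residuals P \<union> residuals Q"
| "residuals (While r b P) =
     insert (While r b P) (insert Done ((\<lambda>P'. Seq P' (While r b P)) ` residuals P))"

lemma finite_residuals: "finite (residuals P)"
  by (induction P) auto

lemma residuals_self: "P \<in> residuals P"
  by (induction P) auto

lemma residuals_Done: "Done \<in> residuals P"
  by (induction P) auto

lemma residuals_nxt: "Q \<in> residuals P \<Longrightarrow> nxt Q sc \<in> residuals P"
proof (induction P arbitrary: Q)
  case (While r b P)
  then consider "Q = While r b P" | "Q = Done" | P' where "P' \<in> residuals P" "Q = Seq P' (While r b P)"
    by auto
  then show ?case
    using While.IH residuals_self[of P] by cases auto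
qed (auto simp: residuals_self residuals_Done)

lemma residuals_prog_wf: "Q \<in> residuals P \<Longrightarrow> prog_wf K P \<Longrightarrow> prog_wf K Q"
  by (induction P arbitrary: Q) auto

lemma prog_wf_mono: "prog_wf K P \<Longrightarrow> K \<le> K' \<Longrightarrow> prog_wf K' P"
  by (induction P) auto

text \<open>Tapes are indexed by all natural numbers, so programs compose without declaring how many
  tapes they use.\<close>

definition sstep :: "prog \<times> (nat \<Rightarrow> tape) \<Rightarrow> prog \<times> (nat \<Rightarrow> tape)" where
  "sstep c = (case c of (P, Ts) \<Rightarrow>
     (nxt P (\<lambda>r. read_tape (Ts r)), \<lambda>r. act_tape (acts P (\<lambda>r. read_tape (Ts r)) r) (Ts r)))"

lemma act_tape_idle [simp]: "act_tape (read_tape T, Stay) T = T"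
  by (simp add: act_tape_def read_tape_def)

lemma sstep_Done [simp]: "sstep (Done, Ts) = (Done, Ts)"
  by (simp add: sstep_def)

lemma sstep_Done_iter [simp]: "(sstep ^^ t) (Done, Ts) = (Done, Ts)"
  by (induction t) auto

text \<open>An upper bound on the time lets running times be rounded up freely.\<close>

definition runs :: "prog \<Rightarrow> (nat \<Rightarrow> tape) \<Rightarrow> nat \<Rightarrow> (nat \<Rightarrow> tape) \<Rightarrow> bool" where
  "runs P Ts t Ts' \<longleftrightarrow> (\<exists>t'\<le>t. (sstep ^^ t') (P, Ts) = (Done, Ts'))"

lemma runs_mono: "runs P Ts t Ts' \<Longrightarrow> t \<le> t' \<Longrightarrow> runs P Ts t' Ts'"
  unfolding runs_def by (meson le_trans)

lemma runs_Done: "runs Done Ts 0 Ts"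
  by (auto simp: runs_def)

lemma runs_stepI: "sstep (P, Ts) = (P', Ts') \<Longrightarrow> runs P' Ts' t Ts'' \<Longrightarrow> runs P Ts (Suc t) Ts''"
  unfolding runs_def by (metis Suc_le_mono funpow_Suc_right o_apply)

lemma runs_Act: "runs (Act s r g) Ts 1
    (Ts(r := act_tape (g (read_tape (Ts s)) (read_tape (Ts r))) (Ts r)))"
proof -
  have "sstep (Act s r g, Ts) = (Done,
      Ts(r := act_tape (g (read_tape (Ts s)) (read_tape (Ts r))) (Ts r)))"
    by (auto simp: sstep_def)
  from runs_stepI[OF this runs_Done] show ?thesis by simp
qed

lemma sstep_Seq: "P \<noteq> Done \<Longrightarrow> sstep (P, Ts) = (P1, Ts1) \<Longrightarrow> sstep (Seq P Q, Ts) = (Seq P1 Q, Ts1)"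
  by (simp add: sstep_def)

text \<open>The extra unit pays for the idle step from \<open>Seq Done Q\<close> to
  \<open>Q\<close>.\<close>

lemma runs_Seq:
  assumes P: "runs P Ts t1 Ts'" and Q: "runs Q Ts' t2 Ts''"
  shows "runs (Seq P Q) Ts (t1 + t2 + 1) Ts''"
proof -
  obtain t where t: "t \<le> t1" "(sstep ^^ t) (P, Ts) = (Done, Ts')"
    using P by (auto simp: runs_def)
  have "runs (Seq P Q) Ts (t + t2 + 1) Ts''"
    using t(2)
  proof (induction t arbitrary: P Ts)
    case 0
    then have "sstep (Seq P Q, Ts) = (Q, Ts')"
      by (simp add: sstep_def)
    from runs_stepI[OF this Q] show ?case by simp
  next
    case (Suc t)
    show ?case
    proof (cases "P = Done")
      case True
      then have [simp]: "Ts = Ts'" using Suc.prems by (simp del: funpow.simps)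
      have "sstep (Seq P Q, Ts) = (Q, Ts')"
        using True by (simp add: sstep_def)
      from runs_stepI[OF this Q] show ?thesis by (rule runs_mono) simp
    next
      case False
      obtain P1 Ts1 where 1: "sstep (P, Ts) = (P1, Ts1)" by fastforce
      have "runs (Seq P1 Q) Ts1 (t + t2 + 1) Ts''"
        using Suc.prems 1 by (intro Suc.IH) (simp add: funpow_swap1)
      from runs_stepI[OF sstep_Seq[OF False 1] this] show ?thesis by simp
    qed
  qed
  then show ?thesis by (rule runs_mono) (use t in simp)
qed

lemma runs_While_False: "\<not> b (read_tape (Ts r)) \<Longrightarrow> runs (While r b P) Ts 1 Ts"
  using runs_stepI[of "While r b P" Ts Done Ts 0 Ts] runs_Done[of Ts] by (simp add: sstep_def)

lemma runs_While_True:
  assumes "b (read_tape (Ts r))" "runs P Ts t1 Ts'" "runs (While r b P) Ts' t2 Ts''"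
  shows "runs (While r b P) Ts (t1 + t2 + 2) Ts''"
  using runs_stepI[OF _ runs_Seq[OF assms(2,3)], of "While r b P" Ts] assms(1)
  by (simp add: sstep_def)

text \<open>The sequence \<open>S\<close> is the loop invariant made explicit: \<open>S k\<close> is
  the memory after \<open>k\<close> rounds. A round costs its body, the test, and the idle step
  leaving \<open>Seq Done\<close>; the failing test at the end costs one more.\<close>

lemma runs_loop:
  assumes "\<And>k. k < n \<Longrightarrow> b (read_tape (S k r))"
    and "\<And>k. k < n \<Longrightarrow> runs P (S k) t (S (Suc k))"
    and "\<not> b (read_tape (S n r))"
  shows "runs (While r b P) (S 0) (n * (t + 2) + 1) (S n)"
  using assms
proof (induction n arbitrary: S)
  case 0
  then show ?case using runs_While_False by simp
next
  case (Suc n)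
  have "runs (While r b P) (S (Suc 0)) (n * (t + 2) + 1) (S (Suc n))"
    by (rule Suc.IH[where S = "\<lambda>k. S (Suc k)"]) (use Suc.prems in auto)
  from runs_While_True[OF Suc.prems(1)[of 0] Suc.prems(2)[of 0] this]
  show ?case by (simp add: algebra_simps)
qed

section \<open>From programs on infinitely many tapes to a machine with finitely many\<close>

lemma nxt_cong: "prog_wf K P \<Longrightarrow> (\<And>r. r < K \<Longrightarrow> sc r = sc' r) \<Longrightarrow> nxt P sc = nxt P sc'"
  by (induction P) auto

lemma acts_cong: "prog_wf K P \<Longrightarrow> (\<And>r. r < K \<Longrightarrow> sc r = sc' r) \<Longrightarrow> r < K \<Longrightarrow> acts P sc r = acts P sc' r"
  by (induction P) auto

lemma acts_wf: "prog_wf K P \<Longrightarrow> (\<And>r. r < K \<Longrightarrow> sc r < 4) \<Longrightarrow> r < K \<Longrightarrow> fst (acts P sc r) < 4"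
  by (induction P) auto

lemma map2_map_map: "map2 f (map g xs) (map h xs) = map (\<lambda>x. f (g x) (h x)) xs"
  by (induction xs) auto

text \<open>The states number the residual programs, and one machine step simulates one
  \<open>sstep\<close>. The tapes \<open>Ts\<close> in the hypothesis are prescribed only below
  \<open>K\<close>; the others may start with any content, which spares initialising infinitely many
  counters.\<close>

theorem poly_time_computable_prog:
  fixes F :: "bool list list \<Rightarrow> bool list"
  assumes wf: "prog_wf K P" and P: "P \<noteq> Done" and K: "1 \<le> K" "k \<le> K"
    and run: "\<And>ws. length ws = k \<Longrightarrow> \<exists>Ts Ts'.
      (\<forall>r<K. Ts r = (word_content (if r < k then ws ! r else []), 0)) \<and>
      runs P Ts (poly p (sum_list (map length ws))) Ts' \<and>
      (\<forall>i\<le>length (F ws). fst (Ts' 0) (int i) = word_content (F ws) (int i))"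
  shows "poly_time_computable k F"
proof -
  define R where "R = residuals P"
  define A where "A = R - {P, Done}"
  define S where "S = card A + 1"
  have fin: "finite A" by (simp add: A_def R_def finite_residuals)
  then obtain h0 where h0: "bij_betw h0 A {0..<card A}"
    using ex_bij_betw_finite_nat by blast
  \<comment> \<open>State \<open>0\<close> is initial and state \<open>S\<close> is halting, so
    \<open>P\<close> and \<open>Done\<close> are numbered by hand and the other residuals fill the
    numbers in between.\<close>
  define h where "h Q = (if Q = P then 0 else if Q = Done then S else Suc (h0 Q))" for Q
  have h0_less: "h0 Q < card A" if "Q \<in> A" for Q
    using h0 that by (auto simp: bij_betw_def)
  have RA: "R = insert P (insert Done A)"
    using residuals_self[of P] residuals_Done[of P] by (auto simp: A_def R_def)
  have inj: "inj_on h R"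
  proof (rule inj_onI)
    fix x y assume xy: "x \<in> R" "y \<in> R" "h x = h y"
    show "x = y"
      using xy h0_less[of x] h0_less[of y] inj_onD[OF bij_betw_imp_inj_on[OF h0], of x y] P
      unfolding RA h_def S_def by (auto split: if_splits)
  qed
  have im: "{0..S} \<subseteq> h ` R"
  proof
    fix q assume "q \<in> {0..S}"
    then consider "q = 0" | "q = S" | q' where "q = Suc q'" "q' < card A"
      by (cases q) (auto simp: S_def le_less)
    then show "q \<in> h ` R"
    proof cases
      case 1
      then show ?thesis by (auto simp: RA h_def)
    next
      case 2
      then show ?thesis using P by (auto simp: RA h_def image_iff)
    next
      case 3
      then obtain Q where Q: "Q \<in> A" "h0 Q = q'"
        using h0 by (metis atLeastLessThan_iff bij_betw_iff_bijections le0)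
      then have "h Q = q" using 3 by (auto simp: h_def A_def)
      then show ?thesis using Q RA by blast
    qed
  qed
  have h_le: "h Q \<le> S" if "Q \<in> R" for Q
    using that h0_less[of Q] by (auto simp: h_def RA S_def split: if_splits)
  define g where "g = inv_into R h"
  have gR: "g q \<in> R" if "q \<le> S" for q
    unfolding g_def by (rule inv_into_into) (use im that in auto)
  have gh: "g (h Q) = Q" if "Q \<in> R" for Q
    unfolding g_def using inj that by (rule inv_into_f_f)
  define sc where "sc ss = (\<lambda>r. if r < K then ss ! r else (0::nat))" for ss
  define M where "M = \<lparr>tapes = K, symbols = 4, states = S,
    delta = (\<lambda>q ss. (h (nxt (g q) (sc ss)), map (acts (g q) (sc ss)) [0..<K]))\<rparr>"
  have wfQ: "prog_wf K Q" if "Q \<in> R" for Q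
    using that wf residuals_prog_wf by (auto simp: R_def)
  have "wf_turing_machine M"
    unfolding wf_turing_machine_def
  proof (intro conjI allI impI)
    fix q ss assume a: "q < states M \<and> length ss = tapes M \<and> set ss \<subseteq> {..<symbols M}"
    have gq: "g q \<in> R" using a by (intro gR) (simp add: M_def)
    have "sc ss r < 4" if "r < K" for r
      using a that by (auto simp: sc_def M_def dest!: nth_mem)
    then have "fst (acts (g q) (sc ss) r) < 4" if "r < K" for r
      using acts_wf[OF wfQ[OF gq]] that by blast
    moreover have "h (nxt (g q) (sc ss)) \<le> S"
      using gq by (intro h_le) (auto simp: R_def residuals_nxt)
    ultimately show "case delta M q ss of (q', as) \<Rightarrow>
        q' \<le> states M \<and> length as = tapes M \<and> fst ` set as \<subseteq> {..<symbols M}"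
      by (auto simp: M_def)
  qed (use K in \<open>auto simp: M_def S_def\<close>)
  moreover have sim1: "step M (h Q, map Ts [0..<K]) = (h Q', map Ts' [0..<K])"
    if Q: "Q \<in> R" and s: "sstep (Q, Ts) = (Q', Ts')" for Q Q' Ts Ts'
  proof (cases "Q = Done")
    case True
    then show ?thesis using s P by (auto simp: step_def M_def h_def)
  next
    case False
    have hQ: "h Q \<noteq> S"
      using False Q h0_less[of Q] by (auto simp: h_def RA S_def)
    have sc: "sc (map read_tape (map Ts [0..<K])) r = read_tape (Ts r)" if "r < K" for r
      using that by (simp add: sc_def)
    have "nxt Q (sc (map read_tape (map Ts [0..<K]))) = Q'"
      using s nxt_cong[OF wfQ[OF Q] sc] by (simp add: sstep_def)
    moreover have "act_tape (acts Q (sc (map read_tape (map Ts [0..<K]))) r) (Ts r) = Ts' r"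
      if "r < K" for r
      using s acts_cong[OF wfQ[OF Q] sc that] by (auto simp: sstep_def)
    ultimately show ?thesis
      using hQ gh[OF Q] by (auto simp: step_def M_def map2_map_map)
  qed
  have sim: "\<exists>Q' Ts'. (sstep ^^ t) (Q, Ts) = (Q', Ts') \<and> Q' \<in> R \<and>
      (step M ^^ t) (h Q, map Ts [0..<K]) = (h Q', map Ts' [0..<K])" if "Q \<in> R" for Q Ts t
  proof (induction t)
    case (Suc t)
    then obtain Q' Ts' where 1: "(sstep ^^ t) (Q, Ts) = (Q', Ts')" "Q' \<in> R"
      "(step M ^^ t) (h Q, map Ts [0..<K]) = (h Q', map Ts' [0..<K])" by blast
    obtain Q'' Ts'' where 2: "sstep (Q', Ts') = (Q'', Ts'')" by fastforce
    have "Q'' \<in> R" using 2 1(2) by (auto simp: sstep_def R_def residuals_nxt)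
    then show ?case using 1 2 sim1[OF 1(2) 2] by auto
  qed (use that in auto)
  have "\<exists>t\<le>poly p (sum_list (map length ws)).
      halts_with M ((step M ^^ t) (init_config M ws)) (F ws)" if ws: "length ws = k" for ws
  proof -
    obtain Ts Ts' where Ts: "\<And>r. r < K \<Longrightarrow> Ts r = (word_content (if r < k then ws ! r else []), 0)"
      and r: "runs P Ts (poly p (sum_list (map length ws))) Ts'"
      and out: "\<And>i. i \<le> length (F ws) \<Longrightarrow> fst (Ts' 0) (int i) = word_content (F ws) (int i)"
      using run[OF ws] by blast
    obtain t where t: "t \<le> poly p (sum_list (map length ws))" "(sstep ^^ t) (P, Ts) = (Done, Ts')"
      using r by (auto simp: runs_def)
    have "map Ts [0..<K] = map (\<lambda>w. (word_content w, 0)) (ws @ replicate (K - k) [])"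
      using ws K(2) Ts by (intro nth_equalityI) (auto simp: nth_append)
    then have init: "init_config M ws = (h P, map Ts [0..<K])"
      using ws by (simp add: init_config_def M_def h_def)
    obtain Q' Ts2 where "(sstep ^^ t) (P, Ts) = (Q', Ts2)"
        "(step M ^^ t) (h P, map Ts [0..<K]) = (h Q', map Ts2 [0..<K])"
      using sim[of P t Ts] by (auto simp: R_def residuals_self)
    then have fin: "(step M ^^ t) (init_config M ws) = (h Done, map Ts' [0..<K])"
      using init t(2) by simp
    have "halts_with M ((step M ^^ t) (init_config M ws)) (F ws)"
      unfolding fin halts_with_def using out P K by (auto simp: M_def h_def hd_map)
    then show ?thesis using t(1) by blast
  qed
  ultimately show ?thesis
    unfolding poly_time_computable_def using K(2)
    by (intro exI[of _ M] exI[of _ p]) (auto simp: M_def)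
qed

section \<open>Counter programs\<close>

text \<open>Tape \<open>r \<ge> 1\<close> is a counter whose value is its head position; cell \<open>0\<close> carries the mark \<open>3\<close>.
  The counter on tape \<open>1\<close> doubles as a pointer into the input, stored in cells \<open>1, \<dots>, n\<close>.
  Tape \<open>0\<close> collects the output.\<close>

definition mem :: "bool list \<Rightarrow> nat \<Rightarrow> int \<Rightarrow> nat" where
  "mem x r i = (if i = 0 then 3 else if r = 1 then word_content x (i - 1) else 0)"

definition conf :: "bool list \<Rightarrow> bool list \<Rightarrow> (nat \<Rightarrow> nat) \<Rightarrow> nat \<Rightarrow> tape" where
  "conf x out \<sigma> r = (if r = 0 then (word_content out, int (length out)) else (mem x r, int (\<sigma> r)))"

abbreviation run where
  "run P x out \<sigma> t out' \<sigma>' \<equiv> runs P (conf x out \<sigma>) t (conf x out' \<sigma>')"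

abbreviation "crun P x out \<sigma> t \<sigma>' \<equiv> run P x out \<sigma> t out \<sigma>'"

lemma word_content_less: "word_content x i < 3"
  by (simp add: word_content_def)

lemma mem_eq_3 [simp]: "mem x r i = 3 \<longleftrightarrow> i = 0"
  using word_content_less[of x "i - 1"] by (auto simp: mem_def)

lemma read_conf: "r \<noteq> 0 \<Longrightarrow> read_tape (conf x out \<sigma> r) = mem x r (int (\<sigma> r))"
  by (simp add: read_tape_def conf_def)

definition "incr r = Act r r (\<lambda>_ a. (a, MoveRight))"
text \<open>At zero the head scans the mark and stays, so decrementing is truncated like subtraction
  on natural numbers.\<close>

definition "decr r = Act r r (\<lambda>_ a. if a = 3 then (a, Stay) else (a, MoveLeft))"
abbreviation "while_pos r P \<equiv> While r (\<lambda>a. a \<noteq> 3) P"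
abbreviation "while_zero r P \<equiv> While r (\<lambda>a. a = 3) P"

lemma prog_wf_inc [simp]: "prog_wf K (incr r) \<longleftrightarrow> r < K" by (auto simp: incr_def)
lemma prog_wf_dec [simp]: "prog_wf K (decr r) \<longleftrightarrow> r < K" by (auto simp: decr_def)

text \<open>Counter programs leave the contents of all counter tapes unchanged: the action must
  rewrite the scanned symbol, and only the head position enters the new store.\<close>

lemma run_Act:
  assumes "r \<noteq> 0" "s \<noteq> 0"
    and "g (mem x s (int (\<sigma> s))) (mem x r (int (\<sigma> r))) = (mem x r (int (\<sigma> r)), mv)"
    and "int v = (case mv of MoveLeft \<Rightarrow> int (\<sigma> r) - 1 | Stay \<Rightarrow> int (\<sigma> r) | MoveRight \<Rightarrow> int (\<sigma> r) + 1)"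
  shows "crun (Act s r g) x out \<sigma> 1 (\<sigma>(r := v))"
proof -
  have "(conf x out \<sigma>)(r := act_tape (g (read_tape (conf x out \<sigma> s)) (read_tape (conf x out \<sigma> r)))
      (conf x out \<sigma> r)) = conf x out (\<sigma>(r := v))"
    using assms by (auto simp: fun_eq_iff read_conf act_tape_def conf_def read_tape_def split: move.splits)
  then show ?thesis using runs_Act[of s r g "conf x out \<sigma>"] by simp
qed

lemma run_inc: "r \<noteq> 0 \<Longrightarrow> crun (incr r) x out \<sigma> 1 (\<sigma>(r := Suc (\<sigma> r)))"
  unfolding incr_def by (rule run_Act[where mv = MoveRight]) auto

lemma run_dec: "r \<noteq> 0 \<Longrightarrow> crun (decr r) x out \<sigma> 1 (\<sigma>(r := \<sigma> r - 1))"
  unfolding decr_def by (rule run_Act[where mv = "if \<sigma> r = 0 then Stay else MoveLeft"]) auto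

lemma run_Seq:
  "run P x out \<sigma> t1 out1 \<sigma>1 \<Longrightarrow> run Q x out1 \<sigma>1 t2 out2 \<sigma>2 \<Longrightarrow>
    run (Seq P Q) x out \<sigma> (t1 + t2 + 1) out2 \<sigma>2"
  by (rule runs_Seq)

lemma run_loop:
  assumes "r \<noteq> 0" "S 0 = \<sigma>" "O' 0 = out" "S n = \<sigma>'" "O' n = out'"
    and "\<And>k. k < n \<Longrightarrow> S k r \<noteq> 0" "S n r = 0"
    and "\<And>k. k < n \<Longrightarrow> run P x (O' k) (S k) t (O' (Suc k)) (S (Suc k))"
  shows "run (while_pos r P) x out \<sigma> (n * (t + 2) + 1) out' \<sigma>'"
  using runs_loop[where S = "\<lambda>k. conf x (O' k) (S k)" and r = r and b = "\<lambda>a. a \<noteq> 3" and n = n and P = P and t = t]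
    assms by (simp add: read_conf)

lemma crun_loop:
  assumes "r \<noteq> 0" "S 0 = \<sigma>" "S n = \<sigma>'"
    and "\<And>k. k < n \<Longrightarrow> S k r \<noteq> 0" "S n r = 0"
    and "\<And>k. k < n \<Longrightarrow> crun P x out (S k) t (S (Suc k))"
  shows "crun (while_pos r P) x out \<sigma> (n * (t + 2) + 1) \<sigma>'"
  by (rule run_loop[where S = S and O' = "\<lambda>_. out"]) (use assms in auto)

lemma crun_eq: "crun P x out \<sigma> t \<sigma>' \<Longrightarrow> t \<le> t' \<Longrightarrow> \<sigma>' = \<sigma>'' \<Longrightarrow> crun P x out \<sigma> t' \<sigma>''"
  using runs_mono by blast

definition "clear r = while_pos r (decr r)"
definition "move a b = while_pos a (Seq (decr a) (incr b))"
text \<open>The scratch counter \<open>c\<close> takes a second copy while \<open>a\<close> is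
  emptied, and gives it back; it has to be zero beforehand.\<close>

definition "copy a b c = Seq (while_pos a (Seq (decr a) (Seq (incr b) (incr c)))) (move c a)"

lemma prog_wf_clear [simp]: "prog_wf K (clear r) \<longleftrightarrow> r < K" by (auto simp: clear_def)
lemma prog_wf_move [simp]: "prog_wf K (move a b) \<longleftrightarrow> a < K \<and> b < K" by (auto simp: move_def)
lemma prog_wf_copy [simp]: "prog_wf K (copy a b c) \<longleftrightarrow> a < K \<and> b < K \<and> c < K" by (auto simp: copy_def)

lemma run_clear: "r \<noteq> 0 \<Longrightarrow> crun (clear r) x out \<sigma> (\<sigma> r * 3 + 1) (\<sigma>(r := 0))"
  unfolding clear_def
  by (rule crun_eq, rule crun_loop[where S = "\<lambda>k. \<sigma>(r := \<sigma> r - k)" and n = "\<sigma> r" and t = 1])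
     (auto intro!: crun_eq[OF run_dec])

lemma run_move:
  assumes "a \<noteq> 0" "b \<noteq> 0" "a \<noteq> b"
  shows "crun (move a b) x out \<sigma> (\<sigma> a * 5 + 1) (\<sigma>(a := 0, b := \<sigma> b + \<sigma> a))"
  unfolding move_def
  by (rule crun_eq, rule crun_loop[where S = "\<lambda>k. \<sigma>(a := \<sigma> a - k, b := \<sigma> b + k)" and n = "\<sigma> a" and t = 3])
     (use assms in \<open>auto intro!: crun_eq[OF run_Seq[OF run_dec run_inc]]\<close>)

lemma run_copy:
  assumes "a \<noteq> 0" "b \<noteq> 0" "c \<noteq> 0" "distinct [a, b, c]" "\<sigma> c = 0"
  shows "crun (copy a b c) x out \<sigma> (\<sigma> a * 12 + 3) (\<sigma>(b := \<sigma> b + \<sigma> a))"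
proof -
  have "crun (while_pos a (Seq (decr a) (Seq (incr b) (incr c)))) x out \<sigma> (\<sigma> a * 7 + 1)
      (\<sigma>(a := 0, b := \<sigma> b + \<sigma> a, c := \<sigma> a))"
    by (rule crun_eq, rule crun_loop[where S = "\<lambda>k. \<sigma>(a := \<sigma> a - k, b := \<sigma> b + k, c := k)" and n = "\<sigma> a" and t = 5])
       (use assms in \<open>auto intro!: crun_eq[OF run_Seq[OF run_dec run_Seq[OF run_inc run_inc]]]\<close>)
  note run_Seq[OF this run_move[of c a]]
  then show ?thesis unfolding copy_def
    by (rule crun_eq) (use assms in \<open>auto simp: fun_eq_iff\<close>)
qed

section \<open>Computable functions\<close>

definition pbounded :: "(nat \<Rightarrow> nat) \<Rightarrow> bool" where
  "pbounded T \<longleftrightarrow> (\<exists>p::nat poly. \<forall>n. T n \<le> poly p n)"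

lemma pboundedE:
  assumes "pbounded T" obtains p :: "nat poly" where "\<And>n. T n \<le> poly p n"
  using assms by (auto simp: pbounded_def)

lemma pbounded_const [intro, simp]: "pbounded (\<lambda>_. c)"
  unfolding pbounded_def by (rule exI[of _ "[:c:]"]) simp

lemma pbounded_id [intro, simp]: "pbounded (\<lambda>n. n)"
  unfolding pbounded_def by (rule exI[of _ "[:0, 1:]"]) simp

lemma pbounded_poly [intro, simp]: "pbounded (poly p)"
  unfolding pbounded_def by blast

lemma pbounded_add [intro, simp]:
  assumes "pbounded S" "pbounded T" shows "pbounded (\<lambda>n. S n + T n)"
proof -
  obtain p q where "\<And>n. S n \<le> poly p n" "\<And>n. T n \<le> poly q n"
    using assms by (meson pboundedE)
  then show ?thesis unfolding pbounded_def
    by (intro exI[of _ "p + q"]) (simp add: add_mono)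
qed

lemma pbounded_mult [intro, simp]:
  assumes "pbounded S" "pbounded T" shows "pbounded (\<lambda>n. S n * T n)"
proof -
  obtain p q where "\<And>n. S n \<le> poly p n" "\<And>n. T n \<le> poly q n"
    using assms by (meson pboundedE)
  then show ?thesis unfolding pbounded_def
    by (intro exI[of _ "p * q"]) (simp add: mult_mono)
qed

lemma pbounded_Suc [intro, simp]: "pbounded T \<Longrightarrow> pbounded (\<lambda>n. Suc (T n))"
  using pbounded_add[of T "\<lambda>_. 1"] by simp

lemma poly_nat_mono: "m \<le> n \<Longrightarrow> poly (p :: nat poly) m \<le> poly p n"
  by (induction p) (auto intro!: add_mono mult_mono)

lemma pbounded_comp [intro]:
  assumes "pbounded S" "pbounded T" shows "pbounded (\<lambda>n. S (T n))"
proof -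
  obtain p q where pq: "\<And>n. S n \<le> poly p n" "\<And>n. T n \<le> poly q n"
    using assms by (meson pboundedE)
  have "S (T n) \<le> poly (p \<circ>\<^sub>p q) n" for n
    using le_trans[OF pq(1)[of "T n"] poly_nat_mono[OF pq(2)[of n]]] by (simp add: poly_pcompose)
  then show ?thesis unfolding pbounded_def by blast
qed

text \<open>Functions of the input word and of two numbers, which are held in counters \<open>3\<close> and \<open>4\<close>;
  counter \<open>2\<close> holds the length of the input, counters \<open>5\<close> and \<open>6\<close> are reserved for loops.\<close>

definition computes where
  "computes m P T f \<longleftrightarrow> (\<exists>K. prog_wf K P) \<and> pbounded T \<and>
     (\<forall>x out \<sigma>. \<sigma> 1 = 0 \<longrightarrow> \<sigma> 2 = length x \<longrightarrow> (\<forall>r\<ge>m. \<sigma> r = 0) \<longrightarrow>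
        crun P x out \<sigma> (T (length x + \<sigma> 3 + \<sigma> 4)) (\<sigma>(m := f x (\<sigma> 3) (\<sigma> 4))))"

text \<open>The target \<open>m\<close> is arbitrary so that the arguments of an operation can be
  evaluated into \<open>m + 1\<close> and \<open>m + 2\<close>. The bound on values belongs to the
  notion because counters are unary: the time of a later operation depends on the size of its
  arguments.\<close>

definition computable :: "(bool list \<Rightarrow> nat \<Rightarrow> nat \<Rightarrow> nat) \<Rightarrow> bool" where
  "computable f \<longleftrightarrow> (\<exists>B. pbounded B \<and> (\<forall>x i j. f x i j \<le> B (length x + i + j))) \<and>
     (\<forall>m\<ge>7. \<exists>P T. computes m P T f)"

definition decidable :: "(bool list \<Rightarrow> nat \<Rightarrow> nat \<Rightarrow> bool) \<Rightarrow> bool" where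
  "decidable b \<longleftrightarrow> computable (\<lambda>x i j. of_bool (b x i j))"

lemma computesD:
  "computes m P T f \<Longrightarrow> \<sigma> 1 = 0 \<Longrightarrow> \<sigma> 2 = length x \<Longrightarrow> (\<And>r. r \<ge> m \<Longrightarrow> \<sigma> r = 0) \<Longrightarrow>
     crun P x out \<sigma> (T (length x + \<sigma> 3 + \<sigma> 4)) (\<sigma>(m := f x (\<sigma> 3) (\<sigma> 4)))"
  by (auto simp: computes_def)

lemma prog_wf_Max: "prog_wf K P \<Longrightarrow> prog_wf (max K K') P" "prog_wf K P \<Longrightarrow> prog_wf (max K' K) P"
  by (auto elim: prog_wf_mono)

lemma computesI:
  assumes "\<exists>K. prog_wf K P" "pbounded T"
    and "\<And>x out \<sigma>. \<sigma> 1 = 0 \<Longrightarrow> \<sigma> 2 = length x \<Longrightarrow> \<forall>r\<ge>m. \<sigma> r = 0 \<Longrightarrow>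
        crun P x out \<sigma> (T (length x + \<sigma> 3 + \<sigma> 4)) (\<sigma>(m := f x (\<sigma> 3) (\<sigma> 4)))"
  shows "computes m P T f"
  using assms by (auto simp: computes_def)

section \<open>Arithmetic on unary counters\<close>

lemma computable_const [intro, simp]: "computable (\<lambda>x i j. c)"
  unfolding computable_def
proof (intro conjI allI impI)
  fix m :: nat assume m: "m \<ge> 7"
  show "\<exists>P T. computes m P T (\<lambda>x i j. c)"
  proof (induction c)
    case 0
    have "computes m Done (\<lambda>_. 0) (\<lambda>x i j. 0)"
      by (rule computesI) (auto intro!: crun_eq[OF runs_Done])
    then show ?case by blast
  next
    case (Suc c)
    then obtain P T where P: "computes m P T (\<lambda>x i j. c)" by blast
    have "computes m (Seq P (incr m)) (\<lambda>n. T n + 2) (\<lambda>x i j. Suc c)"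
    proof (rule computesI)
      show "\<exists>K. prog_wf K (Seq P (incr m))"
      proof -
        obtain K where "prog_wf K P" using P by (auto simp: computes_def)
        then have "prog_wf (max K (Suc m)) (Seq P (incr m))" by (auto intro: prog_wf_Max)
        then show ?thesis by blast
      qed
      show "pbounded (\<lambda>n. T n + 2)" using P by (auto simp: computes_def)
      fix x out :: "bool list" and \<sigma> assume "\<sigma> 1 = 0" "\<sigma> 2 = length x" "\<forall>r\<ge>m. \<sigma> r = (0::nat)"
      from computesD[OF P this(1,2)] this(3)
      show "crun (Seq P (incr m)) x out \<sigma> (T (length x + \<sigma> 3 + \<sigma> 4) + 2) (\<sigma>(m := Suc c))"
        using m by (intro crun_eq[OF run_Seq[OF _ run_inc]]) auto
    qed
    then show ?case by blast
  qed
qed (auto intro!: exI[of _ "\<lambda>_. c"])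

lemma computable_var:
  fixes f :: "bool list \<Rightarrow> nat \<Rightarrow> nat \<Rightarrow> nat"
  assumes "v \<in> {2, 3, 4 :: nat}"
    and "f = (\<lambda>x i j. if v = 2 then length x else if v = 3 then i else j)"
  shows "computable f"
  unfolding computable_def
proof (intro conjI allI impI)
  fix m :: nat assume m: "m \<ge> 7"
  have "computes m (copy v m (Suc m)) (\<lambda>n. n * 12 + 3) f"
  proof (rule computesI)
    show "\<exists>K. prog_wf K (copy v m (Suc m))" using m assms(1) by (auto intro!: exI[of _ "Suc (Suc m)"])
    fix x out :: "bool list" and \<sigma> assume "\<sigma> 1 = 0" "\<sigma> 2 = length x" "\<forall>r\<ge>m. \<sigma> r = (0::nat)"
    then show "crun (copy v m (Suc m)) x out \<sigma> ((length x + \<sigma> 3 + \<sigma> 4) * 12 + 3) (\<sigma>(m := f x (\<sigma> 3) (\<sigma> 4)))"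
      using m assms by (intro crun_eq[OF run_copy]) auto
  qed auto
  then show "\<exists>P T. computes m P T f" by blast
qed (use assms in \<open>auto intro!: exI[of _ "\<lambda>n. n"]\<close>)

lemma computable_length [intro, simp]: "computable (\<lambda>x i j. length x)"
  by (rule computable_var[of 2]) auto
lemma computable_fst [intro, simp]: "computable (\<lambda>x i j. i)"
  by (rule computable_var[of 3]) auto
lemma computable_snd [intro, simp]: "computable (\<lambda>x i j. j)"
  by (rule computable_var[of 4]) auto

text \<open>\<open>H\<close> bounds both the value of the operation and the time of
  \<open>op\<close>; being monotone and preserving polynomial bounds, it turns bounds for the
  arguments into bounds for the result. \<open>op\<close> also clears the arguments, so that all
  counters above \<open>m\<close> are zero again.\<close>

lemma computable_binary:
  assumes f: "computable f" and g: "computable g"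
    and le: "\<And>x i j. h (f x i j) (g x i j) \<le> H (f x i j) (g x i j)"
    and H: "\<And>S T. pbounded S \<Longrightarrow> pbounded T \<Longrightarrow> pbounded (\<lambda>n. H (S n) (T n))"
      "\<And>a b a' b'. a \<le> a' \<Longrightarrow> b \<le> b' \<Longrightarrow> H a b \<le> H a' b'"
    and op: "\<And>m. m \<ge> 7 \<Longrightarrow> \<exists>K. prog_wf K (op m)"
      "\<And>m \<sigma> x i j out. m \<ge> 7 \<Longrightarrow> \<sigma> m = 0 \<Longrightarrow> \<sigma> (m + 1) = f x i j \<Longrightarrow> \<sigma> (m + 2) = g x i j \<Longrightarrow>
         \<forall>r\<ge>m+3. \<sigma> r = 0 \<Longrightarrow>
         crun (op m) x out \<sigma> (H (\<sigma> (m+1)) (\<sigma> (m+2))) (\<sigma>(m := h (\<sigma> (m + 1)) (\<sigma> (m + 2)), m + 1 := 0, m + 2 := 0))"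
  shows "computable (\<lambda>x i j. h (f x i j) (g x i j))"
proof -
  obtain Bf Bg where Bf: "pbounded Bf" "\<And>x i j. f x i j \<le> Bf (length x + i + j)"
    and Bg: "pbounded Bg" "\<And>x i j. g x i j \<le> Bg (length x + i + j)"
    using f g by (auto simp: computable_def)
  define B where "B n = H (Bf n) (Bg n)" for n
  have pB: "pbounded B" unfolding B_def by (rule H(1)) (fact Bf Bg)+
  have HB: "H (f x i j) (g x i j) \<le> B (length x + i + j)" for x i j
    unfolding B_def by (rule H(2)) (fact Bf Bg)+
  show ?thesis
    unfolding computable_def
  proof (intro conjI allI impI)
    show "\<exists>B. pbounded B \<and> (\<forall>x i j. h (f x i j) (g x i j) \<le> B (length x + i + j))"
      using pB le_trans[OF le HB] by blast
    fix m :: nat assume m: "m \<ge> 7"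
    obtain P S where P: "computes (m+1) P S f"
      using f m by (auto simp: computable_def dest: spec[of _ "m + 1"])
    obtain Q T where Q: "computes (m+2) Q T g"
      using g m by (auto simp: computable_def dest: spec[of _ "m + 2"])
    have "computes m (Seq (Seq P Q) (op m)) (\<lambda>n. (S n + T n + 1) + B n + 1)
        (\<lambda>x i j. h (f x i j) (g x i j))"
    proof (rule computesI)
      obtain K1 K2 K3 where "prog_wf K1 P" "prog_wf K2 Q" "prog_wf K3 (op m)"
        using P Q op(1)[OF m] by (auto simp: computes_def)
      then show "\<exists>K. prog_wf K (Seq (Seq P Q) (op m))"
        by (auto intro!: exI[of _ "max K1 (max K2 K3)"] intro: prog_wf_Max)
      show "pbounded (\<lambda>n. S n + T n + 1 + B n + 1)"
        using P Q pB by (intro pbounded_add) (auto simp: computes_def)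
      fix x out :: "bool list" and \<sigma> :: "nat \<Rightarrow> nat"
      assume \<sigma>: "\<sigma> 1 = 0" "\<sigma> 2 = length x" "\<forall>r\<ge>m. \<sigma> r = 0"
      let ?a = "f x (\<sigma> 3) (\<sigma> 4)" and ?b = "g x (\<sigma> 3) (\<sigma> 4)" and ?n = "length x + \<sigma> 3 + \<sigma> 4"
      have 1: "crun P x out \<sigma> (S ?n) (\<sigma>(m + 1 := ?a))"
        using computesD[OF P \<sigma>(1,2)] \<sigma>(3) by simp
      have 2: "crun Q x out (\<sigma>(m + 1 := ?a)) (T ?n) (\<sigma>(m + 1 := ?a, m + 2 := ?b))"
        using computesD[OF Q, of "\<sigma>(m + 1 := ?a)" x out] \<sigma> m by simp
      have 3: "crun (op m) x out (\<sigma>(m + 1 := ?a, m + 2 := ?b)) (H ?a ?b) (\<sigma>(m := h ?a ?b))"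
        using m \<sigma>(3)
        by (intro crun_eq[OF op(2)[OF m, where i = "\<sigma> 3" and j = "\<sigma> 4"]]) (auto simp: fun_eq_iff)
      show "crun (Seq (Seq P Q) (op m)) x out \<sigma> (S ?n + T ?n + 1 + B ?n + 1) (\<sigma>(m := h ?a ?b))"
        using HB[of x "\<sigma> 3" "\<sigma> 4"] by (intro crun_eq[OF run_Seq[OF run_Seq[OF 1 2] 3]]) auto
    qed
    then show "\<exists>P T. computes m P T (\<lambda>x i j. h (f x i j) (g x i j))" by blast
  qed
qed

lemma computable_add [intro, simp]:
  assumes "computable f" "computable g"
  shows "computable (\<lambda>x i j. f x i j + g x i j)"
proof (rule computable_binary[where h = "(+)", OF assms, where H = "\<lambda>a b. a * 5 + b * 5 + 3"
      and op = "\<lambda>m. Seq (move (m + 1) m) (move (m + 2) m)"])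
  show "\<exists>K. prog_wf K (Seq (move (m + 1) m) (move (m + 2) m))" for m
    by (auto intro!: exI[of _ "m + 3"])
  show "crun (Seq (move (m + 1) m) (move (m + 2) m)) x out \<sigma> (\<sigma> (m + 1) * 5 + \<sigma> (m + 2) * 5 + 3)
        (\<sigma>(m := \<sigma> (m + 1) + \<sigma> (m + 2), m + 1 := 0, m + 2 := 0))"
    if "m \<ge> 7" "\<sigma> m = 0" for m x out \<sigma>
    using that by (intro crun_eq[OF run_Seq[OF run_move run_move]]) auto
qed auto

lemma computable_Suc [intro, simp]: "computable f \<Longrightarrow> computable (\<lambda>x i j. Suc (f x i j))"
  using computable_add[of f "\<lambda>x i j. 1"] by simp

lemma computable_diff [intro, simp]:
  assumes "computable f" "computable g"
  shows "computable (\<lambda>x i j. f x i j - g x i j)"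
proof (rule computable_binary[where h = "(-)", OF assms, where H = "\<lambda>a b. a * 5 + b * 5 + 3"
      and op = "\<lambda>m. Seq (move (m + 1) m) (while_pos (m + 2) (Seq (decr (m + 2)) (decr m)))"])
  show "\<exists>K. prog_wf K (Seq (move (m + 1) m) (while_pos (m + 2) (Seq (decr (m + 2)) (decr m))))" for m
    by (auto intro!: exI[of _ "m + 3"])
  show "crun (Seq (move (m + 1) m) (while_pos (m + 2) (Seq (decr (m + 2)) (decr m)))) x out \<sigma>
        (\<sigma> (m + 1) * 5 + \<sigma> (m + 2) * 5 + 3)
        (\<sigma>(m := \<sigma> (m + 1) - \<sigma> (m + 2), m + 1 := 0, m + 2 := 0))"
    if m: "m \<ge> 7" "\<sigma> m = 0" for m x out \<sigma>
  proof -
    have "crun (while_pos (m + 2) (Seq (decr (m + 2)) (decr m))) x out (\<sigma>(m := \<sigma> (m + 1), m + 1 := 0))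
       (\<sigma> (m + 2) * 5 + 1) (\<sigma>(m := \<sigma> (m + 1) - \<sigma> (m + 2), m + 1 := 0, m + 2 := 0))"
      by (rule crun_eq, rule crun_loop[where S = "\<lambda>k. \<sigma>(m := \<sigma> (m + 1) - k, m + 1 := 0, m + 2 := \<sigma> (m + 2) - k)"
            and n = "\<sigma> (m + 2)" and t = 3])
         (use m in \<open>auto intro!: crun_eq[OF run_Seq[OF run_dec run_dec]]\<close>)
    moreover have "crun (move (m + 1) m) x out \<sigma> (\<sigma> (m + 1) * 5 + 1) (\<sigma>(m := \<sigma> (m + 1), m + 1 := 0))"
      by (rule crun_eq[OF run_move]) (use m in auto)
    ultimately show ?thesis
      by (intro crun_eq[OF run_Seq]) auto
  qed
qed auto

lemma computable_mult [intro, simp]: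
  assumes "computable f" "computable g"
  shows "computable (\<lambda>x i j. f x i j * g x i j)"
proof (rule computable_binary[where h = "(*)", OF assms, where H = "\<lambda>a b. a * (b * 12 + 7) + b * 3 + 3"
      and op = "\<lambda>m. Seq (while_pos (m + 1) (Seq (decr (m + 1)) (copy (m + 2) m (m + 3)))) (clear (m + 2))"])
  show "\<exists>K. prog_wf K (Seq (while_pos (m + 1) (Seq (decr (m + 1)) (copy (m + 2) m (m + 3)))) (clear (m + 2)))" for m
    by (auto intro!: exI[of _ "m + 4"])
  show "crun (Seq (while_pos (m + 1) (Seq (decr (m + 1)) (copy (m + 2) m (m + 3)))) (clear (m + 2))) x out \<sigma>
        (\<sigma> (m + 1) * (\<sigma> (m + 2) * 12 + 7) + \<sigma> (m + 2) * 3 + 3)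
        (\<sigma>(m := \<sigma> (m + 1) * \<sigma> (m + 2), m + 1 := 0, m + 2 := 0))"
    if m: "m \<ge> 7" "\<sigma> m = 0" "\<forall>r\<ge>m + 3. \<sigma> r = 0" for m x out \<sigma>
  proof -
    have "crun (while_pos (m + 1) (Seq (decr (m + 1)) (copy (m + 2) m (m + 3)))) x out \<sigma>
       (\<sigma> (m + 1) * (\<sigma> (m + 2) * 12 + 7) + 1) (\<sigma>(m := \<sigma> (m + 1) * \<sigma> (m + 2), m + 1 := 0))"
      by (rule crun_eq, rule crun_loop[where S = "\<lambda>k. \<sigma>(m := k * \<sigma> (m + 2), m + 1 := \<sigma> (m + 1) - k)"
            and n = "\<sigma> (m + 1)" and t = "\<sigma> (m + 2) * 12 + 5"])
         (use m in \<open>auto intro!: crun_eq[OF run_Seq[OF run_dec run_copy]]\<close>)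
    then show ?thesis
      by (intro crun_eq[OF run_Seq[OF _ run_clear]]) (use m in auto)
  qed
  show "f x i j * g x i j \<le> f x i j * (g x i j * 12 + 7) + g x i j * 3 + 3" for x i j
    by (simp add: algebra_simps)
qed (auto intro!: add_mono mult_mono)

text \<open>Division by counting: after \<open>k\<close> decrements of the dividend,
  \<open>S\<close> holds the quotient, the rest of the dividend, and the divisor split into an
  unspent and a spent part. When the unspent part reaches zero, the quotient grows and the divisor
  is restored. Here \<open>while_zero\<close> acts as a conditional, since a positive divisor stops
  it after one round.\<close>

lemma computable_div [intro, simp]:
  assumes "computable f" "computable g" "\<And>x i j. g x i j > 0"
  shows "computable (\<lambda>x i j. f x i j div g x i j)"
proof -
  define body where "body m = Seq (decr (m + 1)) (Seq (decr (m + 2)) (Seq (incr (m + 3))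
    (while_zero (m + 2) (Seq (incr m) (move (m + 3) (m + 2))))))" for m
  define op where "op m = Seq (while_pos (m + 1) (body m)) (Seq (clear (m + 2)) (clear (m + 3)))" for m
  define S where "S \<sigma> m a y k = \<sigma>(m := k div y, m + 1 := a - k, m + 2 := y - k mod y, m + 3 := k mod y)"
    for \<sigma> :: "nat \<Rightarrow> nat" and m a y k :: nat
  have step: "crun (body m) x out (S \<sigma> m a y k) (y * 5 + 15) (S \<sigma> m a y (Suc k))"
    if m: "m \<ge> 7" and y: "y > 0" for m x out \<sigma> k y and a :: nat
  proof -
    let ?s = "\<lambda>b r. \<sigma>(m := k div y, m + 1 := a - Suc k, m + 2 := b, m + 3 := r)"
    have 1: "crun (decr (m + 1)) x out (S \<sigma> m a y k) 1 (?s (y - k mod y) (k mod y))"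
      by (rule crun_eq[OF run_dec]) (auto simp: fun_eq_iff S_def)
    have 2: "crun (decr (m + 2)) x out (?s (y - k mod y) (k mod y)) 1 (?s (y - Suc (k mod y)) (k mod y))"
      by (rule crun_eq[OF run_dec]) (auto simp: fun_eq_iff)
    have 3: "crun (incr (m + 3)) x out (?s (y - Suc (k mod y)) (k mod y)) 1 (?s (y - Suc (k mod y)) (Suc (k mod y)))"
      by (rule crun_eq[OF run_inc]) (auto simp: fun_eq_iff)
    have 4: "crun (while_zero (m + 2) (Seq (incr m) (move (m + 3) (m + 2)))) x out (?s (y - Suc (k mod y)) (Suc (k mod y)))
       (y * 5 + 6) (S \<sigma> m a y (Suc k))"
    proof (cases "Suc (k mod y) = y")
      case True
      have "Suc k mod y = 0" "Suc k div y = Suc (k div y)"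
        using True by (auto simp: mod_Suc div_Suc)
      moreover have "crun (Seq (incr m) (move (m + 3) (m + 2))) x out (?s (y - Suc (k mod y)) (Suc (k mod y))) (y * 5 + 3)
          (\<sigma>(m := Suc (k div y), m + 1 := a - Suc k, m + 2 := y, m + 3 := 0))"
        by (rule crun_eq[OF run_Seq[OF run_inc run_move]]) (use m True in \<open>auto simp: fun_eq_iff\<close>)
      ultimately show ?thesis
        using True y m by (intro crun_eq[OF runs_While_True[OF _ _ runs_While_False]]) (auto simp: read_conf S_def)
    next
      case False
      then have "Suc (k mod y) < y" using y by (metis Suc_lessI mod_less_divisor)
      then have "Suc k mod y = Suc (k mod y)" "Suc k div y = k div y"
        by (auto simp: mod_Suc div_Suc)
      then show ?thesis
        using \<open>Suc (k mod y) < y\<close> by (intro crun_eq[OF runs_While_False]) (auto simp: read_conf S_def)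
    qed
    show ?thesis unfolding body_def
      by (rule crun_eq[OF run_Seq[OF 1 run_Seq[OF 2 run_Seq[OF 3 4]]]]) auto
  qed
  show ?thesis
  proof (rule computable_binary[where h = "(div)", OF assms(1,2), where H = "\<lambda>a b. a * (b * 5 + 17) + b * 10 + 20" and op = op])
    show "\<exists>K. prog_wf K (op m)" for m
      by (auto simp: op_def body_def intro!: exI[of _ "m + 4"])
    show "crun (op m) x out \<sigma>
          (\<sigma> (m + 1) * (\<sigma> (m + 2) * 5 + 17) + \<sigma> (m + 2) * 10 + 20)
          (\<sigma>(m := \<sigma> (m + 1) div \<sigma> (m + 2), m + 1 := 0, m + 2 := 0))"
      if m: "m \<ge> 7" "\<sigma> m = 0" "\<forall>r\<ge>m + 3. \<sigma> r = 0" "\<sigma> (m + 2) = g x i j" for m x i j out \<sigma>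
    proof -
      define a y where "a = \<sigma> (m + 1)" and "y = \<sigma> (m + 2)"
      have y: "y > 0" using assms(3) m(4) by (simp add: y_def)
      have "crun (while_pos (m + 1) (body m)) x out \<sigma> (a * (y * 5 + 17) + 1) (S \<sigma> m a y a)"
        by (rule crun_eq, rule crun_loop[where S = "S \<sigma> m a y" and n = a and t = "y * 5 + 15", OF _ _ refl])
           (use m y step in \<open>auto simp: S_def a_def y_def fun_eq_iff\<close>)
      note r = run_Seq[OF this run_Seq[OF run_clear run_clear]]
      have "a mod y < y" "y - a mod y \<le> y" using y by auto
      then show ?thesis unfolding op_def
        by (intro crun_eq[OF r]) (use m in \<open>auto simp: S_def fun_eq_iff a_def y_def algebra_simps\<close>)
    qed
    show "f x i j div g x i j \<le> f x i j * (g x i j * 5 + 17) + g x i j * 10 + 20" for x i j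
      by (rule order_trans[OF div_le_dividend]) (simp add: algebra_simps)
  qed (auto intro!: add_mono mult_mono)
qed

lemma computable_mod [intro, simp]:
  assumes "computable f" "computable g" "\<And>x i j. g x i j > 0"
  shows "computable (\<lambda>x i j. f x i j mod g x i j)"
  unfolding modulo_nat_def using assms by (intro computable_diff computable_mult computable_div)

text \<open>Counter \<open>1\<close> is moved onto the queried cell and the symbol there is
  transferred to \<open>m\<close>. An index out of range meets a blank and yields false.\<close>

lemma decidable_input [intro, simp]:
  assumes f: "computable f"
  shows "decidable (\<lambda>x i j. f x i j < length x \<and> x ! f x i j)"
  unfolding decidable_def computable_def
proof (intro conjI allI impI)
  fix m :: nat assume m: "m \<ge> 7"
  let ?h = "\<lambda>x i j. of_bool (f x i j < length x \<and> x ! f x i j)"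
  obtain P S where P: "computes m P S f"
    using f m by (auto simp: computable_def)
  obtain B where B: "pbounded B" "\<And>x i j. f x i j \<le> B (length x + i + j)"
    using f by (auto simp: computable_def)
  define get where "get = Act 1 m (\<lambda>a b. if a = 2 then (b, MoveRight) else (b, Stay))"
  have "computes m (Seq P (Seq (move m 1) (Seq (incr 1) (Seq get (clear 1))))) (\<lambda>n. S n + B n * 8 + 20) ?h"
  proof (rule computesI)
    obtain K where "prog_wf K P" using P by (auto simp: computes_def)
    then show "\<exists>K. prog_wf K (Seq P (Seq (move m 1) (Seq (incr 1) (Seq get (clear 1)))))"
      using m by (auto simp: get_def intro!: exI[of _ "max K (Suc m)"] intro: prog_wf_Max)
    show "pbounded (\<lambda>n. S n + B n * 8 + 20)"
      using P B by (auto simp: computes_def)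
    fix x out :: "bool list" and \<sigma> :: "nat \<Rightarrow> nat"
    assume \<sigma>: "\<sigma> 1 = 0" "\<sigma> 2 = length x" "\<forall>r\<ge>m. \<sigma> r = 0"
    let ?a = "f x (\<sigma> 3) (\<sigma> 4)" and ?b = "?h x (\<sigma> 3) (\<sigma> 4) :: nat" and ?n = "length x + \<sigma> 3 + \<sigma> 4"
    have 1: "crun P x out \<sigma> (S ?n) (\<sigma>(m := ?a))"
      using computesD[OF P \<sigma>(1,2)] \<sigma>(3) by simp
    have 2: "crun (move m 1) x out (\<sigma>(m := ?a)) (?a * 5 + 1) (\<sigma>(1 := ?a))"
      using m \<sigma> by (intro crun_eq[OF run_move]) (auto simp: fun_eq_iff)
    \<comment> \<open>Bit number \<open>?a\<close> is stored in cell \<open>?a + 1\<close>, as cell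
      \<open>0\<close> holds the mark.\<close>
    have 3: "crun (incr 1) x out (\<sigma>(1 := ?a)) 1 (\<sigma>(1 := Suc ?a))"
      by (intro crun_eq[OF run_inc]) auto
    have "mem x 1 (int (Suc ?a)) = 2 \<longleftrightarrow> ?a < length x \<and> x ! ?a"
      by (auto simp: mem_def word_content_def)
    then have 4: "crun get x out (\<sigma>(1 := Suc ?a)) 1 (\<sigma>(1 := Suc ?a, m := ?b))"
      unfolding get_def using m \<sigma>(3)
      by (intro run_Act[where mv = "if ?a < length x \<and> x ! ?a then MoveRight else Stay"]) auto
    have 5: "crun (clear 1) x out (\<sigma>(1 := Suc ?a, m := ?b)) (Suc ?a * 3 + 1) (\<sigma>(m := ?b))"
      using m \<sigma> by (intro crun_eq[OF run_clear]) (auto simp: fun_eq_iff)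
    show "crun (Seq P (Seq (move m 1) (Seq (incr 1) (Seq get (clear 1))))) x out \<sigma> (S ?n + B ?n * 8 + 20) (\<sigma>(m := ?b))"
      using B(2)[of x "\<sigma> 3" "\<sigma> 4"]
      by (intro crun_eq[OF run_Seq[OF 1 run_Seq[OF 2 run_Seq[OF 3 run_Seq[OF 4 5]]]]]) auto
  qed
  then show "\<exists>P T. computes m P T ?h" by blast
qed (auto intro!: exI[of _ "\<lambda>_. 1"])

lemma computable_poly [intro, simp]: "computable f \<Longrightarrow> computable (\<lambda>x i j. poly p (f x i j))"
  by (induction p) auto

section \<open>Boolean connectives, comparisons and case distinctions\<close>

lemma decidable_conj [intro, simp]:
  "decidable b \<Longrightarrow> decidable c \<Longrightarrow> decidable (\<lambda>x i j. b x i j \<and> c x i j)"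
  using computable_mult unfolding decidable_def of_bool_conj by blast

lemma decidable_not [intro, simp]:
  assumes "decidable b" shows "decidable (\<lambda>x i j. \<not> b x i j)"
proof -
  have "(\<lambda>x i j. of_bool (\<not> b x i j)) = (\<lambda>x i j. 1 - of_bool (b x i j) :: nat)"
    by (auto simp: fun_eq_iff)
  then show ?thesis using assms unfolding decidable_def by auto
qed

lemma decidable_disj [intro, simp]:
  assumes "decidable b" "decidable c" shows "decidable (\<lambda>x i j. b x i j \<or> c x i j)"
  using decidable_not[OF decidable_conj[OF decidable_not[OF assms(1)] decidable_not[OF assms(2)]]]
  by simp

lemma decidable_imp [intro, simp]:
  assumes "decidable b" "decidable c" shows "decidable (\<lambda>x i j. b x i j \<longrightarrow> c x i j)"
  unfolding imp_conv_disj using assms by (intro decidable_disj decidable_not)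

lemma decidable_less [intro, simp]:
  assumes "computable f" "computable g" shows "decidable (\<lambda>x i j. f x i j < g x i j)"
proof -
  have "(\<lambda>x i j. of_bool (f x i j < g x i j)) = (\<lambda>x i j. 1 - (1 - (g x i j - f x i j)))"
    by (auto simp: fun_eq_iff)
  then show ?thesis using assms unfolding decidable_def by simp
qed

lemma decidable_le [intro, simp]:
  "computable f \<Longrightarrow> computable g \<Longrightarrow> decidable (\<lambda>x i j. f x i j \<le> g x i j)"
  unfolding linorder_not_less[symmetric] by auto

lemma decidable_eq [intro, simp]:
  assumes "computable f" "computable g" shows "decidable (\<lambda>x i j. f x i j = g x i j)"
  using decidable_conj[OF decidable_le[OF assms] decidable_le[OF assms(2,1)]]
  by (simp add: order_eq_iff)

lemma computable_If [intro, simp]: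
  assumes "decidable b" "computable f" "computable g"
  shows "computable (\<lambda>x i j. if b x i j then f x i j else g x i j)"
proof -
  have "(\<lambda>x i j. if b x i j then f x i j else g x i j) =
    (\<lambda>x i j. of_bool (b x i j) * f x i j + (1 - of_bool (b x i j)) * g x i j)"
    by (auto simp: fun_eq_iff)
  then show ?thesis using assms unfolding decidable_def by auto
qed

section \<open>Writing an adjacency matrix\<close>

lemma runs_eq: "runs P Ts t Ts' \<Longrightarrow> t \<le> t' \<Longrightarrow> Ts' = Ts'' \<Longrightarrow> runs P Ts t' Ts''"
  using runs_mono by blast

section \<open>Marking the counters and moving the input to the pointer tape\<close>

primrec marks :: "nat \<Rightarrow> prog" where
  "marks 0 = Done"
| "marks (Suc k) = Seq (marks k) (if k = 0 then Done else Act k k (\<lambda>_ _. (3, Stay)))"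

lemma prog_wf_marks [simp]: "prog_wf K (marks k) \<longleftrightarrow> k \<le> K \<or> k \<le> 1"
  by (induction k) auto

lemma runs_marks:
  "runs (marks K) Ts (2 * K)
     (\<lambda>r. if 0 < r \<and> r < K then ((fst (Ts r))(snd (Ts r) := 3), snd (Ts r)) else Ts r)"
proof (induction K)
  case 0
  then show ?case by (auto intro: runs_eq[OF runs_Done])
next
  case (Suc k)
  show ?case
  proof (cases "k = 0")
    case True
    then show ?thesis using runs_Seq[OF runs_Done runs_Done]
      by (auto intro!: runs_eq[OF runs_Seq[OF runs_Done runs_Done]] simp: fun_eq_iff)
  next
    case False
    then show ?thesis
      by (auto intro!: runs_eq[OF runs_Seq[OF Suc.IH runs_Act]] simp: fun_eq_iff act_tape_def)
  qed
qed

text \<open>From tape \<open>K\<close> on the marks are already present: these tapes lie outside the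
  machine and may be chosen.\<close>

definition start_tapes :: "bool list \<Rightarrow> nat \<Rightarrow> nat \<Rightarrow> tape" where
  "start_tapes x K r = (if r = 0 then (word_content x, 0) else if r < K then (word_content [], 0) else (mem x r, 0))"

text \<open>Snapshot after \<open>k\<close> symbols: tape \<open>0\<close> is erased on the fly,
  tape \<open>1\<close> receives the input shifted by one, counter \<open>2\<close> accumulates its
  length, and counter \<open>3\<close> remembers the way back, as tape \<open>0\<close> has no mark
  at its origin.\<close>

definition load_tapes :: "bool list \<Rightarrow> nat \<Rightarrow> nat \<Rightarrow> tape" where
  "load_tapes x k r =
     (if r = 0 then (\<lambda>i. if i < int k then 0 else word_content x i, int k)
      else if r = 1 then (\<lambda>i. if i = 0 then 3 else if i \<le> int k then word_content x (i - 1) else 0, int k + 1)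
      else (mem x r, if r = 2 \<or> r = 3 then int k else 0))"

definition rewind_tapes :: "bool list \<Rightarrow> nat \<Rightarrow> nat \<Rightarrow> tape" where
  "rewind_tapes x k r =
     (if r = 0 then (word_content [], int (length x) - int k)
      else (mem x r, if r = 1 then int (length x) + 1 else if r = 2 then int (length x)
         else if r = 3 then int (length x) - int k else 0))"

definition load_step :: prog where
  "load_step = Seq (Act 0 1 (\<lambda>a _. (a, MoveRight)))
     (Seq (incr 2) (Seq (incr 3) (Act 0 0 (\<lambda>_ _. (0, MoveRight)))))"

definition rewind_step :: prog where
  "rewind_step = Seq (decr 3) (Act 0 0 (\<lambda>_ _. (0, MoveLeft)))"

definition load :: "nat \<Rightarrow> prog" where
  "load K = Seq (marks K) (Seq (incr 1) (Seq (While 0 (\<lambda>a. a \<noteq> 0) load_step)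
     (Seq (while_pos 3 rewind_step) (clear 1))))"

lemma runs_load_step:
  assumes "k < length x"
  shows "runs load_step (load_tapes x k) 7 (load_tapes x (Suc k))"
  unfolding load_step_def incr_def
  by (rule runs_eq[OF runs_Seq[OF runs_Act runs_Seq[OF runs_Act runs_Seq[OF runs_Act runs_Act]]]])
     (use assms in \<open>auto simp: fun_eq_iff load_tapes_def act_tape_def read_tape_def word_content_def\<close>)

lemma runs_rewind_step:
  assumes "k < length x"
  shows "runs rewind_step (rewind_tapes x k) 3 (rewind_tapes x (Suc k))"
  unfolding rewind_step_def decr_def
  by (rule runs_eq[OF runs_Seq[OF runs_Act runs_Act]])
     (use assms in \<open>auto simp: fun_eq_iff rewind_tapes_def act_tape_def read_tape_def word_content_def\<close>)

lemma runs_load: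
  assumes "K \<ge> 4"
  shows "runs (load K) (start_tapes x K) (2 * K + length x * 17 + 20) (conf x [] ((\<lambda>_. 0)(2 := length x)))"
proof -
  define n where "n = length x"
  let ?S1 = "\<lambda>r. if r = 0 then (word_content x, 0) else if r = 1 then (\<lambda>i. if i = 0 then 3 else 0, 0)
    else (mem x r, 0 :: int)"
  have 1: "runs (marks K) (start_tapes x K) (2 * K) ?S1"
    by (rule runs_eq[OF runs_marks])
       (use assms in \<open>auto simp: fun_eq_iff start_tapes_def mem_def word_content_def\<close>)
  have 2: "runs (incr 1) ?S1 1 (load_tapes x 0)"
    unfolding incr_def by (rule runs_eq[OF runs_Act])
      (auto simp: fun_eq_iff load_tapes_def act_tape_def read_tape_def word_content_def)
  have 3: "runs (While 0 (\<lambda>a. a \<noteq> 0) load_step) (load_tapes x 0) (n * (7 + 2) + 1) (load_tapes x n)"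
    by (rule runs_loop, simp add: n_def load_tapes_def read_tape_def word_content_def,
        simp add: n_def runs_load_step, simp add: n_def load_tapes_def read_tape_def word_content_def)
  have eq: "load_tapes x n = rewind_tapes x 0"
    by (auto simp: fun_eq_iff n_def load_tapes_def rewind_tapes_def mem_def word_content_def)
  have 4: "runs (while_pos 3 rewind_step) (rewind_tapes x 0) (n * (3 + 2) + 1) (rewind_tapes x n)"
    by (rule runs_loop, simp add: n_def rewind_tapes_def read_tape_def,
        simp add: n_def runs_rewind_step, simp add: n_def rewind_tapes_def read_tape_def)
  have eq': "rewind_tapes x n = conf x [] ((\<lambda>_. 0)(2 := n, 1 := Suc n))"
    by (auto simp: fun_eq_iff n_def rewind_tapes_def conf_def)
  have 5: "runs (clear 1) (rewind_tapes x n) (Suc n * 3 + 1) (conf x [] ((\<lambda>_. 0)(2 := n)))"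
    unfolding eq' by (rule crun_eq[OF run_clear]) (auto simp: fun_eq_iff)
  show ?thesis unfolding load_def
    by (rule runs_eq[OF runs_Seq[OF 1 runs_Seq[OF 2 runs_Seq[OF 3[unfolded eq] runs_Seq[OF 4 5]]]]])
       (auto simp: n_def)
qed

lemma prog_wf_load [simp]: "K \<ge> 4 \<Longrightarrow> prog_wf K (load K)"
  by (auto simp: load_def load_step_def rewind_step_def)

definition emit :: "nat \<Rightarrow> prog" where
  "emit m = Act m 0 (\<lambda>a _. (if a = 3 then 1 else 2, MoveRight))"

lemma run_emit: "m \<noteq> 0 \<Longrightarrow> run (emit m) x out \<sigma> 1 (out @ [\<sigma> m \<noteq> 0]) \<sigma>"
  unfolding emit_def
  by (rule runs_eq[OF runs_Act])
     (auto simp: fun_eq_iff conf_def act_tape_def read_tape_def word_content_def nth_append)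

lemma run_eq: "run P x out \<sigma> t out' \<sigma>' \<Longrightarrow> t \<le> t' \<Longrightarrow> out' = out'' \<Longrightarrow> \<sigma>' = \<sigma>'' \<Longrightarrow>
    run P x out \<sigma> t' out'' \<sigma>''"
  using runs_mono by blast

text \<open>Counters \<open>3\<close> and \<open>4\<close> hold the indices of the current entry,
  \<open>5\<close> and \<open>6\<close> the numbers of rows and entries still to do, and
  \<open>7\<close> receives computed values. Every entry is evaluated from scratch; there are only
  polynomially many.\<close>

theorem poly_time_computable_matrix:
  assumes N: "computable (\<lambda>x i j. N x)" and E: "decidable E"
  shows "poly_time_computable 1 (\<lambda>ws. concat
    (map (\<lambda>i. map (\<lambda>j. E (ws ! 0) i j) [0..<N (ws ! 0)]) [0..<N (ws ! 0)]))"
proof -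
  obtain PN TN where PN: "computes 7 PN TN (\<lambda>x i j. N x)"
    using N by (auto simp: computable_def)
  obtain PE TE where PE: "computes 7 PE TE (\<lambda>x i j. of_bool (E x i j))"
    using E by (auto simp: computable_def decidable_def)
  obtain B0 where B0: "pbounded B0" "\<And>x i j :: nat. N x \<le> B0 (length x + i + j)"
    using N by (auto simp: computable_def)
  obtain B :: "nat poly" where B: "\<And>n. B0 n \<le> poly B n" using B0(1) pboundedE by blast
  obtain pN :: "nat poly" where pN: "\<And>n. TN n \<le> poly pN n"
    using PN pboundedE by (metis computes_def)
  obtain pE :: "nat poly" where pE: "\<And>n. TE n \<le> poly pE n"
    using PE pboundedE by (metis computes_def)
  have NB: "N x \<le> poly B (length x)" for x
    using B0(2)[of x 0 0] B[of "length x"] by simp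
  obtain KN KE where K: "prog_wf KN PN" "prog_wf KE PE"
    using PN PE by (auto simp: computes_def)
  define K where "K = max (max KN KE) 8"
  define row where "row x i = map (E x i) [0..<N x]" for x i
  define inner where "inner = Seq (decr 6) (Seq PE (Seq (emit 7) (Seq (clear 7) (incr 4))))"
  define outer where "outer = Seq (decr 5) (Seq PN (Seq (move 7 6)
    (Seq (while_pos 6 inner) (Seq (clear 4) (incr 3)))))"
  define P where "P = Seq (load K) (Seq PN (Seq (move 7 5) (while_pos 5 outer)))"
  \<comment> \<open>Both indices are below \<open>N x\<close>, so their sum adds at most
    \<open>2 * poly B n\<close> to the input length.\<close>
  define ti where "ti n = poly pE (n + 2 * poly B n) + 20" for n
  define to where "to n = poly pN (n + poly B n) + 8 * poly B n + poly B n * (ti n + 2) + 20" for n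
  define tt where "tt n = 2 * K + n * 17 + 40 + poly pN n + 5 * poly B n + poly B n * (to n + 2)" for n
  have pti: "pbounded ti" unfolding ti_def
    by (intro pbounded_add pbounded_comp[OF pbounded_poly]) auto
  have pto: "pbounded to" unfolding to_def
    by (intro pbounded_add pbounded_mult pti pbounded_comp[OF pbounded_poly]) auto
  have ptt: "pbounded tt" unfolding tt_def
    by (intro pbounded_add pbounded_mult pto) auto
  have wf: "prog_wf K P"
    using K by (auto simp: P_def K_def outer_def inner_def emit_def intro: prog_wf_mono)
  define regs where "regs x i j a b = ((\<lambda>_. 0)(2 := length x, 3 := i, 4 := j, 5 := a, 6 := b) :: nat \<Rightarrow> nat)" for x :: "bool list" and i j a b
  have inner: "run inner x out (regs x i k a (N x - k)) (ti (length x)) (out @ [E x i k]) (regs x i (Suc k) a (N x - Suc k))"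
    if k: "k < N x" "i < N x" for x out i k a
  proof -
    let ?n = "length x" and ?r = "regs x i k a (N x - Suc k)"
    let ?r7 = "?r(7 := of_bool (E x i k))"
    have "TE (?n + i + k) \<le> poly pE (?n + 2 * poly B ?n)"
      using pE[of "?n + i + k"] poly_nat_mono[of "?n + i + k" "?n + 2 * poly B ?n" pE] NB[of x] k by simp
    moreover have 1: "crun (decr 6) x out (regs x i k a (N x - k)) 1 ?r"
      by (rule crun_eq[OF run_dec]) (auto simp: regs_def fun_eq_iff)
    moreover have 2: "crun PE x out ?r (TE (?n + i + k))
        ?r7"
      by (rule crun_eq[OF computesD[OF PE]]) (auto simp: regs_def)
    moreover have 3: "run (emit 7) x out ?r7 1
        (out @ [E x i k]) ?r7"
      by (rule run_eq[OF run_emit]) auto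
    moreover have 4: "crun (clear 7) x (out @ [E x i k]) ?r7 4
        ?r"
      by (rule crun_eq[OF run_clear]) (auto simp: regs_def fun_eq_iff)
    moreover have 5: "crun (incr 4) x (out @ [E x i k]) ?r 1 (regs x i (Suc k) a (N x - Suc k))"
      by (rule crun_eq[OF run_inc]) (auto simp: regs_def fun_eq_iff)
    ultimately show ?thesis unfolding inner_def
      by (intro run_eq[OF run_Seq[OF 1 run_Seq[OF 2 run_Seq[OF 3 run_Seq[OF 4 5]]]]]) (auto simp: ti_def)
  qed
  have inner_loop: "run (while_pos 6 inner) x out (regs x i 0 a (N x)) (N x * (ti (length x) + 2) + 1)
      (out @ row x i) (regs x i (N x) a 0)" if i: "i < N x" for x out i a
    by (rule run_loop[where S = "\<lambda>k. regs x i k a (N x - k)" and O' = "\<lambda>k. out @ map (E x i) [0..<k]"])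
       (use i in \<open>auto simp: regs_def[of _ _ _ _ 0] row_def intro!: run_eq[OF inner]\<close>, auto simp: regs_def)
  have outer: "run outer x out (regs x k 0 (N x - k) 0) (to (length x)) (out @ row x k)
      (regs x (Suc k) 0 (N x - Suc k) 0)" if k: "k < N x" for x out k
  proof -
    let ?n = "length x" and ?r = "regs x k 0 (N x - Suc k) 0"
    let ?r7 = "?r(7 := N x)"
    have "TN (?n + k) \<le> poly pN (?n + poly B ?n)"
      using pN[of "?n + k"] poly_nat_mono[of "?n + k" "?n + poly B ?n" pN] NB[of x] k by simp
    moreover have "N x * (ti ?n + 2) \<le> poly B ?n * (ti ?n + 2)"
      using NB[of x] by (rule mult_le_mono1)
    moreover have 1: "crun (decr 5) x out (regs x k 0 (N x - k) 0) 1 ?r"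
      by (rule crun_eq[OF run_dec]) (auto simp: regs_def fun_eq_iff)
    moreover have 2: "crun PN x out ?r (TN (?n + k))
        ?r7"
      by (rule crun_eq[OF computesD[OF PN]]) (auto simp: regs_def)
    moreover have 3: "crun (move 7 6) x out ?r7 (N x * 5 + 1)
        (regs x k 0 (N x - Suc k) (N x))"
      by (rule crun_eq[OF run_move]) (auto simp: regs_def fun_eq_iff)
    moreover note 4 = inner_loop[OF k, of out "N x - Suc k"]
    moreover have 5: "crun (clear 4) x (out @ row x k) (regs x k (N x) (N x - Suc k) 0) (N x * 3 + 1)
        ?r"
      by (rule crun_eq[OF run_clear]) (auto simp: regs_def fun_eq_iff)
    moreover have 6: "crun (incr 3) x (out @ row x k) ?r 1 (regs x (Suc k) 0 (N x - Suc k) 0)"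
      by (rule crun_eq[OF run_inc]) (auto simp: regs_def fun_eq_iff)
    ultimately show ?thesis unfolding outer_def using NB[of x]
      by (intro run_eq[OF run_Seq[OF 1 run_Seq[OF 2 run_Seq[OF 3 run_Seq[OF 4 run_Seq[OF 5 6]]]]]]) (auto simp: to_def)
  qed
  have outer_loop: "run (while_pos 5 outer) x [] (regs x 0 0 (N x) 0) (N x * (to (length x) + 2) + 1)
      (concat (map (row x) [0..<N x])) (regs x (N x) 0 0 0)" for x
    by (rule run_loop[where S = "\<lambda>k. regs x k 0 (N x - k) 0" and O' = "\<lambda>k. concat (map (row x) [0..<k])"])
       (auto intro!: run_eq[OF outer], auto simp: regs_def)
  have main: "runs P (start_tapes x K) (tt (length x))
      (conf x (concat (map (row x) [0..<N x])) (regs x (N x) 0 0 0))" for x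
  proof -
    let ?n = "length x"
    have 1: "runs (load K) (start_tapes x K) (2 * K + length x * 17 + 20) (conf x [] (regs x 0 0 0 0))"
    proof -
      have "regs x 0 0 0 0 = (\<lambda>_. 0)(2 := length x)" by (auto simp: regs_def fun_eq_iff)
      then show ?thesis by (simp only:) (rule runs_load, simp add: K_def)
    qed
    have 2: "crun PN x [] (regs x 0 0 0 0) (TN ?n) ((regs x 0 0 0 0)(7 := N x))"
      by (rule crun_eq[OF computesD[OF PN]]) (auto simp: regs_def)
    have 3: "crun (move 7 5) x [] ((regs x 0 0 0 0)(7 := N x)) (N x * 5 + 1) (regs x 0 0 (N x) 0)"
      by (rule crun_eq[OF run_move]) (auto simp: regs_def fun_eq_iff)
    have "N x * (to ?n + 2) \<le> poly B ?n * (to ?n + 2)"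
      using NB[of x] by (rule mult_le_mono1)
    then show ?thesis unfolding P_def using NB[of x] pN[of ?n]
      by (intro runs_eq[OF runs_Seq[OF 1 runs_Seq[OF 2 runs_Seq[OF 3 outer_loop]]]]) (auto simp: tt_def)
  qed
  obtain p :: "nat poly" where p: "\<And>n. tt n \<le> poly p n" using ptt pboundedE by blast
  show ?thesis
  proof (rule poly_time_computable_prog[OF wf])
    show "P \<noteq> Done" by (simp add: P_def)
    show "1 \<le> K" "1 \<le> K" by (auto simp: K_def)
    fix ws :: "bool list list" assume "length ws = 1"
    then obtain x where ws: "ws = [x]" by (auto simp: length_Suc_conv)
    let ?F = "concat (map (\<lambda>i. map (\<lambda>j. E (ws ! 0) i j) [0..<N (ws ! 0)]) [0..<N (ws ! 0)])"
    have F: "?F = concat (map (row x) [0..<N x])"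
      by (simp add: ws row_def[abs_def])
    have "runs P (start_tapes x K) (poly p (sum_list (map length ws)))
        (conf x ?F (regs x (N x) 0 0 0))"
      unfolding F by (rule runs_mono[OF main]) (simp add: ws p)
    moreover have "\<forall>r<K. start_tapes x K r = (word_content (if r < 1 then ws ! r else []), 0)"
      by (auto simp: start_tapes_def ws)
    ultimately show "\<exists>Ts Ts'. (\<forall>r<K. Ts r = (word_content (if r < 1 then ws ! r else []), 0)) \<and>
        runs P Ts (poly p (sum_list (map length ws))) Ts' \<and>
        (\<forall>i\<le>length ?F. fst (Ts' 0) (int i) = word_content ?F (int i))"
      by (intro exI[of _ "start_tapes x K"] exI) (auto simp: conf_def)
  qed
qed

section \<open>Adjacency eigenvalues\<close>

definition nbs :: "'a pair_pre_digraph \<Rightarrow> 'a \<Rightarrow> 'a set" where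
  "nbs G v = {u. (v, u) \<in> parcs G}"

lemma simple_graph_iff:
  "simple_graph G \<longleftrightarrow> finite (pverts G) \<and> pverts G \<noteq> {} \<and>
     (\<forall>u v. (u, v) \<in> parcs G \<longrightarrow> u \<in> pverts G \<and> v \<in> pverts G \<and> (v, u) \<in> parcs G \<and> u \<noteq> v)"
  (is "?L \<longleftrightarrow> ?R")
proof
  assume L: ?L
  then interpret pair_graph G by (simp add: simple_graph_def)
  show ?R using L arcs_symmetric in_arcsD1 in_arcsD2 no_loops'
    by (auto simp: simple_graph_def)
next
  assume R: ?R
  have "parcs G \<subseteq> pverts G \<times> pverts G" using R by auto
  then have "finite (parcs G)" using R finite_subset by blast
  then have "pair_graph G"
    using R by unfold_locales (auto simp: symmetric_def sym_def)
  then show ?L using R by (simp add: simple_graph_def)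
qed

lemma subgraph_simple_iff:
  "simple_graph H \<Longrightarrow> simple_graph G \<Longrightarrow>
     subgraph (with_proj H) (with_proj G) \<longleftrightarrow> pverts H \<subseteq> pverts G \<and> parcs H \<subseteq> parcs G"
  unfolding subgraph_def compatible_def wf_digraph_wp_iff simple_graph_def pair_graph_def
    pair_digraph_def pair_fin_digraph_def by auto

lemma nbs_subset: "simple_graph G \<Longrightarrow> nbs G v \<subseteq> pverts G"
  by (auto simp: simple_graph_iff nbs_def)

lemma finite_nbs: "simple_graph G \<Longrightarrow> finite (nbs G v)"
  using nbs_subset finite_subset by (metis simple_graph_iff)

lemma out_degree_nbs: "out_degree (with_proj G) v = card (nbs G v)"
proof -
  have "out_arcs (with_proj G) v = Pair v ` nbs G v"
    by (auto simp: out_arcs_def nbs_def)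
  then show ?thesis by (simp add: out_degree_def card_image inj_on_def)
qed

lemma card_nbs_le_max_degree: "simple_graph G \<Longrightarrow> v \<in> pverts G \<Longrightarrow> card (nbs G v) \<le> max_degree G"
  unfolding max_degree_def out_degree_nbs by (rule Max_ge) (auto simp: simple_graph_iff)

lemma max_degree_attained: "simple_graph G \<Longrightarrow> \<exists>v\<in>pverts G. card (nbs G v) = max_degree G"
proof -
  assume "simple_graph G"
  then have "max_degree G \<in> (\<lambda>v. card (nbs G v)) ` pverts G"
    unfolding max_degree_def out_degree_nbs by (intro Max_in) (auto simp: simple_graph_iff)
  then show ?thesis by force
qed

text \<open>Stated over an arbitrary field: the complex instance supplies an eigenvalue, the real
  one describes \<open>adjacency_matrix\<close>. Passing from index vectors to functions on vertices
  removes the dependence on the enumeration \<open>vs\<close>.\<close>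

lemma eigenvalue_relation_matrix:
  fixes k :: "'b::field"
  assumes vs: "distinct vs" and n: "n = length vs"
  shows "eigenvalue (mat n n (\<lambda>(i, j). if (vs ! i, vs ! j) \<in> E then 1 else 0)) k \<longleftrightarrow>
    (\<exists>x. (\<exists>v\<in>set vs. x v \<noteq> 0) \<and> (\<forall>v\<in>set vs. (\<Sum>u | u \<in> set vs \<and> (v, u) \<in> E. x u) = k * x v))"
    (is "eigenvalue ?A k \<longleftrightarrow> ?R")
proof -
  have bij: "bij_betw ((!) vs) {..<n} (set vs)"
    using bij_betw_nth[OF vs _ refl, of "{..<n}"] n by (auto simp: lessThan_atLeast0)
  have row: "(?A *\<^sub>v vec n (\<lambda>j. x (vs ! j))) $ i = (\<Sum>u | u \<in> set vs \<and> (vs ! i, u) \<in> E. x u)"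
    if "i < n" for x :: "_ \<Rightarrow> 'b" and i
  proof -
    have "(?A *\<^sub>v vec n (\<lambda>j. x (vs ! j))) $ i =
        (\<Sum>j<n. (if (vs ! i, vs ! j) \<in> E then x (vs ! j) else 0))"
      using that by (auto simp: scalar_prod_def lessThan_atLeast0 intro!: sum.cong)
    also have "\<dots> = (\<Sum>u\<in>set vs. (if (vs ! i, u) \<in> E then x u else 0))"
      by (rule sum.reindex_bij_betw[OF bij])
    also have "\<dots> = (\<Sum>u | u \<in> set vs \<and> (vs ! i, u) \<in> E. x u)"
      by (simp add: sum.inter_filter)
    finally show ?thesis .
  qed
  have ev: "eigenvector ?A (vec n (\<lambda>j. x (vs ! j))) k \<longleftrightarrow> (\<exists>v\<in>set vs. x v \<noteq> 0) \<and>
      (\<forall>v\<in>set vs. (\<Sum>u | u \<in> set vs \<and> (v, u) \<in> E. x u) = k * x v)" for x :: "_ \<Rightarrow> 'b"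
  proof -
    have "vec n (\<lambda>j. x (vs ! j)) \<noteq> 0\<^sub>v n \<longleftrightarrow> (\<exists>v\<in>set vs. x v \<noteq> 0)"
    proof -
      have "(\<exists>v\<in>set vs. x v \<noteq> 0) \<longleftrightarrow> (\<exists>i<n. x (vs ! i) \<noteq> 0)"
        unfolding n in_set_conv_nth by (auto simp: set_conv_nth)
      then show ?thesis by (auto simp: vec_eq_iff)
    qed
    moreover have "?A *\<^sub>v vec n (\<lambda>j. x (vs ! j)) = k \<cdot>\<^sub>v vec n (\<lambda>j. x (vs ! j)) \<longleftrightarrow>
       (\<forall>i<n. (?A *\<^sub>v vec n (\<lambda>j. x (vs ! j))) $ i = k * x (vs ! i))"
      by (simp add: vec_eq_iff)
    moreover have "(\<forall>i<n. (?A *\<^sub>v vec n (\<lambda>j. x (vs ! j))) $ i = k * x (vs ! i)) \<longleftrightarrow>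
       (\<forall>v\<in>set vs. (\<Sum>u | u \<in> set vs \<and> (v, u) \<in> E. x u) = k * x v)"
      using row n by (simp add: all_set_conv_all_nth)
    ultimately show ?thesis by (auto simp: eigenvector_def)
  qed
  show ?thesis
  proof
    assume "eigenvalue ?A k"
    then obtain w where w: "eigenvector ?A w k" by (auto simp: eigenvalue_def)
    define x where "x v = w $ the_inv_into {..<n} ((!) vs) v" for v
    have "vec n (\<lambda>j. x (vs ! j)) = w"
      using w bij by (auto simp: vec_eq_iff eigenvector_def x_def bij_betw_def the_inv_into_f_f)
    with w have "eigenvector ?A (vec n (\<lambda>j. x (vs ! j))) k" by (simp only:)
    then show ?R unfolding ev by blast
  next
    assume ?R
    then show "eigenvalue ?A k" using ev unfolding eigenvalue_def by blast
  qed
qed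

definition adj_eigen :: "'a pair_pre_digraph \<Rightarrow> 'b::field \<Rightarrow> ('a \<Rightarrow> 'b) \<Rightarrow> bool" where
  "adj_eigen G k x \<longleftrightarrow> (\<exists>v\<in>pverts G. x v \<noteq> 0) \<and> (\<forall>v\<in>pverts G. sum x (nbs G v) = k * x v)"

lemma nbs_filter: "simple_graph G \<Longrightarrow> {u. u \<in> pverts G \<and> (v, u) \<in> parcs G} = nbs G v"
  using nbs_subset[of G v] by (auto simp: nbs_def)

lemma eigenvalue_adjacency:
  assumes "simple_graph G"
  shows "eigenvalue (adjacency_matrix G) k \<longleftrightarrow> (\<exists>x. adj_eigen G k x)"
proof -
  have "finite (pverts G)" using assms by (simp add: simple_graph_iff)
  then show ?thesis
    using eigenvalue_relation_matrix[of "sorted_list_of_set (pverts G)" _ "parcs G" k, OF _ refl] assms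
    by (simp add: adjacency_matrix_def Let_def adj_eigen_def nbs_filter)
qed

text \<open>A complex eigenvalue exists; it is real because the sum of
  \<open>cnj (x v) * x u\<close> over all arcs \<open>(v, u)\<close> is invariant under conjugation.\<close>

lemma adj_eigen_exists:
  fixes G :: "'a::linorder pair_pre_digraph"
  assumes G: "simple_graph G"
  shows "\<exists>k::real. eigenvalue (adjacency_matrix G) k"
proof -
  let ?V = "pverts G"
  have fin: "finite ?V" and ne: "?V \<noteq> {}" using G by (auto simp: simple_graph_iff)
  define vs where "vs = sorted_list_of_set ?V"
  have vs: "distinct vs" "set vs = ?V" "length vs \<noteq> 0"
    using fin ne by (auto simp: vs_def)
  let ?A = "mat (length vs) (length vs) (\<lambda>(i, j). if (vs ! i, vs ! j) \<in> parcs G then 1 else 0) :: complex mat"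
  have "spectrum ?A \<noteq> {}"
    by (rule spectrum_non_empty[of _ "length vs"]) (use vs in auto)
  then obtain k where "eigenvalue ?A k" by (auto simp: spectrum_def)
  then obtain x where x: "adj_eigen G k x"
    using eigenvalue_relation_matrix[OF vs(1) refl, of "parcs G" k] vs(2)
    by (auto simp: adj_eigen_def nbs_filter[OF G])
  have ind: "sum f (nbs G v) = (\<Sum>u\<in>?V. if (v, u) \<in> parcs G then f u else 0)" for f :: "'a \<Rightarrow> complex" and v
    unfolding nbs_filter[OF G, symmetric] using fin by (simp add: sum.inter_filter)
  let ?S = "\<Sum>v\<in>?V. cnj (x v) * sum x (nbs G v)" and ?N = "\<Sum>v\<in>?V. (cmod (x v))\<^sup>2"
  have "?S = (\<Sum>v\<in>?V. \<Sum>u\<in>?V. if (v, u) \<in> parcs G then cnj (x v) * x u else 0)"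
    by (simp add: ind sum_distrib_left if_distrib cong: if_cong)
  also have "\<dots> = (\<Sum>u\<in>?V. \<Sum>v\<in>?V. if (v, u) \<in> parcs G then cnj (x v) * x u else 0)"
    by (rule sum.swap)
  also have "\<dots> = (\<Sum>u\<in>?V. \<Sum>v\<in>?V. if (u, v) \<in> parcs G then cnj (x v) * x u else 0)"
    using G by (intro sum.cong refl) (auto simp: simple_graph_iff)
  also have "\<dots> = cnj ?S"
    by (simp add: ind cnj_sum sum_distrib_left if_distrib mult.commute cong: if_cong)
  finally have S: "?S = cnj ?S" .
  have "?S = (\<Sum>v\<in>?V. k * complex_of_real ((cmod (x v))\<^sup>2))"
  proof (intro sum.cong refl)
    fix v assume v: "v \<in> ?V"
    have "complex_of_real ((cmod (x v))\<^sup>2) = cnj (x v) * x v"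
      by (metis complex_norm_square mult.commute)
    then show "cnj (x v) * sum x (nbs G v) = k * complex_of_real ((cmod (x v))\<^sup>2)"
      using x v by (simp add: adj_eigen_def mult.left_commute del: of_real_power)
  qed
  then have S2: "?S = k * complex_of_real ?N"
    by (simp add: sum_distrib_left)
  obtain v0 where "v0 \<in> ?V" "x v0 \<noteq> 0" using x by (auto simp: adj_eigen_def)
  then have "?N > 0"
    using fin by (intro sum_pos2[of _ v0]) auto
  then have "complex_of_real ?N \<noteq> 0" by (simp only: of_real_eq_0_iff)
  then have "k = cnj k"
    using S unfolding S2 complex_cnj_mult complex_cnj_complex_of_real by (simp only: mult_cancel_right) simp
  then have k: "k = complex_of_real (Re k)" by (metis Reals_cnj_iff complex_is_Real_iff of_real_Re)
  \<comment> \<open>As \<open>k\<close> is real, real and imaginary part of \<open>x\<close> both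
    satisfy the eigenvalue equation; the one that does not vanish at \<open>v0\<close> is an
    eigenvector.\<close>
  define part where "part = (if Re (x v0) \<noteq> 0 then Re else Im)"
  have part: "part (sum x A) = (\<Sum>u\<in>A. part (x u))" "part (complex_of_real r * z) = r * part z" for A r z
    by (auto simp: part_def)
  have "part (x v0) \<noteq> 0" using \<open>x v0 \<noteq> 0\<close> by (auto simp: part_def complex_eq_iff)
  moreover have "(\<Sum>u\<in>nbs G v. part (x u)) = Re k * part (x v)" if "v \<in> ?V" for v
  proof -
    have "(\<Sum>u\<in>nbs G v. part (x u)) = part (sum x (nbs G v))" by (rule part(1)[symmetric])
    also have "sum x (nbs G v) = complex_of_real (Re k) * x v"
      using x that k[symmetric] by (simp add: adj_eigen_def)
    finally show ?thesis by (simp only: part(2))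
  qed
  ultimately have "adj_eigen G (Re k) (\<lambda>v. part (x v))"
    using \<open>v0 \<in> ?V\<close> by (auto simp: adj_eigen_def)
  then show ?thesis using eigenvalue_adjacency[OF G] by blast
qed

text \<open>The real spectrum is finite and nonempty, so the \<open>Max\<close> in the definition of
  the radius is attained.\<close>

lemma
  assumes G: "simple_graph G"
  shows graph_spectral_radius_eigen: "\<exists>x. adj_eigen G (graph_spectral_radius G) x"
    and adj_eigen_le_radius: "adj_eigen G k x \<Longrightarrow> k \<le> graph_spectral_radius G"
proof -
  let ?A = "adjacency_matrix G"
  have A: "?A \<in> carrier_mat (length (sorted_list_of_set (pverts G))) (length (sorted_list_of_set (pverts G)))"
    by (simp add: adjacency_matrix_def Let_def)
  have "finite (spectrum ?A)" using card_finite_spectrum[OF A] by simp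
  then have fin: "finite {k. eigenvalue ?A k}" by (simp add: spectrum_def)
  have "graph_spectral_radius G \<in> {k. eigenvalue ?A k}"
    unfolding graph_spectral_radius_def using fin adj_eigen_exists[OF G] by (intro Max_in) auto
  then show "\<exists>x. adj_eigen G (graph_spectral_radius G) x"
    using eigenvalue_adjacency[OF G] by auto
  assume "adj_eigen G k x"
  then have "eigenvalue ?A k" using eigenvalue_adjacency[OF G, of k] by blast
  then show "k \<le> graph_spectral_radius G"
    unfolding graph_spectral_radius_def by (intro Max_ge[OF fin]) simp
qed

text \<open>Collatz--Wielandt bound: compare \<open>x\<close> with the weight \<open>y\<close> where \<open>\<bar>x v\<bar> / y v\<close> is largest.\<close>

lemma adj_eigen_le_weight:
  fixes y :: "'a \<Rightarrow> real"
  assumes G: "simple_graph G" and x: "adj_eigen G k x"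
    and y: "\<And>v. v \<in> pverts G \<Longrightarrow> y v > 0" "\<And>v. v \<in> pverts G \<Longrightarrow> sum y (nbs G v) \<le> l * y v"
  shows "\<bar>k\<bar> \<le> l"
proof -
  define M where "M = Max ((\<lambda>v. \<bar>x v\<bar> / y v) ` pverts G)"
  have fin: "finite (pverts G)" and ne: "pverts G \<noteq> {}" using G by (auto simp: simple_graph_iff)
  have le: "\<bar>x v\<bar> / y v \<le> M" if "v \<in> pverts G" for v
    unfolding M_def using fin that by (intro Max_ge) auto
  have "M \<in> (\<lambda>v. \<bar>x v\<bar> / y v) ` pverts G"
    unfolding M_def using fin ne by (intro Max_in) auto
  then obtain v where v: "v \<in> pverts G" "M = \<bar>x v\<bar> / y v" by auto
  obtain v0 where v0: "v0 \<in> pverts G" "x v0 \<noteq> 0" using x by (auto simp: adj_eigen_def)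
  have M: "M > 0" using le[OF v0(1)] v0 y(1)[OF v0(1)] by (smt (verit) divide_pos_pos)
  have "\<bar>k\<bar> * (M * y v) = \<bar>sum x (nbs G v)\<bar>"
    using x v y(1)[OF v(1)] by (simp add: adj_eigen_def abs_mult)
  also have "\<dots> \<le> (\<Sum>u\<in>nbs G v. \<bar>x u\<bar>)" by (rule sum_abs)
  also have "\<dots> \<le> (\<Sum>u\<in>nbs G v. M * y u)"
  proof (rule sum_mono)
    fix u assume "u \<in> nbs G v"
    then have "u \<in> pverts G" using nbs_subset[OF G] by blast
    then show "\<bar>x u\<bar> \<le> M * y u" using le[of u] y(1)[of u] by (simp add: divide_le_eq)
  qed
  also have "\<dots> \<le> M * (l * y v)"
    using y(2)[OF v(1)] M by (simp add: sum_distrib_left[symmetric])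
  finally show ?thesis using M y(1)[OF v(1)] by (simp add: mult.left_commute)
qed

lemma adj_eigen_le_max_degree:
  fixes k :: real
  assumes "simple_graph G" "adj_eigen G k x"
  shows "\<bar>k\<bar> \<le> real (max_degree G)"
  using adj_eigen_le_weight[OF assms, of "\<lambda>_. 1" "real (max_degree G)"]
    card_nbs_le_max_degree[OF assms(1)] by simp

section \<open>Spectral degeneracy and regular subgraphs\<close>

text \<open>There are finitely many subgraphs, so the least admissible value is the largest ratio
  \<open>c H\<close>, with \<open>0\<close> added for the requirement of being nonnegative. The
  ratio is put to \<open>0\<close> for a negative radius or maximum degree \<open>0\<close>, where
  the defining inequality holds for every nonnegative parameter.\<close>

lemma spectral_degeneracy_ge_iff:
  fixes G :: "'a::linorder pair_pre_digraph"
  assumes G: "simple_graph G" and d: "d > 0"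
  shows "spectral_degeneracy G \<ge> d \<longleftrightarrow>
    (\<exists>H. simple_graph H \<and> subgraph (with_proj H) (with_proj G) \<and> max_degree H > 0 \<and>
       graph_spectral_radius H \<ge> 0 \<and> d * real (max_degree H) \<le> (graph_spectral_radius H)\<^sup>2)"
proof -
  define Hs where "Hs = {H. simple_graph H \<and> subgraph (with_proj H) (with_proj G)}"
  define c where "c H = (if graph_spectral_radius H \<ge> 0 \<and> max_degree H > 0
    then (graph_spectral_radius H)\<^sup>2 / real (max_degree H) else 0)" for H :: "'a pair_pre_digraph"
  let ?R = "(\<lambda>(V, E). \<lparr>pverts = V, parcs = E\<rparr>) ` (Pow (pverts G) \<times> Pow (parcs G))"
  have "finite (pverts G)" using G by (simp add: simple_graph_iff)
  moreover have "parcs G \<subseteq> pverts G \<times> pverts G" using G by (auto simp: simple_graph_iff)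
  ultimately have "finite (Pow (pverts G) \<times> Pow (parcs G))"
    by (meson finite_Pow_iff finite_SigmaI finite_subset)
  then have "finite ?R"
    by (rule finite_imageI)
  moreover have "Hs \<subseteq> ?R"
  proof
    fix H assume "H \<in> Hs"
    then have "pverts H \<subseteq> pverts G" "parcs H \<subseteq> parcs G"
      using subgraph_simple_iff[OF _ G] by (auto simp: Hs_def)
    moreover have "H = \<lparr>pverts = pverts H, parcs = parcs H\<rparr>" by simp
    ultimately show "H \<in> ?R"
      by (intro image_eqI[of _ _ "(pverts H, parcs H)"]) auto
  qed
  ultimately have fin: "finite Hs" by (rule finite_subset[rotated])
  have single: "graph_spectral_radius H \<le> sqrt (e * real (max_degree H)) \<longleftrightarrow> c H \<le> e"
    if "H \<in> Hs" "e \<ge> 0" for H e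
  proof -
    have H: "simple_graph H" using that by (simp add: Hs_def)
    obtain x where x: "adj_eigen H (graph_spectral_radius H) x"
      using graph_spectral_radius_eigen[OF H] by blast
    have le: "\<bar>graph_spectral_radius H\<bar> \<le> real (max_degree H)" by (rule adj_eigen_le_max_degree[OF H x])
    show ?thesis
    proof (cases "graph_spectral_radius H \<ge> 0 \<and> max_degree H > 0")
      case True
      then have "graph_spectral_radius H \<le> sqrt (e * real (max_degree H)) \<longleftrightarrow>
          (graph_spectral_radius H)\<^sup>2 \<le> e * real (max_degree H)"
        by (metis real_le_rsqrt real_sqrt_le_iff real_sqrt_unique sqrt_le_D)
      then show ?thesis using True by (simp add: c_def divide_le_eq)
    next
      case False
      then show ?thesis using le that(2) by (auto simp: c_def intro: order_trans[of _ 0])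
    qed
  qed
  define m where "m = Max (insert 0 (c ` Hs))"
  have iff: "0 \<le> e \<and> spectrally_degenerate e G \<longleftrightarrow> m \<le> e" for e
  proof -
    have "m \<le> e \<longleftrightarrow> 0 \<le> e \<and> (\<forall>H\<in>Hs. c H \<le> e)"
      unfolding m_def using fin by (subst Max_le_iff) auto
    then show ?thesis using single by (auto simp: spectrally_degenerate_def Hs_def)
  qed
  have "spectral_degeneracy G = m"
    unfolding spectral_degeneracy_def iff by (rule Least_equality) auto
  moreover have "d \<le> m \<longleftrightarrow> (\<exists>H\<in>Hs. d \<le> c H)"
    unfolding m_def using fin d by (subst Max_ge_iff) auto
  moreover have "d \<le> c H \<longleftrightarrow> max_degree H > 0 \<and> graph_spectral_radius H \<ge> 0 \<and>
      d * real (max_degree H) \<le> (graph_spectral_radius H)\<^sup>2" for H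
    using d by (auto simp: c_def pos_le_divide_eq)
  ultimately show ?thesis by (auto simp: Hs_def)
qed

definition has_regular_subgraph :: "nat \<Rightarrow> 'a pair_pre_digraph \<Rightarrow> bool" where
  "has_regular_subgraph d G \<longleftrightarrow> (\<exists>H. simple_graph H \<and> pverts H \<subseteq> pverts G \<and> parcs H \<subseteq> parcs G \<and>
     (\<forall>v\<in>pverts H. card (nbs H v) = d))"

text \<open>A subgraph of maximum degree \<open>d + 1\<close> is excluded by the weight, a subgraph of maximum degree
  at most \<open>d\<close> has spectral radius \<open>d\<close> only if it contains a \<open>d\<close>-regular subgraph: the vertices at
  which \<open>\<bar>x\<bar>\<close> is largest, for an eigenvector \<open>x\<close>.\<close>

theorem spectral_degeneracy_regular_subgraph:
  fixes G :: "'a::linorder pair_pre_digraph" and y :: "'a \<Rightarrow> real"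
  assumes G: "simple_graph G" and d: "d > 0" and deg: "max_degree G \<le> d + 1"
    and y: "\<And>v. v \<in> pverts G \<Longrightarrow> y v > 0" "\<And>v. v \<in> pverts G \<Longrightarrow> sum y (nbs G v) \<le> l * y v"
    and l: "l\<^sup>2 < real d * (real d + 1)"
  shows "spectral_degeneracy G \<ge> real d \<longleftrightarrow> has_regular_subgraph d G"
proof
  assume "has_regular_subgraph d G"
  then obtain H where H: "simple_graph H" "pverts H \<subseteq> pverts G" "parcs H \<subseteq> parcs G"
    and reg: "\<And>v. v \<in> pverts H \<Longrightarrow> card (nbs H v) = d" by (auto simp: has_regular_subgraph_def)
  have md: "max_degree H = d" using max_degree_attained[OF H(1)] reg by auto
  have "adj_eigen H (real d) (\<lambda>_. 1)"
    using H(1) reg by (auto simp: adj_eigen_def simple_graph_iff)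
  then have "real d \<le> graph_spectral_radius H" by (rule adj_eigen_le_radius[OF H(1)])
  then have "graph_spectral_radius H \<ge> 0 \<and> real d * real d \<le> (graph_spectral_radius H)\<^sup>2"
    by (simp add: power2_eq_square mult_mono)
  then show "spectral_degeneracy G \<ge> real d"
    using spectral_degeneracy_ge_iff[OF G, of "real d"] subgraph_simple_iff[OF H(1) G] H d md by auto
next
  assume "spectral_degeneracy G \<ge> real d"
  then obtain H where H: "simple_graph H" "subgraph (with_proj H) (with_proj G)"
    and pos: "max_degree H > 0" "graph_spectral_radius H \<ge> 0"
    and rad: "real d * real (max_degree H) \<le> (graph_spectral_radius H)\<^sup>2"
    using spectral_degeneracy_ge_iff[OF G, of "real d"] d by auto
  have sub: "pverts H \<subseteq> pverts G" "parcs H \<subseteq> parcs G"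
    using H subgraph_simple_iff[OF H(1) G] by auto
  have nbs_sub: "nbs H v \<subseteq> nbs G v" for v using sub by (auto simp: nbs_def)
  let ?r = "graph_spectral_radius H"
  obtain x where x: "adj_eigen H ?r x" using graph_spectral_radius_eigen[OF H(1)] by blast
  have le: "?r \<le> real (max_degree H)" using adj_eigen_le_max_degree[OF H(1) x] by simp
  have "\<bar>?r\<bar> \<le> l"
  proof (rule adj_eigen_le_weight[OF H(1) x, of y])
    fix v assume v: "v \<in> pverts H"
    then show "0 < y v" using sub y(1) by auto
    have "sum y (nbs H v) \<le> sum y (nbs G v)"
    proof (rule sum_mono2[OF finite_nbs[OF G] nbs_sub])
      fix u assume "u \<in> nbs G v - nbs H v"
      then have "u \<in> pverts G" using nbs_subset[OF G] by blast
      then show "0 \<le> y u" using y(1) by (simp add: less_imp_le)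
    qed
    then show "sum y (nbs H v) \<le> l * y v" using y(2)[of v] v sub by auto
  qed
  then have "?r\<^sup>2 \<le> l\<^sup>2" by (simp add: abs_le_square_iff[symmetric] abs_le_iff)
  then have "real d * real (max_degree H) < real d * (real d + 1)" using rad l by linarith
  then have "max_degree H \<le> d" using d by (simp add: mult_less_cancel_left)
  moreover have "real d * real (max_degree H) \<le> real (max_degree H) * real (max_degree H)"
    using rad le pos(2) by (smt (verit) mult_mono power2_eq_square)
  then have "d \<le> max_degree H" using pos(1) by simp
  ultimately have md: "max_degree H = d" by simp
  have "(real d)\<^sup>2 \<le> ?r\<^sup>2" using rad md by (simp add: power2_eq_square)
  then have "real d \<le> ?r" using pos(2) by (rule power2_le_imp_le)
  then have r: "?r = real d" using le md by simp
  define M where "M = Max ((\<lambda>v. \<bar>x v\<bar>) ` pverts H)"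
  define U where "U = {v \<in> pverts H. \<bar>x v\<bar> = M}"
  have fin: "finite (pverts H)" and ne: "pverts H \<noteq> {}" using H(1) by (auto simp: simple_graph_iff)
  have leM: "\<bar>x v\<bar> \<le> M" if "v \<in> pverts H" for v
    unfolding M_def using fin that by (intro Max_ge) auto
  have "M \<in> (\<lambda>v. \<bar>x v\<bar>) ` pverts H"
    unfolding M_def using fin ne by (intro Max_in) auto
  then have Une: "U \<noteq> {}" by (auto simp: U_def)
  obtain v0 where "v0 \<in> pverts H" "x v0 \<noteq> 0" using x by (auto simp: adj_eigen_def)
  then have M: "M > 0" using leM[of v0] by simp
  \<comment> \<open>At a vertex where the modulus of \<open>x\<close> is maximal,
    \<open>d * M\<close> is bounded by a sum of at most \<open>d\<close> terms that are at most
    \<open>M\<close>. So equality holds throughout: there are \<open>d\<close> neighbours, and all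
    are maximal.\<close>
  have U: "card (nbs H v) = d \<and> nbs H v \<subseteq> U" if "v \<in> U" for v
  proof -
    have v: "v \<in> pverts H" "\<bar>x v\<bar> = M" using that by (auto simp: U_def)
    have nb: "u \<in> pverts H" if "u \<in> nbs H v" for u using that nbs_subset[OF H(1)] by blast
    have finn: "finite (nbs H v)" by (rule finite_nbs[OF H(1)])
    have "real d * M = \<bar>sum x (nbs H v)\<bar>" using x v r by (simp add: adj_eigen_def abs_mult)
    also have "\<dots> \<le> (\<Sum>u\<in>nbs H v. \<bar>x u\<bar>)" by (rule sum_abs)
    finally have 1: "real d * M \<le> (\<Sum>u\<in>nbs H v. \<bar>x u\<bar>)" .
    have 2: "(\<Sum>u\<in>nbs H v. \<bar>x u\<bar>) \<le> real (card (nbs H v)) * M"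
      using sum_bounded_above[of "nbs H v" "\<lambda>u. \<bar>x u\<bar>" M] leM nb by simp
    have c: "card (nbs H v) \<le> d" using card_nbs_le_max_degree[OF H(1) v(1)] md by simp
    have "real d * M \<le> real (card (nbs H v)) * M" using 1 2 by linarith
    then have "d \<le> card (nbs H v)" using M by simp
    with c have card: "card (nbs H v) = d" by simp
    have "\<bar>x u\<bar> = M" if u: "u \<in> nbs H v" for u
    proof (rule ccontr)
      assume "\<bar>x u\<bar> \<noteq> M"
      then have "\<bar>x u\<bar> < M" using leM[OF nb[OF u]] by simp
      then have "(\<Sum>u\<in>nbs H v. \<bar>x u\<bar>) < (\<Sum>u\<in>nbs H v. M)"
        using leM nb u finn by (intro sum_strict_mono_ex1) auto
      then show False using 1 card by simp
    qed
    then show ?thesis using card nb by (auto simp: U_def)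
  qed
  \<comment> \<open>\<open>U\<close> is closed under neighbours in \<open>H\<close>, so restricting
    the source of an arc to \<open>U\<close> restricts its target too, and no degree drops.\<close>
  define H' where "H' = \<lparr>pverts = U, parcs = {(u, v) \<in> parcs H. u \<in> U}\<rparr>"
  have nb': "nbs H' v = nbs H v" if "v \<in> U" for v using that by (auto simp: nbs_def H'_def)
  have "simple_graph H'"
    unfolding simple_graph_iff
  proof (intro conjI allI impI)
    show "finite (pverts H')" "pverts H' \<noteq> {}"
      using fin Une by (auto simp: H'_def U_def)
    fix u v assume "(u, v) \<in> parcs H'"
    then have uv: "(u, v) \<in> parcs H" "u \<in> U" by (auto simp: H'_def)
    then have "v \<in> U" using U[OF uv(2)] by (auto simp: nbs_def)
    then show "u \<in> pverts H'" "v \<in> pverts H'" "(v, u) \<in> parcs H'" "u \<noteq> v"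
      using uv H(1) by (auto simp: H'_def simple_graph_iff)
  qed
  moreover have "\<forall>v\<in>pverts H'. card (nbs H' v) = d" using U nb' by (auto simp: H'_def)
  moreover have "pverts H' \<subseteq> pverts G" "parcs H' \<subseteq> parcs G" using sub by (auto simp: H'_def U_def)
  ultimately show "has_regular_subgraph d G" unfolding has_regular_subgraph_def by blast
qed

section \<open>Wires and constraints\<close>

lemma mod_less_double: "x < 2 * (M :: nat) \<Longrightarrow> x mod M = (if x < M then x else x - M)"
  by (auto simp: mod_if)

text \<open>Cyclic distance from \<open>a\<close> forward to \<open>b\<close>; adding
  \<open>M\<close> before subtracting keeps the natural-number difference exact for
  \<open>a < M\<close>.\<close>

definition gap :: "nat \<Rightarrow> nat \<Rightarrow> nat \<Rightarrow> nat" where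
  "gap M a b = (b + M - a) mod M"

lemma gap_less: "M > 0 \<Longrightarrow> gap M a b < M"
  by (simp add: gap_def)

lemma gap_eq: "a < M \<Longrightarrow> b < M \<Longrightarrow> gap M a b = (if a \<le> b then b - a else b + M - a)"
  unfolding gap_def by (subst mod_less_double) auto

lemma gap_forward: "a < M \<Longrightarrow> b < M \<Longrightarrow> s < M \<Longrightarrow> b = (a + s) mod M \<longleftrightarrow> s = gap M a b"
  by (subst mod_less_double) (auto simp: gap_eq)

lemma gap_backward: "a < M \<Longrightarrow> b < M \<Longrightarrow> s < M \<Longrightarrow> a = (b + M - s) mod M \<longleftrightarrow> s = gap M a b"
  by (subst mod_less_double) (auto simp: gap_eq)

lemma image_filter_eq: "A \<subseteq> f ` P \<Longrightarrow> (\<And>u. u \<in> P \<Longrightarrow> f u \<in> A \<longleftrightarrow> Q u) \<Longrightarrow> A = f ` {u \<in> P. Q u}"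
  by auto

lemma mult_add_eq_iff:
  assumes "a < M" "b < (M :: nat)"
  shows "q * M + a = q' * M + b \<longleftrightarrow> q = q' \<and> a = b"
proof
  assume eq: "q * M + a = q' * M + b"
  have "(q * M + a) div M = q" "(q' * M + b) div M = q'" "(q * M + a) mod M = a" "(q' * M + b) mod M = b"
    using assms by auto
  then show "q = q' \<and> a = b" using eq by simp
qed simp

text \<open>A \<open>d\<close>-regular subgraph contains all edges at a vertex of degree \<open>d\<close> or none. A wire is a
  circulant piece of such vertices, hence is contained as a whole or not at all. At every position
  of a wire one edge is left: it leads to a constraint vertex of degree \<open>d + 1\<close> if the position is
  used, and otherwise joins the two sides. Taking two sides makes the graph loop-free.\<close>

locale wire_system =
  fixes d wn K :: nat and used :: "nat \<Rightarrow> bool"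
  assumes d: "d \<ge> 3" and K: "K \<ge> 2" and wn: "wn > 0"
begin

text \<open>Every wire reserves \<open>d - 1\<close> consecutive positions for every constraint, the
  largest multiplicity with which a wire will be attached to one.\<close>

definition M :: nat where "M = K * (d - 1)"
definition nw :: nat where "nw = wn * M"

text \<open>The first argument lies on the even side, the second on the odd side, and numbers from
  \<open>nw\<close> on are constraints. The gaps \<open>1\<close> to \<open>d - 1\<close> form the
  circulant; the rung \<open>u = u'\<close> closes a position that no constraint uses.\<close>

definition link :: "nat \<Rightarrow> nat \<Rightarrow> bool" where
  "link u u' \<longleftrightarrow>
     u < nw \<and> u' < nw \<and> u div M = u' div M \<and>
       (0 < gap M (u mod M) (u' mod M) \<and> gap M (u mod M) (u' mod M) < d \<or> u = u' \<and> \<not> used u) \<or>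
     u < nw \<and> nw \<le> u' \<and> used u \<and> u mod M div (d - 1) = u' - nw \<or>
     u' < nw \<and> nw \<le> u \<and> used u' \<and> u' mod M div (d - 1) = u - nw"

definition adj :: "nat \<Rightarrow> nat \<Rightarrow> bool" where
  "adj v v' \<longleftrightarrow> v mod 2 \<noteq> v' mod 2 \<and>
     (if v mod 2 = 0 then link (v div 2) (v' div 2) else link (v' div 2) (v div 2))"

definition nv :: nat where "nv = 2 * (nw + K)"

definition graph :: "nat pair_pre_digraph" where
  "graph = \<lparr>pverts = {0..<nv}, parcs = {(v, v'). v < nv \<and> v' < nv \<and> adj v v'}\<rparr>"

definition ports :: "nat \<Rightarrow> nat set" where
  "ports k = {u. u < nw \<and> used u \<and> u mod M div (d - 1) = k}"

text \<open>\<open>f\<close> selects the wires of the subgraph. A selected wire is demanded because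
  the empty selection meets every constraint.\<close>

definition solution :: "(nat \<Rightarrow> bool) \<Rightarrow> bool" where
  "solution f \<longleftrightarrow> (\<exists>w<wn. f w) \<and> (\<forall>k<K. card {u \<in> ports k. f (u div M)} \<in> {0, d})"

text \<open>Keeps the gaps \<open>0\<close> to \<open>d - 1\<close> distinct modulo
  \<open>M\<close>, so that a wire vertex has \<open>d\<close> different neighbours.\<close>

lemma M_ge: "M > d"
proof -
  have "M \<ge> 2 * (d - 1)" unfolding M_def using K by simp
  then show ?thesis using d by linarith
qed

lemma M_pos: "M > 0" using M_ge by simp

lemma nw_div: "u < nw \<Longrightarrow> u div M < wn"
  unfolding nw_def using M_pos by (simp add: less_mult_imp_div_less)

lemma nw_node: "w < wn \<Longrightarrow> m < M \<Longrightarrow> w * M + m < nw"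
proof -
  assume "w < wn" "m < M"
  then have "w * M + m < Suc w * M" "Suc w * M \<le> wn * M" by (auto intro: mult_le_mono1 simp del: mult_Suc) simp
  then show ?thesis by (simp add: nw_def)
qed

lemma port_less: "u mod M div (d - 1) < K"
proof -
  have "u mod M < M" using M_pos by simp
  then have "u mod M < K * (d - 1)" by (simp only: M_def)
  then show ?thesis by (simp add: less_mult_imp_div_less)
qed

definition fwd :: "nat \<Rightarrow> nat \<Rightarrow> nat" where "fwd u s = u div M * M + (u mod M + s) mod M"
definition bwd :: "nat \<Rightarrow> nat \<Rightarrow> nat" where "bwd u s = u div M * M + (u mod M + M - s) mod M"

lemma shift_less: "u < nw \<Longrightarrow> fwd u s < nw" "u < nw \<Longrightarrow> bwd u s < nw"
  unfolding fwd_def bwd_def using M_pos by (auto intro!: nw_node nw_div)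

lemma fwd_iff: "s < M \<Longrightarrow> u' = fwd u s \<longleftrightarrow> u div M = u' div M \<and> s = gap M (u mod M) (u' mod M)"
proof -
  assume s: "s < M"
  have "u' = fwd u s \<longleftrightarrow> u' div M * M + u' mod M = u div M * M + (u mod M + s) mod M"
    by (simp only: fwd_def div_mult_mod_eq)
  also have "\<dots> \<longleftrightarrow> u' div M = u div M \<and> u' mod M = (u mod M + s) mod M"
    using M_pos by (intro mult_add_eq_iff) auto
  finally show ?thesis using gap_forward[of "u mod M" M "u' mod M" s] s M_pos by auto
qed

lemma bwd_iff: "s < M \<Longrightarrow> u' = bwd u s \<longleftrightarrow> u' div M = u div M \<and> s = gap M (u' mod M) (u mod M)"
proof -
  assume s: "s < M"
  have "u' = bwd u s \<longleftrightarrow> u' div M * M + u' mod M = u div M * M + (u mod M + M - s) mod M"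
    by (simp only: bwd_def div_mult_mod_eq)
  also have "\<dots> \<longleftrightarrow> u' div M = u div M \<and> u' mod M = (u mod M + M - s) mod M"
    using M_pos by (intro mult_add_eq_iff) auto
  finally show ?thesis using gap_backward[of "u' mod M" M "u mod M" s] s M_pos by auto
qed

text \<open>The one neighbour outside the circulant, as a number on the opposite side: the
  constraint there, or the vertex's own copy.\<close>

definition external :: "nat \<Rightarrow> nat" where
  "external u = (if used u then nw + u mod M div (d - 1) else u)"

definition links :: "nat \<Rightarrow> nat set" where "links u = {u'. u' < nw + K \<and> link u u'}"
definition colinks :: "nat \<Rightarrow> nat set" where "colinks u = {u'. u' < nw + K \<and> link u' u}"

lemma gap_self: "gap M a b = 0 \<longleftrightarrow> a = b" if "a < M" "b < M"
  using that by (auto simp: gap_eq)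

lemma image_shift:
  assumes "\<And>s. s < M \<Longrightarrow> u' = h s \<longleftrightarrow> Q \<and> s = g"
  shows "u' \<in> h ` {1..<d} \<longleftrightarrow> Q \<and> 0 < g \<and> g < d"
proof -
  have "u' = h s \<longleftrightarrow> Q \<and> s = g" if "s < d" for s
    using that M_ge by (intro assms) simp
  then have "u' \<in> h ` {1..<d} \<longleftrightarrow> (\<exists>s. 1 \<le> s \<and> s < d \<and> Q \<and> s = g)" by fastforce
  then show ?thesis by auto
qed

lemma links_wire: "u < nw \<Longrightarrow> links u = insert (external u) (fwd u ` {1..<d})"
proof -
  assume u: "u < nw"
  have "u' \<in> fwd u ` {1..<d} \<longleftrightarrow> u' < nw \<and> u div M = u' div M \<and>
      0 < gap M (u mod M) (u' mod M) \<and> gap M (u mod M) (u' mod M) < d" for u'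
    using image_shift[OF fwd_iff, of u' u] shift_less(1)[OF u] by blast
  note shifts = this
  have "u' \<in> links u \<longleftrightarrow> u' = external u \<or> u' \<in> fwd u ` {1..<d}" for u'
  proof (cases "u' < nw")
    case True
    have "u' \<in> links u \<longleftrightarrow> u div M = u' div M \<and> 0 < gap M (u mod M) (u' mod M) \<and> gap M (u mod M) (u' mod M) < d \<or> u' = u \<and> \<not> used u"
      using u True unfolding links_def link_def by auto
    moreover have "u' = external u \<longleftrightarrow> u' = u \<and> \<not> used u"
      using True unfolding external_def by auto
    ultimately show ?thesis unfolding shifts using True by blast
  next
    case False
    have "u' \<in> links u \<longleftrightarrow> u' < nw + K \<and> used u \<and> u mod M div (d - 1) = u' - nw"
      using u False unfolding links_def link_def by auto
    moreover have "u' = external u \<longleftrightarrow> used u \<and> u mod M div (d - 1) = u' - nw"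
      using u False unfolding external_def by auto
    ultimately show ?thesis unfolding shifts using False port_less[of u] by auto
  qed
  then show ?thesis by blast
qed

lemma colinks_wire: "u < nw \<Longrightarrow> colinks u = insert (external u) (bwd u ` {1..<d})"
proof -
  assume u: "u < nw"
  have "u' \<in> bwd u ` {1..<d} \<longleftrightarrow> u' < nw \<and> u' div M = u div M \<and>
      0 < gap M (u' mod M) (u mod M) \<and> gap M (u' mod M) (u mod M) < d" for u'
    using image_shift[OF bwd_iff, of u' u] shift_less(2)[OF u] by blast
  note shifts = this
  have "u' \<in> colinks u \<longleftrightarrow> u' = external u \<or> u' \<in> bwd u ` {1..<d}" for u'
  proof (cases "u' < nw")
    case True
    have "u' \<in> colinks u \<longleftrightarrow> u' div M = u div M \<and> 0 < gap M (u' mod M) (u mod M) \<and> gap M (u' mod M) (u mod M) < d \<or> u' = u \<and> \<not> used u"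
      using u True unfolding colinks_def link_def by auto
    moreover have "u' = external u \<longleftrightarrow> u' = u \<and> \<not> used u"
      using True unfolding external_def by auto
    ultimately show ?thesis unfolding shifts using True by blast
  next
    case False
    have "u' \<in> colinks u \<longleftrightarrow> u' < nw + K \<and> used u \<and> u mod M div (d - 1) = u' - nw"
      using u False unfolding colinks_def link_def by auto
    moreover have "u' = external u \<longleftrightarrow> used u \<and> u mod M div (d - 1) = u' - nw"
      using u False unfolding external_def by auto
    ultimately show ?thesis unfolding shifts using False port_less[of u] by auto
  qed
  then show ?thesis by blast
qed

lemma links_constraint: "nw \<le> u \<Longrightarrow> links u = ports (u - nw)"
  "nw \<le> u \<Longrightarrow> colinks u = ports (u - nw)"
  by (auto simp: links_def colinks_def link_def ports_def)

lemma external_notin: "u < nw \<Longrightarrow> external u \<notin> fwd u ` {1..<d}" "u < nw \<Longrightarrow> external u \<notin> bwd u ` {1..<d}"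
proof -
  assume u: "u < nw"
  have "fwd u s \<noteq> external u \<and> bwd u s \<noteq> external u" if s: "s \<in> {1..<d}" for s
  proof (cases "used u")
    case True
    then show ?thesis using shift_less[OF u, of s] by (simp add: external_def)
  next
    case False
    have "gap M (u mod M) (u mod M) = 0" using M_pos by (simp add: gap_self)
    then have "u \<noteq> fwd u s" "u \<noteq> bwd u s"
      using fwd_iff[of s u u] bwd_iff[of s u u] s M_ge by auto
    then show ?thesis using False by (simp add: external_def)
  qed
  then show "external u \<notin> fwd u ` {1..<d}" "external u \<notin> bwd u ` {1..<d}" by force+
qed

lemma inj_fwd: "inj_on (fwd u) {1..<d}"
proof (rule inj_onI)
  fix s t assume "s \<in> {1..<d}" "t \<in> {1..<d}" "fwd u s = fwd u t"
  then show "s = t" using fwd_iff[of s "fwd u s" u] fwd_iff[of t "fwd u s" u] M_ge by simp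
qed

lemma inj_bwd: "inj_on (bwd u) {1..<d}"
proof (rule inj_onI)
  fix s t assume "s \<in> {1..<d}" "t \<in> {1..<d}" "bwd u s = bwd u t"
  then show "s = t" using bwd_iff[of s "bwd u s" u] bwd_iff[of t "bwd u s" u] M_ge by simp
qed

lemma card_links_wire: "u < nw \<Longrightarrow> card (links u) = d" "u < nw \<Longrightarrow> card (colinks u) = d"
proof -
  have "card (fwd u ` {1..<d}) = d - 1" "card (bwd u ` {1..<d}) = d - 1"
    by (simp_all only: card_image[OF inj_fwd] card_image[OF inj_bwd] card_atLeastLessThan)
  then show "u < nw \<Longrightarrow> card (links u) = d" "u < nw \<Longrightarrow> card (colinks u) = d"
    using d external_notin[of u] by (simp_all add: links_wire colinks_wire del: One_nat_def)
qed

lemma simple_graph: "simple_graph graph"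
proof -
  have "adj v v' \<Longrightarrow> adj v' v \<and> v \<noteq> v'" for v v'
    by (auto simp: adj_def split: if_splits)
  then show ?thesis using K by (auto simp: simple_graph_iff graph_def nv_def)
qed

lemma mod_2E:
  fixes v :: nat
  shows "v mod 2 = Suc 0 \<Longrightarrow> (\<And>u. v = Suc (2 * u) \<Longrightarrow> R) \<Longrightarrow> R"
    and "Suc 0 \<noteq> v mod 2 \<Longrightarrow> (\<And>u. v = 2 * u \<Longrightarrow> R) \<Longrightarrow> R"
proof -
  have "v mod 2 = Suc 0 \<Longrightarrow> v = Suc (2 * (v div 2))" "Suc 0 \<noteq> v mod 2 \<Longrightarrow> v = 2 * (v div 2)"
    by presburger+
  then show "v mod 2 = Suc 0 \<Longrightarrow> (\<And>u. v = Suc (2 * u) \<Longrightarrow> R) \<Longrightarrow> R"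
    "Suc 0 \<noteq> v mod 2 \<Longrightarrow> (\<And>u. v = 2 * u \<Longrightarrow> R) \<Longrightarrow> R" by blast+
qed

lemma nbs_even: "nbs graph (2 * u) = (\<lambda>u'. 2 * u' + 1) ` links u" if "u < nw + K"
  using that by (auto simp: nbs_def graph_def adj_def nv_def links_def image_iff elim!: mod_2E)

lemma nbs_odd: "nbs graph (2 * u + 1) = (\<lambda>u'. 2 * u') ` colinks u" if "u < nw + K"
  using that by (auto simp: nbs_def graph_def adj_def nv_def colinks_def image_iff elim!: mod_2E)

lemma vertex_cases:
  assumes "v < nv"
  obtains u where "u < nw + K" "v = 2 * u" | u where "u < nw + K" "v = 2 * u + 1"
proof (cases "even v")
  case True
  then show ?thesis using assms that(1)[of "v div 2"] by (auto simp: nv_def)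
next
  case False
  then show ?thesis using assms that(2)[of "v div 2"] by (auto simp: nv_def)
qed

lemma pverts_graph [simp]: "pverts graph = {0..<nv}"
  by (simp add: graph_def)

lemma card_nbs_wire: "v < nv \<Longrightarrow> v div 2 < nw \<Longrightarrow> card (nbs graph v) = d"
  by (erule vertex_cases)
     (simp_all add: nbs_even nbs_odd[simplified] card_links_wire card_image inj_on_def)

lemma finite_ports: "finite (ports k)"
  by (simp add: ports_def)

end

text \<open>Separate from \<open>wire_system\<close>, since \<open>ports\<close> has to be available
  before the ports of a concrete instance can be counted.\<close>

locale regular_wire_system = wire_system +
  assumes card_ports: "k < K \<Longrightarrow> card (ports k) = d + 1"
begin

lemma card_nbs_constraint: "v < nv \<Longrightarrow> nw \<le> v div 2 \<Longrightarrow> card (nbs graph v) = d + 1"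
  using card_ports[of "v div 2 - nw"]
  by (elim vertex_cases)
     (simp_all add: nbs_even nbs_odd[simplified] links_constraint card_image inj_on_def)

lemma max_degree_graph: "max_degree graph = d + 1"
proof (rule antisym)
  obtain v where v: "v < nv" "card (nbs graph v) = max_degree graph"
    using max_degree_attained[OF simple_graph] by auto
  then show "max_degree graph \<le> d + 1"
    using card_nbs_wire[of v] card_nbs_constraint[of v] by linarith
  have "2 * nw < nv" using K by (simp add: nv_def)
  then show "d + 1 \<le> max_degree graph"
    using card_nbs_le_max_degree[OF simple_graph, of "2 * nw"] card_nbs_constraint[of "2 * nw"] by simp
qed

text \<open>With weight \<open>1\<close> on wires and \<open>1 + e\<close> on constraints the requirement reads \<open>d + e \<le> l\<close> and
  \<open>d + 1 \<le> l * (1 + e)\<close>; for \<open>e = 1 / (d + 1)\<close> it is met by an \<open>l\<close> with \<open>l\<^sup>2 < d * (d + 1)\<close>.\<close>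

lemma spectral_degeneracy_graph:
  "spectral_degeneracy graph \<ge> real d \<longleftrightarrow> has_regular_subgraph d graph"
proof (rule spectral_degeneracy_regular_subgraph[OF simple_graph])
  define e where "e = 1 / (real d + 1)"
  define y where "y v = (if v div 2 < nw then 1 else 1 + e)" for v
  have e: "e > 0" "e * (real d + 1) = 1" by (auto simp: e_def)
  show "d > 0" using d by simp
  show "max_degree graph \<le> d + 1" by (simp add: max_degree_graph)
  show "0 < y v" for v using e by (simp add: y_def)
  show "sum y (nbs graph v) \<le> (real d + e) * y v" if v: "v \<in> pverts graph" for v
  proof (cases "v div 2 < nw")
    case True
    \<comment> \<open>Apart from the external one, all neighbours of a wire vertex lie on wires, so
      at most one neighbour carries the larger weight.\<close>
    have cl: "card {u \<in> nbs graph v. \<not> u div 2 < nw} \<le> 1"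
    proof -
      obtain w where "{u \<in> nbs graph v. \<not> u div 2 < nw} \<subseteq> {w}"
        using v[simplified]
      proof (cases rule: vertex_cases)
        case (1 u)
        then have u: "u < nw" using True by simp
        have "{x \<in> nbs graph v. \<not> x div 2 < nw} \<subseteq> {2 * external u + 1}"
          using 1 u shift_less(1)[OF u] by (auto simp: nbs_even links_wire)
        then show ?thesis using that by blast
      next
        case (2 u)
        then have u: "u < nw" using True by simp
        have "{x \<in> nbs graph v. \<not> x div 2 < nw} \<subseteq> {2 * external u}"
          using 2 u shift_less(2)[OF u] by (auto simp: nbs_odd[simplified] colinks_wire)
        then show ?thesis using that by blast
      qed
      then show ?thesis using card_mono[of "{w}"] by fastforce
    qed
    have "sum y (nbs graph v) = (\<Sum>u\<in>nbs graph v. 1 + e * of_bool (\<not> u div 2 < nw))"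
      by (intro sum.cong) (auto simp: y_def)
    also have "\<dots> = real d + e * real (card {u \<in> nbs graph v. \<not> u div 2 < nw})"
      using card_nbs_wire[of v] v True finite_nbs[OF simple_graph, of v]
      by (simp add: sum.distrib sum_distrib_left[symmetric] Int_def)
    also have "\<dots> \<le> real d + e * 1"
      using cl e(1) by (intro add_left_mono mult_left_mono) auto
    finally show ?thesis using True by (simp add: y_def)
  next
    case False
    have "y u = 1" if "u \<in> nbs graph v" for u
      using v[simplified] that False
      by (elim vertex_cases) (auto simp: nbs_even nbs_odd[simplified] links_constraint y_def ports_def)
    then have "sum y (nbs graph v) = real (d + 1)"
      using card_nbs_constraint[of v] v False by simp
    also have "\<dots> = real d + 1" by simp
    also have "real d + 1 \<le> (real d + e) * (1 + e)"
    proof -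
      \<comment> \<open>By the choice of \<open>e\<close> the middle term is exactly
        \<open>1\<close>.\<close>
      have "(real d + e) * (1 + e) = real d + e * (real d + 1) + e * e" by (simp add: algebra_simps)
      then show ?thesis using e by simp
    qed
    finally show ?thesis using False by (simp add: y_def)
  qed
  show "(real d + e)\<^sup>2 < real d * (real d + 1)"
  proof -
    \<comment> \<open>The excess \<open>2 * (real d * e) + e * e\<close> of the square over
      \<open>d * d\<close> stays below \<open>3\<close>, and \<open>d\<close> is at least
      \<open>3\<close>.\<close>
    have "e \<le> 1" "real d * e \<le> 1"
      using d by (auto simp: e_def field_simps)
    then have "2 * (real d * e) + e * e \<le> 2 * 1 + e * 1"
      using e by (intro add_mono mult_left_mono) auto
    moreover have "e < 1" using d by (simp add: e_def field_simps)
    ultimately have "2 * (real d * e) + e * e < 3" by simp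
    then have "2 * (real d * e) + e * e < real d" using d by simp
    then show ?thesis by (simp add: power2_eq_square algebra_simps)
  qed
qed

text \<open>Take the subgraph induced by both copies of the selected wires and of the constraints
  with exactly \<open>d\<close> selected ports. A selected wire meets only constraints with a
  nonzero, hence full, count, so none of its vertices loses an edge.\<close>

lemma solution_imp_regular:
  assumes f: "solution f"
  shows "has_regular_subgraph d graph"
proof -
  define act where "act u = (if u < nw then f (u div M) else card {p \<in> ports (u - nw). f (p div M)} = d)" for u
  define U where "U = {v. v < nv \<and> act (v div 2)}"
  define H where "H = \<lparr>pverts = U, parcs = {(v, v') \<in> parcs graph. v \<in> U \<and> v' \<in> U}\<rparr>"
  have nbs: "nbs H v = nbs graph v \<inter> U" if "v \<in> U" for v
    using that by (auto simp: nbs_def H_def)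
  obtain w where w: "w < wn" "f w" using f by (auto simp: solution_def)
  have "w * M < nw" using nw_node[of w 0] w M_pos by simp
  moreover have "act (w * M)" using w M_pos \<open>w * M < nw\<close> by (simp add: act_def)
  ultimately have "2 * (w * M) \<in> U" by (auto simp: U_def nv_def)
  then have "simple_graph H"
    using simple_graph unfolding simple_graph_iff by (auto simp: H_def U_def)
  moreover have ext: "act (external u)" if "u < nw" "act u" for u
  proof (cases "used u")
    case True
    let ?k = "u mod M div (d - 1)"
    have "u \<in> {p \<in> ports ?k. f (p div M)}" using that True by (auto simp: ports_def act_def)
    then have "card {p \<in> ports ?k. f (p div M)} \<noteq> 0" using finite_ports by auto
    then have "card {p \<in> ports ?k. f (p div M)} = d"
      using f port_less[of u] by (auto simp: solution_def)
    then show ?thesis using True by (simp add: external_def act_def)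
  qed (use that in \<open>simp add: external_def\<close>)
  have shift: "act (fwd u s)" "act (bwd u s)" if "u < nw" "act u" for u s
    using that shift_less[OF that(1), of s] M_pos by (auto simp: act_def fwd_def bwd_def)
  have wire: "nbs graph v \<subseteq> U" if v: "v \<in> U" "v div 2 < nw" for v
  proof -
    have "v < nv" using v by (simp add: U_def)
    moreover have "act (v div 2)" using v by (simp add: U_def)
    ultimately have "act (v' div 2)" if "v' \<in> nbs graph v" for v'
      using that v(2)
      by (elim vertex_cases) (auto simp: nbs_even nbs_odd[simplified] links_wire colinks_wire ext shift)
    then show ?thesis using nbs_subset[OF simple_graph, of v] by (auto simp: U_def)
  qed
  have "card (nbs H v) = d" if v: "v \<in> pverts H" for v
  proof (cases "v div 2 < nw")
    case True
    then show ?thesis using v nbs wire[of v] card_nbs_wire[of v] by (simp add: H_def Int_absorb2 U_def)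
  next
    case False
    have vU: "v \<in> U" "v < nv" using v by (auto simp: H_def U_def)
    have card: "card {p \<in> ports (v div 2 - nw). f (p div M)} = d"
      using vU False by (simp add: U_def act_def)
    have inU: "2 * p + b \<in> U \<longleftrightarrow> f (p div M)" if "p \<in> ports k" "b < 2" for p b k
    proof -
      have "p < nw" using that by (simp add: ports_def)
      moreover have "(2 * p + b) div 2 = p" using that by simp
      ultimately show ?thesis using that by (simp add: U_def act_def nv_def)
    qed
    from vU(2) show ?thesis
    proof (cases rule: vertex_cases)
      case (1 u)
      then have "nbs graph v = (\<lambda>u'. 2 * u' + 1) ` ports (v div 2 - nw)"
        using False by (simp add: nbs_even links_constraint)
      then have "nbs H v = (\<lambda>u'. 2 * u' + 1) ` {p \<in> ports (v div 2 - nw). f (p div M)}"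
        using nbs[OF vU(1)] inU[of _ "v div 2 - nw" 1] by auto
      then show ?thesis using card by (simp add: card_image inj_on_def)
    next
      case (2 u)
      then have "nbs graph v = (\<lambda>u'. 2 * u') ` ports (v div 2 - nw)"
        using False by (simp add: nbs_odd[simplified] links_constraint)
      then have "nbs H v = (\<lambda>u'. 2 * u') ` {p \<in> ports (v div 2 - nw). f (p div M)}"
        using nbs[OF vU(1)] inU[of _ "v div 2 - nw" 0] by auto
      then show ?thesis using card by (simp add: card_image inj_on_def)
    qed
  qed
  moreover have "pverts H \<subseteq> pverts graph" "parcs H \<subseteq> parcs graph"
    by (auto simp: H_def U_def)
  ultimately show ?thesis unfolding has_regular_subgraph_def by blast
qed

text \<open>A wire vertex in \<open>H\<close> has degree \<open>d\<close> in both graphs and keeps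
  all its neighbours, so membership spreads along the wire and to its constraints. The wires whose
  even vertex at position \<open>0\<close> lies in \<open>H\<close> are selected.\<close>

lemma regular_imp_solution:
  assumes "has_regular_subgraph d graph"
  shows "\<exists>f. solution f"
proof -
  obtain H where H: "simple_graph H" "pverts H \<subseteq> pverts graph" "parcs H \<subseteq> parcs graph"
    and reg: "\<And>v. v \<in> pverts H \<Longrightarrow> card (nbs H v) = d"
    using assms by (auto simp: has_regular_subgraph_def)
  let ?V = "pverts H"
  have sub: "nbs H v \<subseteq> nbs graph v" for v using H(3) by (auto simp: nbs_def)
  have wire: "nbs H v = nbs graph v" if "v \<in> ?V" "v div 2 < nw" for v
    using that H(2) reg[of v] card_nbs_wire[of v] sub[of v] finite_nbs[OF simple_graph]
    by (intro card_subset_eq) auto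
  have step: "v' \<in> ?V" if "v \<in> ?V" "v div 2 < nw" "v' \<in> nbs graph v" for v v'
    using wire[OF that(1,2)] that(3) nbs_subset[OF H(1), of v] by auto
  have to_odd: "2 * fwd u s + 1 \<in> ?V" if "2 * u \<in> ?V" "u < nw" "1 \<le> s" "s < d" for u s
    by (rule step[of "2 * u"]) (use that in \<open>auto simp: nbs_even links_wire\<close>)
  have to_even: "2 * bwd u s \<in> ?V" if "2 * u + 1 \<in> ?V" "u < nw" "1 \<le> s" "s < d" for u s
    by (rule step[of "2 * u + 1"]) (use that in \<open>auto simp: nbs_odd[simplified] colinks_wire\<close>)
  have fwd_mod: "fwd u s div M = u div M" "fwd u s mod M = (u mod M + s) mod M" for u s
    using M_pos by (auto simp: fwd_def)
  \<comment> \<open>Two positions forward to the odd side and one back: this advances by one on the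
    even side. The gap \<open>2\<close> is available because \<open>d \<ge> 3\<close>.\<close>
  have fwd1: "2 * fwd u 1 \<in> ?V" if "2 * u \<in> ?V" "u < nw" for u
  proof -
    have "2 * bwd (fwd u 2) 1 \<in> ?V"
      using to_odd[OF that, of 2] to_even[of "fwd u 2" 1] shift_less(1)[OF that(2)] d by simp
    moreover have "fwd u 1 = bwd (fwd u 2) 1"
    proof -
      have "gap M ((u mod M + 1) mod M) ((u mod M + 2) mod M) = 1"
        by (rule sym, rule iffD1[OF gap_forward]) (use M_pos M_ge d in \<open>auto simp: mod_simps\<close>)
      then show ?thesis using bwd_iff[of 1 "fwd u 1" "fwd u 2"] M_ge d by (simp add: fwd_mod)
    qed
    ultimately show ?thesis by simp
  qed
  have fwd_fwd: "fwd (fwd u s) 1 = fwd u (Suc s)" for u s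
    unfolding fwd_def[of "fwd u s" 1] fwd_def[of u "Suc s"] fwd_mod
      mod_add_left_eq[of "u mod M + s" M 1] by (simp only: add.assoc Suc_eq_plus1)
  have fwdn: "2 * fwd u s \<in> ?V" if "2 * u \<in> ?V" "u < nw" for u s
  proof (induction s)
    case 0
    have "fwd u 0 = u" by (simp add: fwd_def div_mult_mod_eq)
    then show ?case using that by simp
  next
    case (Suc s)
    then show ?case using fwd1[OF Suc shift_less(1)[OF that(2)]] by (simp only: fwd_fwd)
  qed
  have even_even: "2 * u' \<in> ?V" if "2 * u \<in> ?V" "u < nw" "u' div M = u div M" for u u'
  proof -
    have "u' = fwd u (gap M (u mod M) (u' mod M))"
      using fwd_iff[OF gap_less[OF M_pos]] that(3) by simp
    then show ?thesis using fwdn[OF that(1,2)] by metis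
  qed
  have bwd_div: "bwd u s div M = u div M" for u s using M_pos by (simp add: bwd_def)
  have fwd_bwd: "fwd (bwd u 1) 1 = u" for u
    using bwd_iff[of 1 "bwd u 1" u] fwd_iff[of 1 u "bwd u 1"] M_ge d by simp
  \<comment> \<open>An odd vertex is adjacent to the even vertex one position before it, so both
    sides of a wire lie in \<open>H\<close> together.\<close>
  have all: "2 * u + b \<in> ?V \<longleftrightarrow> 2 * u' \<in> ?V" if "u < nw" "u' < nw" "u' div M = u div M" "b < 2" for u u' b
  proof (cases "b = 0")
    case True
    then show ?thesis using even_even that by auto
  next
    case False
    then have b: "b = 1" using that(4) by simp
    have "2 * u + 1 \<in> ?V \<longleftrightarrow> 2 * bwd u 1 \<in> ?V"
      using to_even[of u 1] to_odd[of "bwd u 1" 1, unfolded fwd_bwd] that(1) shift_less(2) d by auto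
    also have "\<dots> \<longleftrightarrow> 2 * u' \<in> ?V"
      using even_even[of "bwd u 1" u'] even_even[of u' "bwd u 1"] that shift_less(2) by (auto simp: bwd_div)
    finally show ?thesis using b by simp
  qed
  define f where "f w \<longleftrightarrow> 2 * (w * M) \<in> ?V" for w
  have f: "2 * u + b \<in> ?V \<longleftrightarrow> f (u div M)" if "u < nw" "b < 2" for u b
    unfolding f_def using that nw_node[OF nw_div[OF that(1)] M_pos] M_pos by (intro all) auto
  \<comment> \<open>The neighbours in \<open>H\<close> of a constraint are its selected ports on the
    other side, whether or not the constraint itself lies in \<open>H\<close>; \<open>b\<close> is
    its side.\<close>
  have con: "card {u \<in> ports k. f (u div M)} = (if 2 * (nw + k) + b \<in> ?V then d else 0)"
    if k: "k < K" "b < 2" for k b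
  proof -
    let ?v = "2 * (nw + k) + b"
    have nb: "nbs graph ?v = (\<lambda>u. 2 * u + (1 - b)) ` ports k"
    proof -
      have l: "links (nw + k) = ports k" "colinks (nw + k) = ports k"
        using links_constraint[of "nw + k"] by simp_all
      have "b = 0 \<or> b = 1" using k(2) by auto
      then show ?thesis
      proof
        assume "b = 0"
        then show ?thesis using nbs_even[of "nw + k"] k(1) by (simp only: l add_0_right diff_zero add_less_cancel_left)
      next
        assume "b = 1"
        then show ?thesis using nbs_odd[of "nw + k"] k(1)
          by (simp only: l add_0_right diff_self_eq_0 add_less_cancel_left)
      qed
    qed
    have iff: "2 * u + (1 - b) \<in> nbs H ?v \<longleftrightarrow> f (u div M)" if u: "u \<in> ports k" for u
    proof -
      have u': "u < nw" using u by (simp add: ports_def)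
      have "2 * u + (1 - b) \<in> nbs graph ?v" using nb u by auto
      then have sym: "?v \<in> nbs graph (2 * u + (1 - b))"
        using simple_graph by (auto simp: simple_graph_iff nbs_def)
      show ?thesis
      proof
        assume "2 * u + (1 - b) \<in> nbs H ?v"
        then have "2 * u + (1 - b) \<in> ?V" using nbs_subset[OF H(1)] by blast
        then show "f (u div M)" using f[OF u', of "1 - b"] k by auto
      next
        assume "f (u div M)"
        then have V: "2 * u + (1 - b) \<in> ?V" using f[OF u', of "1 - b"] k by auto
        have "(2 * u + (1 - b)) div 2 < nw" using u' by simp
        then have "?v \<in> nbs H (2 * u + (1 - b))" using wire[OF V] sym by blast
        then show "2 * u + (1 - b) \<in> nbs H ?v"
          using H(1) by (auto simp: simple_graph_iff nbs_def)
      qed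
    qed
    have "nbs H ?v = (\<lambda>u. 2 * u + (1 - b)) ` {u \<in> ports k. f (u div M)}"
      using sub[of ?v, unfolded nb] iff by (rule image_filter_eq)
    then have "card (nbs H ?v) = card {u \<in> ports k. f (u div M)}"
      by (simp add: card_image inj_on_def)
    moreover have "nbs H ?v = {}" if "?v \<notin> ?V"
      using that H(1) by (auto simp: simple_graph_iff nbs_def)
    ultimately show ?thesis using reg[of ?v] by (auto split: if_splits)
  qed
  have "\<exists>w<wn. f w"
  proof -
    obtain v where v: "v \<in> ?V" "v < nv" using H(1,2) by (force simp: simple_graph_iff)
    define u b where "u = v div 2" and "b = v mod 2"
    have ub: "v = 2 * u + b" "b < 2" "u < nw + K" using v by (auto simp: u_def b_def nv_def)
    show ?thesis
    proof (cases "u < nw")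
      case True
      then show ?thesis using f[of u b] ub v nw_div by auto
    next
      case False
      then have "card {p \<in> ports (u - nw). f (p div M)} = d"
        using con[of "u - nw" b] ub v by simp
      then have "{p \<in> ports (u - nw). f (p div M)} \<noteq> {}" using d by (metis card.empty not_numeral_le_zero)
      then show ?thesis using nw_div by (auto simp: ports_def)
    qed
  qed
  then have "solution f" unfolding solution_def using con[of _ 0] by auto
  then show ?thesis by blast
qed

theorem spectral_degeneracy_iff_solution:
  "spectral_degeneracy graph \<ge> real d \<longleftrightarrow> (\<exists>f. solution f)"
  using spectral_degeneracy_graph solution_imp_regular regular_imp_solution by blast

end

section \<open>Exact covers as wire systems\<close>

lemma mult_add_less: "c < C \<Longrightarrow> l < W \<Longrightarrow> c * W + l < C * (W :: nat)"
proof -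
  assume "c < C" "l < W"
  then have "c * W + l < Suc c * W" "Suc c * W \<le> C * W" by (simp, intro mult_le_mono1) simp
  then show ?thesis by simp
qed

text \<open>Columns \<open>l < W\<close> cover rows \<open>c < C\<close>; wire \<open>xw l\<close> stands for the choice of \<open>l\<close>. Along row \<open>c\<close>
  the wires \<open>sw\<close> carry the information whether \<open>c\<close> is covered by one of the first \<open>l\<close> columns, the wires
  \<open>tw\<close> carry the negated information; the row is closed up by using \<open>tw\<close> at \<open>l = 0\<close> also as the last
  negated wire, so that the information is false at the start and true at the end. A statement is true
  if its wire is \<^emph>\<open>not\<close> in the subgraph. Wire \<open>0\<close> is in every nonempty solution; it fills up the
  constraints, which then say that exactly one of the other two or three members is true.\<close>

locale cover_system =
  fixes d C W :: nat and inc :: "nat \<Rightarrow> nat \<Rightarrow> bool"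
  assumes d: "d \<ge> 3" and C: "C > 0" and W: "W \<ge> 2"
    and inc: "l < W \<Longrightarrow> \<exists>c<C. inc c l"
begin

definition P :: nat where "P = C * W"
definition xw :: "nat \<Rightarrow> nat" where "xw l = 1 + l"
definition sw :: "nat \<Rightarrow> nat" where "sw p = 1 + W + p"
definition tw :: "nat \<Rightarrow> nat" where "tw p = 1 + W + P + p"

definition inw :: "nat \<Rightarrow> nat" where
  "inw p = (if p mod W = 0 then tw p else sw p)"
definition outw :: "nat \<Rightarrow> nat" where
  "outw p = tw (p div W * W + (p mod W + 1) mod W)"

definition incident :: "nat \<Rightarrow> bool" where
  "incident k \<longleftrightarrow> k < P \<and> inc (k div W) (k mod W)"

text \<open>A constraint below \<open>P\<close> belongs to a row and a column and offers the
  alternatives: covered earlier, covered by this column, not covered even after it. The other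
  \<open>P\<close> constraints are inverters tying \<open>sw\<close> to \<open>tw\<close>.\<close>

definition member :: "nat \<Rightarrow> nat \<Rightarrow> bool" where
  "member k w \<longleftrightarrow>
     (if k < P then w = inw k \<or> w = outw k \<or> inc (k div W) (k mod W) \<and> w = xw (k mod W)
      else w = sw (k - P) \<or> w = tw (k - P))"

text \<open>The ports filled by wire \<open>0\<close>. They complete the two or three other members
  to \<open>d + 1\<close>, so a full count of \<open>d\<close> leaves out exactly one of these
  members.\<close>

definition slots :: "nat \<Rightarrow> nat" where
  "slots k = (if incident k then d - 2 else d - 1)"

definition wn :: nat where "wn = 1 + W + 2 * P"

definition cused :: "nat \<Rightarrow> bool" where
  "cused u \<longleftrightarrow> (let m = u mod (2 * P * (d - 1)); w = u div (2 * P * (d - 1)) in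
     if w = 0 then m mod (d - 1) < slots (m div (d - 1))
     else m mod (d - 1) = 0 \<and> member (m div (d - 1)) w)"

lemma P_pos: "P \<ge> 2"
  using C W mult_le_mono[of 1 C 2 W] by (simp add: P_def)

sublocale wire_system d wn "2 * P" cused
  by standard (use d P_pos in \<open>auto simp: wn_def\<close>)

lemma outw_idx: "p < P \<Longrightarrow> p div W * W + (p mod W + 1) mod W < P"
  unfolding P_def using W by (intro mult_add_less) (auto simp: less_mult_imp_div_less)

lemma member_wire: "k < 2 * P \<Longrightarrow> member k w \<Longrightarrow> 0 < w \<and> w < wn"
proof -
  assume k: "k < 2 * P" "member k w"
  have "k mod W < W" using W by simp
  then show "0 < w \<and> w < wn"
    using k outw_idx[of k]
    by (auto simp: member_def inw_def outw_def sw_def tw_def xw_def wn_def simp del: mod_less_divisor split: if_splits)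
qed

text \<open>At the start of a row both are \<open>tw\<close> wires, and \<open>W \<ge> 2\<close>
  keeps them apart.\<close>

lemma inw_neq_outw: "p < P \<Longrightarrow> inw p \<noteq> outw p"
proof (cases "p mod W = 0")
  case True
  then have "p div W * W = p" by auto
  then show ?thesis using True W by (simp add: inw_def outw_def tw_def)
qed (simp add: inw_def outw_def sw_def tw_def)

lemma xw_neq: "p < P \<Longrightarrow> xw (p mod W) \<noteq> inw p" "p < P \<Longrightarrow> xw (p mod W) \<noteq> outw p"
  using mod_less_divisor[of W p] W
  by (auto simp: xw_def inw_def outw_def sw_def tw_def simp del: mod_less_divisor)

lemma slots_le: "slots k \<le> d - 1"
  by (auto simp: slots_def)

lemma M_eq: "M = 2 * P * (d - 1)"
  by (simp add: M_def)

lemma cused_iff: "cused u \<longleftrightarrow>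
    (if u div M = 0 then u mod M mod (d - 1) < slots (u mod M div (d - 1))
     else u mod M mod (d - 1) = 0 \<and> member (u mod M div (d - 1)) (u div M))"
  by (simp only: cused_def Let_def M_eq)

lemma ports_filter:
  assumes k: "k < 2 * P"
  shows "{u \<in> ports k. g (u div M)} =
    (\<lambda>j. k * (d - 1) + j) ` {j. j < slots k \<and> g 0} \<union> (\<lambda>w. w * M + k * (d - 1)) ` {w. member k w \<and> g w}"
    (is "?L = ?A \<union> ?B")
proof (intro subset_antisym subsetI)
  fix u assume u: "u \<in> ?L"
  define w m j where "w = u div M" and "m = u mod M" and "j = m mod (d - 1)"
  have uw: "u = w * M + m" by (simp add: w_def m_def div_mult_mod_eq)
  have mk: "m div (d - 1) = k" using u by (simp add: ports_def m_def)
  then have m: "m = k * (d - 1) + j" using div_mult_mod_eq[of m "d - 1"] by (simp add: j_def)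
  have used: "if w = 0 then j < slots k else j = 0 \<and> member k w"
    using u mk by (auto simp: ports_def cused_iff w_def m_def j_def simp del: One_nat_def split: if_splits)
  have g: "g w" using u by (simp add: w_def)
  show "u \<in> ?A \<union> ?B"
  proof (cases "w = 0")
    case True
    then have "u \<in> ?A" using used g uw m by (intro image_eqI[of _ _ j]) auto
    then show ?thesis by blast
  next
    case False
    then have "u \<in> ?B" using used g uw m by (intro image_eqI[of _ _ w]) auto
    then show ?thesis by blast
  qed
next
  fix u assume "u \<in> ?A \<union> ?B"
  then consider j where "u = k * (d - 1) + j" "j < slots k" "g 0"
    | w where "u = w * M + k * (d - 1)" "member k w" "g w" by auto
  then show "u \<in> ?L"
  proof cases
    case 1
    have j: "j < d - 1" using 1 slots_le[of k] by simp
    then have uM: "u < M" unfolding 1 M_eq using k by (intro mult_add_less) auto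
    have "u div (d - 1) = k" "u mod (d - 1) = j" using j by (simp_all add: 1)
    moreover have "0 < wn" by (simp add: wn_def)
    then have "u < nw" using nw_node[of 0 u] uM by simp
    ultimately show ?thesis
      using 1 uM by (simp add: ports_def cused_iff)
  next
    case 2
    have w: "0 < w" "w < wn" using member_wire[OF k 2(2)] by auto
    have km: "k * (d - 1) < M" unfolding M_eq using k d by simp
    then have "u div M = w" "u mod M = k * (d - 1)" by (simp_all add: 2)
    moreover have "k * (d - 1) div (d - 1) = k" "k * (d - 1) mod (d - 1) = 0" using d by simp_all
    moreover have "u < nw" using nw_node[OF w(2) km] by (simp add: 2)
    ultimately show ?thesis
      using 2 w by (simp add: ports_def cused_iff)
  qed
qed

lemma finite_member: "finite {w. member k w \<and> g w}"
proof (rule finite_subset)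
  show "{w. member k w \<and> g w} \<subseteq> {inw k, outw k, xw (k mod W), sw (k - P), tw (k - P)}"
    by (auto simp: member_def split: if_splits)
qed simp

lemma card_ports_filter:
  assumes k: "k < 2 * P"
  shows "card {u \<in> ports k. g (u div M)} = (if g 0 then slots k else 0) + card {w. member k w \<and> g w}"
proof -
  let ?a = "\<lambda>j. k * (d - 1) + j" and ?b = "\<lambda>w. w * M + k * (d - 1)"
  have "?a ` {j. j < slots k \<and> g 0} \<inter> ?b ` {w. member k w \<and> g w} = {}"
  proof -
    have "?a j \<noteq> ?b w" if "j < slots k" "member k w" for j w
    proof -
      have "?a j < M" unfolding M_eq using k that(1) slots_le[of k] by (intro mult_add_less) auto
      moreover have "M \<le> w * M" using member_wire[OF k that(2)] by simp
      ultimately show ?thesis by linarith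
    qed
    then show ?thesis by blast
  qed
  then have "card {u \<in> ports k. g (u div M)} =
      card (?a ` {j. j < slots k \<and> g 0}) + card (?b ` {w. member k w \<and> g w})"
    unfolding ports_filter[OF k] by (intro card_Un_disjoint) (simp_all add: finite_member)
  moreover have "card (?a ` {j. j < slots k \<and> g 0}) = (if g 0 then slots k else 0)"
    by (subst card_image) (auto simp: inj_on_def)
  moreover have "card (?b ` {w. member k w \<and> g w}) = card {w. member k w \<and> g w}"
    using M_pos by (intro card_image) (auto simp: inj_on_def)
  ultimately show ?thesis by simp
qed

lemma card_three:
  assumes "a \<noteq> b" "c \<noteq> a" "c \<noteq> b"
  shows "card {w. (w = a \<or> w = b \<or> Q \<and> w = c) \<and> g w} = of_bool (g a) + of_bool (g b) + of_bool (Q \<and> g c)"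
proof -
  have "{w. (w = a \<or> w = b \<or> Q \<and> w = c) \<and> g w} =
     (if g a then {a} else {}) \<union> (if g b then {b} else {}) \<union> (if Q \<and> g c then {c} else {})"
    by auto
  then show ?thesis using assms by auto
qed

lemma card_member_cross:
  assumes "p < P"
  shows "card {w. member p w \<and> g w} =
    of_bool (g (inw p)) + of_bool (g (outw p)) + of_bool (inc (p div W) (p mod W) \<and> g (xw (p mod W)))"
  using assms card_three[OF inw_neq_outw[OF assms] xw_neq[OF assms]] by (simp add: member_def)

lemma card_member_inverter:
  assumes "p < P"
  shows "card {w. member (P + p) w \<and> g w} = of_bool (g (sw p)) + of_bool (g (tw p))"
proof -
  have "sw p \<noteq> tw p" using P_pos by (simp add: sw_def tw_def)
  then have "{w. (w = sw p \<or> w = tw p) \<and> g w} = (if g (sw p) then {sw p} else {}) \<union> (if g (tw p) then {tw p} else {})"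
    by auto
  then show ?thesis using \<open>sw p \<noteq> tw p\<close> by (auto simp: member_def)
qed

sublocale regular_wire_system d wn "2 * P" cused
proof
  fix k assume k: "k < 2 * P"
  show "card (ports k) = d + 1"
  proof (cases "k < P")
    case True
    then show ?thesis
      using card_ports_filter[OF k, of "\<lambda>_. True"] card_member_cross[OF True, of "\<lambda>_. True"] d
      by (auto simp: slots_def incident_def of_bool_def)
  next
    case False
    then show ?thesis
      using card_ports_filter[OF k, of "\<lambda>_. True"] card_member_inverter[of "k - P" "\<lambda>_. True"] d k
      by (auto simp: slots_def incident_def of_bool_def)
  qed
qed

lemma solution_iff:
  "solution f \<longleftrightarrow> (\<exists>w<wn. f w) \<and> (\<forall>k<2 * P. (if f 0 then slots k else 0) + card {w. member k w \<and> f w} \<in> {0, d})"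
  unfolding solution_def using card_ports_filter[of _ f] by auto

lemma wire_cases:
  assumes "w < wn"
  obtains "w = 0" | l where "l < W" "w = xw l" | p where "p < P" "w = sw p" | p where "p < P" "w = tw p"
proof -
  consider "w = 0" | "0 < w" "w \<le> W" | "W < w" "w \<le> W + P" | "W + P < w" by linarith
  then show thesis
  proof cases
    case 2
    then show thesis using that(2)[of "w - 1"] by (simp add: xw_def)
  next
    case 3
    then show thesis using that(3)[of "w - 1 - W"] by (simp add: sw_def)
  next
    case 4
    then show thesis using that(4)[of "w - 1 - W - P"] assms by (simp add: tw_def wn_def)
  qed (use that in simp)
qed

definition exact_cover :: "(nat \<Rightarrow> bool) \<Rightarrow> bool" where
  "exact_cover X \<longleftrightarrow> (\<forall>c<C. card {l. l < W \<and> X l \<and> inc c l} = 1)"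

text \<open>With \<open>h0 c\<close> the column covering row \<open>c\<close>, the information
  before column \<open>l\<close> is \<open>h0 c < l\<close>. A wire other than \<open>0\<close> is
  selected iff its statement is false.\<close>

lemma cover_imp_solution:
  assumes X: "exact_cover X"
  shows "\<exists>f. solution f"
proof -
  have "\<exists>l<W. \<forall>l'<W. X l' \<and> inc c l' \<longleftrightarrow> l' = l" if c: "c < C" for c
  proof -
    obtain l where "{l. l < W \<and> X l \<and> inc c l} = {l}"
      using X c unfolding exact_cover_def by (meson card_1_singletonE)
    then show ?thesis by (intro exI[of _ l]) blast
  qed
  then obtain h0 where h0: "\<And>c l. c < C \<Longrightarrow> l < W \<Longrightarrow> X l \<and> inc c l \<longleftrightarrow> l = h0 c"
    and h0W: "\<And>c. c < C \<Longrightarrow> h0 c < W"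
    by metis
  define s where "s p \<longleftrightarrow> h0 (p div W) < p mod W" for p
  \<comment> \<open>At the start of a row the incoming wire is \<open>tw\<close>; it must be
    selected, as nothing is covered yet, and the inverter then keeps \<open>sw\<close> out.\<close>
  define f where "f w = (if w = 0 then True else if w \<le> W then \<not> X (w - 1)
    else if w \<le> W + P then (let p = w - 1 - W in p mod W \<noteq> 0 \<and> \<not> s p)
    else (let p = w - 1 - W - P in p mod W = 0 \<or> s p))" for w
  have f: "f 0" "l < W \<Longrightarrow> f (xw l) \<longleftrightarrow> \<not> X l" "p < P \<Longrightarrow> f (sw p) \<longleftrightarrow> p mod W \<noteq> 0 \<and> \<not> s p"
    "f (tw p) \<longleftrightarrow> p mod W = 0 \<or> s p" for l p
    by (auto simp: f_def xw_def sw_def tw_def Let_def)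
  have "(if f 0 then slots k else 0) + card {w. member k w \<and> f w} = d" if k: "k < 2 * P" for k
  proof (cases "k < P")
    case True
    define c l where "c = k div W" and "l = k mod W"
    have cl: "c < C" "l < W"
      using True W by (auto simp: c_def l_def P_def less_mult_imp_div_less)
    have fin: "f (inw k) \<longleftrightarrow> \<not> h0 c < l"
      using True by (simp add: inw_def f s_def c_def l_def)
    have fout: "f (outw k) \<longleftrightarrow> h0 c < l + 1"
    proof (cases "l + 1 = W")
      case True
      then show ?thesis using h0W[OF cl(1)] by (simp add: outw_def f l_def)
    next
      case False
      then have l1: "(l + 1) mod W = l + 1" using cl by simp
      define n where "n = l + 1"
      have "n < W" using cl False by (simp add: n_def)
      then have "(c * W + n) div W = c" "(c * W + n) mod W = n" by simp_all
      then have "(c * W + (l + 1)) div W = c" "(c * W + (l + 1)) mod W = l + 1"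
        by (simp_all only: n_def)
      then show ?thesis using l1 unfolding outw_def f s_def c_def[symmetric] l_def[symmetric] by simp
    qed
    have fx: "f (xw l) \<longleftrightarrow> \<not> X l" using cl by (simp add: f)
    show ?thesis
      using card_member_cross[OF True, of f] fin fout fx h0[OF cl] d True f(1)
      by (auto simp: slots_def incident_def c_def[symmetric] l_def[symmetric] of_bool_def)
  next
    case False
    then have p: "k - P < P" using k by simp
    have "(if f 0 then slots k else 0) = d - 1" using False f(1) by (simp add: slots_def incident_def)
    moreover have "card {w. member k w \<and> f w} = 1"
      using card_member_inverter[OF p, of f] False p by (auto simp: f of_bool_def s_def)
    ultimately show ?thesis using d by simp
  qed
  moreover have "\<exists>w<wn. f w" using f(1) by (auto simp: wn_def)
  ultimately have "solution f" unfolding solution_iff by blast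
  then show ?thesis by blast
qed

lemma solution_imp_cover:
  assumes f: "solution f"
  shows "\<exists>X. exact_cover X"
proof -
  have con: "(if f 0 then slots k else 0) + card {w. member k w \<and> f w} \<in> {0, d}" if "k < 2 * P" for k
    using f that unfolding solution_iff by blast
  \<comment> \<open>Without wire \<open>0\<close> an inverter counts at most \<open>2 < d\<close>
    members, hence none, so no \<open>sw\<close> or \<open>tw\<close> is selected. A crossing of
    incident row and column then counts at most one, so no column wire is selected either, and the
    solution would be empty.\<close>
  have f0: "f 0"
  proof (rule ccontr)
    assume nf: "\<not> f 0"
    have st: "\<not> f (sw p) \<and> \<not> f (tw p)" if p: "p < P" for p
      using con[of "P + p"] p nf d card_member_inverter[OF p, of f] by (auto simp: of_bool_def split: if_splits)
    have x: "\<not> f (xw l)" if l: "l < W" for l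
    proof -
      obtain c where c: "c < C" "inc c l" using inc[OF l] by blast
      define p where "p = c * W + l"
      have p: "p < P" unfolding p_def P_def using c(1) l by (rule mult_add_less)
      have pd: "p div W = c" "p mod W = l" using l by (simp_all add: p_def)
      have "\<not> f (inw p)" "\<not> f (outw p)"
        using st[OF p] st[OF outw_idx[OF p]] by (simp_all add: inw_def outw_def)
      then show ?thesis
        using con[of p] p nf d c(2) card_member_cross[OF p, of f] by (auto simp: pd of_bool_def split: if_splits)
    qed
    obtain w where "w < wn" "f w" using f unfolding solution_iff by blast
    then show False using nf st x by (elim wire_cases) auto
  qed
  have con': "slots k + card {w. member k w \<and> f w} = d" if "k < 2 * P" for k
    using con[OF that] f0 d by (auto simp: slots_def split: if_splits)
  have st: "f (tw p) \<longleftrightarrow> \<not> f (sw p)" if p: "p < P" for p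
    using con'[of "P + p"] p d card_member_inverter[OF p, of f]
    by (auto simp: slots_def incident_def of_bool_def split: if_splits)
  define X where "X l \<longleftrightarrow> \<not> f (xw l)" for l
  have "card {l. l < W \<and> X l \<and> inc c l} = 1" if c: "c < C" for c
  proof -
    define s where "s l \<longleftrightarrow> (if l = W then f (tw (c * W)) else \<not> f (inw (c * W + l)))" for l
    have step: "(of_bool (s (Suc l)) :: nat) = of_bool (s l) + of_bool (X l \<and> inc c l)" if l: "l < W" for l
    proof -
      define p where "p = c * W + l"
      have p: "p < P" unfolding p_def P_def using c l by (rule mult_add_less)
      have pd: "p div W = c" "p mod W = l" using l by (simp_all add: p_def)
      have out: "f (outw p) \<longleftrightarrow> s (Suc l)"
      proof (cases "Suc l = W")
        case True
        then show ?thesis by (simp add: outw_def pd s_def)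
      next
        case False
        then have "c * W + Suc l < P" unfolding P_def using c l by (intro mult_add_less) auto
        then show ?thesis using False l st[of "c * W + Suc l"]
          by (simp add: outw_def pd s_def inw_def)
      qed
      have "f (inw p) \<longleftrightarrow> \<not> s l" using l by (simp add: s_def p_def)
      then show ?thesis
        using con'[of p] p d card_member_cross[OF p, of f] out
        by (auto simp: slots_def incident_def pd X_def of_bool_def split: if_splits)
    qed
    have count: "(of_bool (s l) :: nat) = of_bool (s 0) + card {l'. l' < l \<and> X l' \<and> inc c l'}" if "l \<le> W" for l
      using that
    proof (induction l)
      case (Suc l)
      have "{l'. l' < Suc l \<and> X l' \<and> inc c l'} =
          (if X l \<and> inc c l then insert l {l'. l' < l \<and> X l' \<and> inc c l'} else {l'. l' < l \<and> X l' \<and> inc c l'})"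
        by (auto simp: less_Suc_eq)
      then show ?case using Suc step[of l] by simp
    qed simp
    have "c * W < P" using mult_add_less[OF c, of 0 W] W by (simp add: P_def)
    \<comment> \<open>Both ends of the chain are read off the same wire \<open>tw (c * W)\<close>
      with opposite signs; since the count never decreases, it rises from \<open>0\<close> to
      \<open>1\<close>.\<close>
    then have "s W \<longleftrightarrow> \<not> s 0" using W by (simp add: s_def inw_def)
    then show ?thesis using count[of W] by (auto simp: of_bool_def split: if_splits)
  qed
  then show ?thesis unfolding exact_cover_def by blast
qed

theorem spectral_degeneracy_iff_exact_cover:
  "spectral_degeneracy graph \<ge> real d \<longleftrightarrow> (\<exists>X. exact_cover X)"
  using spectral_degeneracy_iff_solution cover_imp_solution solution_imp_cover by blast

end

section \<open>Tilings as exact covers\<close>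

text \<open>Site \<open>p = t * I + i\<close> of a grid with \<open>T\<close> rows and \<open>I\<close> columns. Each tile position covers
  its site, the second element of its site if the tile is allowed there, and at an edge to the next site
  to the right or above the colour of the edge, while the neighbour covers all colours but its own: an edge is exactly
  covered iff both colours agree.\<close>

locale tiling =
  fixes T I A Kc :: nat and allowed :: "nat \<Rightarrow> nat \<Rightarrow> bool" and rc lc uc dc :: "nat \<Rightarrow> nat"
  assumes T: "T > 0" and I: "I \<ge> 2" and A: "A > 0"
    and colours: "a < A \<Longrightarrow> rc a < Kc" "a < A \<Longrightarrow> uc a < Kc"
begin

definition E :: nat where "E = 2 + 2 * Kc"

text \<open>Element \<open>e\<close> of site \<open>p\<close> against tile \<open>a\<close> at site
  \<open>q\<close>. Elements from \<open>2\<close> on are the colours of the right edge, those from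
  \<open>2 + Kc\<close> on the colours of the upper edge. Where the neighbour is missing, the site
  covers all colours of the edge itself, so they impose nothing.\<close>

definition covers :: "nat \<Rightarrow> nat \<Rightarrow> nat \<Rightarrow> nat \<Rightarrow> bool" where
  "covers p e q a \<longleftrightarrow>
     (if e = 0 then q = p
      else if e = 1 then q = p \<and> allowed p a
      else if e < 2 + Kc then
        q = p \<and> (p mod I + 1 = I \<or> rc a = e - 2) \<or> q = p + 1 \<and> p mod I + 1 \<noteq> I \<and> lc a \<noteq> e - 2
      else
        q = p \<and> (T * I \<le> p + I \<or> uc a = e - 2 - Kc) \<or> q = p + I \<and> dc a \<noteq> e - 2 - Kc)"

definition tinc :: "nat \<Rightarrow> nat \<Rightarrow> bool" where
  "tinc c l = covers (c div E) (c mod E) (l div A) (l mod A)"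

definition valid :: "(nat \<Rightarrow> nat) \<Rightarrow> bool" where
  "valid v \<longleftrightarrow> (\<forall>p<T * I. v p < A \<and> allowed p (v p) \<and>
     (p mod I + 1 < I \<longrightarrow> rc (v p) = lc (v (p + 1))) \<and>
     (p + I < T * I \<longrightarrow> uc (v p) = dc (v (p + I))))"

lemma E_pos: "E > 0" by (simp add: E_def)

lemma next_site: "p < T * I \<Longrightarrow> p mod I + 1 \<noteq> I \<Longrightarrow> p + 1 < T * I"
proof -
  assume p: "p < T * I" "p mod I + 1 \<noteq> I"
  have "p mod I < I" using I by simp
  then have "p div I * I + (p mod I + 1) < T * I"
    using p by (intro mult_add_less) (simp_all add: less_mult_imp_div_less del: mod_less_divisor)
  then show ?thesis by (simp only: add.assoc[symmetric] div_mult_mod_eq)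
qed

abbreviation chosen :: "(nat \<Rightarrow> bool) \<Rightarrow> nat \<Rightarrow> nat set" where
  "chosen X c \<equiv> {l. l < T * I * A \<and> X l \<and> tinc c l}"

text \<open>If both colours at an edge agree, the element of that colour is covered by the site
  alone and any other by the neighbour alone.\<close>

lemma valid_imp_cover:
  assumes v: "valid v"
  shows "\<exists>X. \<forall>c<T * I * E. card (chosen X c) = 1"
proof -
  define X where "X l \<longleftrightarrow> l mod A = v (l div A)" for l
  have vA: "v q < A" if "q < T * I" for q using v that by (simp add: valid_def)
  have "card (chosen X c) = 1" if c: "c < T * I * E" for c
  proof -
    define p e where "p = c div E" and "e = c mod E"
    have p: "p < T * I" using c by (simp add: p_def less_mult_imp_div_less)
    have e: "e < E" using E_pos by (simp add: e_def)
    have "chosen X c = (\<lambda>q. q * A + v q) ` {q. q < T * I \<and> covers p e q (v q)}"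
    proof (intro subset_antisym subsetI)
      fix l assume l: "l \<in> chosen X c"
      then have "l = l div A * A + v (l div A)" using div_mult_mod_eq[of l A] by (simp add: X_def)
      moreover have "l div A < T * I" using l by (simp add: less_mult_imp_div_less)
      moreover have "covers p e (l div A) (v (l div A))" using l by (auto simp: tinc_def X_def p_def e_def)
      ultimately show "l \<in> (\<lambda>q. q * A + v q) ` {q. q < T * I \<and> covers p e q (v q)}" by blast
    next
      fix l assume "l \<in> (\<lambda>q. q * A + v q) ` {q. q < T * I \<and> covers p e q (v q)}"
      then obtain q where q: "q < T * I" "covers p e q (v q)" "l = q * A + v q" by blast
      have "l div A = q" "l mod A = v q" using vA[OF q(1)] by (simp_all add: q(3))
      moreover have "l < T * I * A" unfolding q(3) using q(1) vA[OF q(1)] by (rule mult_add_less)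
      ultimately show "l \<in> chosen X c"
        using q by (simp add: X_def tinc_def p_def e_def)
    qed
    moreover have "\<exists>q0. {q. q < T * I \<and> covers p e q (v q)} = {q0}"
    proof -
      have al: "allowed p (v p)" using v p by (simp add: valid_def)
      have h: "rc (v p) = lc (v (p + 1))" if "p mod I + 1 \<noteq> I"
      proof -
        have "p mod I < I" using I by simp
        then have "p mod I + 1 < I" using that by linarith
        then show ?thesis using v p by (simp add: valid_def)
      qed
      have u: "uc (v p) = dc (v (p + I))" if "p + I < T * I" using v p that by (simp add: valid_def)
      consider "e = 0 \<or> e = 1" | "2 \<le> e" "e < 2 + Kc" | "2 + Kc \<le> e" by linarith
      then show ?thesis
      proof cases
        case 1
        then have "{q. q < T * I \<and> covers p e q (v q)} = {p}"
          using p al by (auto simp: covers_def)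
        then show ?thesis by blast
      next
        case 2
        then have cov: "covers p e q (v q) \<longleftrightarrow> q = p \<and> (p mod I + 1 = I \<or> rc (v q) = e - 2) \<or>
            q = p + 1 \<and> p mod I + 1 \<noteq> I \<and> lc (v q) \<noteq> e - 2" for q
          by (simp add: covers_def)
        have "{q. q < T * I \<and> covers p e q (v q)} =
            {if p mod I + 1 = I \<or> rc (v p) = e - 2 then p else p + 1}"
          unfolding cov using p h next_site[OF p] by auto
        then show ?thesis by blast
      next
        case 3
        then have cov: "covers p e q (v q) \<longleftrightarrow> q = p \<and> (T * I \<le> p + I \<or> uc (v q) = e - 2 - Kc) \<or>
            q = p + I \<and> dc (v q) \<noteq> e - 2 - Kc" for q
          by (auto simp: covers_def)
        have "{q. q < T * I \<and> covers p e q (v q)} =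
            {if T * I \<le> p + I \<or> uc (v p) = e - 2 - Kc then p else p + I}"
          unfolding cov using p u by auto
        then show ?thesis by blast
      qed
    qed
    ultimately show ?thesis by (auto simp: card_1_singleton_iff)
  qed
  then show ?thesis by blast
qed

text \<open>Element \<open>0\<close> selects one tile per site. If the colours at an edge differ,
  the element of the site's own colour is covered twice, by the site and by its neighbour;
  \<open>colours\<close> guarantees that this element exists.\<close>

lemma cover_imp_valid:
  assumes X: "\<And>c. c < T * I * E \<Longrightarrow> card (chosen X c) = 1"
  shows "\<exists>v. valid v"
proof -
  define Y where "Y p a \<longleftrightarrow> a < A \<and> X (p * A + a)" for p a
  have one: "\<exists>q0 a0. \<forall>q a. q < T * I \<and> Y q a \<and> covers p e q a \<longleftrightarrow> q = q0 \<and> a = a0"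
    if p: "p < T * I" "e < E" for p e
  proof -
    have c: "p * E + e < T * I * E" using p by (rule mult_add_less)
    have pe: "(p * E + e) div E = p" "(p * E + e) mod E = e" using p by simp_all
    obtain l0 where l0: "chosen X (p * E + e) = {l0}"
      using X[OF c] by (meson card_1_singletonE)
    have "q < T * I \<and> Y q a \<and> covers p e q a \<longleftrightarrow> q = l0 div A \<and> a = l0 mod A" for q a
    proof -
      have "q < T * I \<and> Y q a \<and> covers p e q a \<longleftrightarrow> a < A \<and> q * A + a \<in> chosen X (p * E + e)"
      proof (cases "a < A")
        case True
        then have "q * A + a < T * I * A \<longleftrightarrow> q < T * I"
          using mult_add_less[of q "T * I" a A] less_mult_imp_div_less[of "q * A + a" "T * I" A] by auto
        then show ?thesis using True p(2) by (auto simp: Y_def tinc_def)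
      qed (simp add: Y_def)
      also have "\<dots> \<longleftrightarrow> a < A \<and> q * A + a = l0 div A * A + l0 mod A"
        unfolding l0 by (simp add: div_mult_mod_eq)
      also have "\<dots> \<longleftrightarrow> q = l0 div A \<and> a = l0 mod A"
        using mult_add_eq_iff[of a A "l0 mod A" q "l0 div A"] A by auto
      finally show ?thesis .
    qed
    then show ?thesis by blast
  qed
  have "\<exists>a. \<forall>a'. Y p a' \<longleftrightarrow> a' = a" if p: "p < T * I" for p
  proof -
    obtain q0 a0 where 0: "\<And>q a. q < T * I \<and> Y q a \<and> covers p 0 q a \<longleftrightarrow> q = q0 \<and> a = a0"
      using one[OF p E_pos] by blast
    have "q0 = p" using 0[of q0 a0] by (simp add: covers_def)
    then have "Y p a' \<longleftrightarrow> a' = a0" for a' using 0[of p a'] p by (simp add: covers_def)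
    then show ?thesis by blast
  qed
  then obtain v where v: "\<And>p a. p < T * I \<Longrightarrow> Y p a \<longleftrightarrow> a = v p" by metis
  have vA: "v p < A" if "p < T * I" for p using v[OF that, of "v p"] by (simp add: Y_def)
  have excl: "\<not> covers p e q (v q)" if "p < T * I" "q < T * I" "q \<noteq> p" "e < E" "covers p e p (v p)" for p q e
    using one[OF that(1,4)] v[OF that(1)] v[OF that(2)] that by metis
  have "valid v"
    unfolding valid_def
  proof (intro allI impI conjI)
    fix p assume p: "p < T * I"
    show "v p < A" by (rule vA[OF p])
    have "1 < E" by (simp add: E_def)
    then obtain q0 a0 where 1: "\<And>q a. q < T * I \<and> Y q a \<and> covers p 1 q a \<longleftrightarrow> q = q0 \<and> a = a0"
      using one[OF p] by blast
    have "q0 = p" "allowed p a0" "Y p a0" using 1[of q0 a0] by (auto simp: covers_def)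
    then show "allowed p (v p)" using v[OF p] by simp
    show "rc (v p) = lc (v (p + 1))" if i: "p mod I + 1 < I"
    proof (rule ccontr)
      assume ne: "rc (v p) \<noteq> lc (v (p + 1))"
      define e where "e = rc (v p) + 2"
      have k: "e < 2 + Kc" using colours(1)[OF vA[OF p]] by (simp add: e_def)
      have n: "p + 1 < T * I" using next_site[OF p] i by simp
      have "covers p e p (v p)" "covers p e (p + 1) (v (p + 1))"
        using k ne i by (auto simp: covers_def e_def)
      then show False using excl[OF p n, of e] k by (simp add: E_def)
    qed
    show "uc (v p) = dc (v (p + I))" if n: "p + I < T * I"
    proof (rule ccontr)
      assume ne: "uc (v p) \<noteq> dc (v (p + I))"
      define e where "e = uc (v p) + 2 + Kc"
      have k: "e < 2 + 2 * Kc" "\<not> e < 2 + Kc" using colours(2)[OF vA[OF p]] by (auto simp: e_def)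
      have "covers p e p (v p)" "covers p e (p + I) (v (p + I))"
        using k ne by (auto simp: covers_def e_def)
      then show False using excl[OF p n, of e] k I by (simp add: E_def)
    qed
  qed
  then show ?thesis by blast
qed

lemma cover_system: "d \<ge> 3 \<Longrightarrow> cover_system d (T * I * E) (T * I * A) tinc"
proof
  assume "d \<ge> 3"
  then show "d \<ge> 3" .
  show "T * I * E > 0" using T I E_pos by simp
  have "1 * 2 * 1 \<le> T * I * A" using T I A by (intro mult_le_mono) auto
  then show "2 \<le> T * I * A" by simp
  fix l assume "l < T * I * A"
  then have l: "l div A < T * I" by (simp add: less_mult_imp_div_less)
  have "l div A * E + 0 < T * I * E" using l E_pos by (rule mult_add_less)
  moreover have "tinc (l div A * E) l" using E_pos by (simp add: tinc_def covers_def)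
  ultimately show "\<exists>c<T * I * E. tinc c l" by (metis add.right_neutral)
qed

end

section \<open>Computations as tilings\<close>

text \<open>Idles in the halting state, so that a tableau of fixed height records shorter
  computations as well.\<close>

definition trans :: "turing_machine \<Rightarrow> nat \<Rightarrow> nat list \<Rightarrow> nat \<times> (nat \<times> move) list" where
  "trans M q ss = (if q = states M then (q, map (\<lambda>s. (s, Stay)) ss) else delta M q ss)"

lemma step_trans:
  "step M (q, Ts) = (fst (trans M q (map read_tape Ts)), map2 act_tape (snd (trans M q (map read_tape Ts))) Ts)"
proof (cases "q = states M")
  case True
  have "map2 act_tape (map (\<lambda>s. (s, Stay)) (map read_tape Ts)) Ts = Ts"
    by (induction Ts) simp_all
  then show ?thesis using True by (simp add: step_def trans_def)
qed (simp add: step_def trans_def split: prod.splits)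

lemma trans_wf:
  assumes "wf_turing_machine M" "q \<le> states M" "length ss = tapes M" "set ss \<subseteq> {..<symbols M}"
  shows "fst (trans M q ss) \<le> states M \<and> length (snd (trans M q ss)) = tapes M \<and>
    (\<forall>j<tapes M. fst (snd (trans M q ss) ! j) < symbols M)"
proof (cases "q = states M")
  case True
  then show ?thesis using assms by (auto simp: trans_def subset_eq)
next
  case False
  obtain q' as where d: "delta M q ss = (q', as)" by fastforce
  have "q < states M" using assms(2) False by simp
  then have "case delta M q ss of (q', as) \<Rightarrow>
      q' \<le> states M \<and> length as = tapes M \<and> fst ` set as \<subseteq> {..<symbols M}"
    using assms by (simp add: wf_turing_machine_def)
  then have "q' \<le> states M \<and> length as = tapes M \<and> fst ` set as \<subseteq> {..<symbols M}"
    by (simp add: d)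
  then show ?thesis using False d by (auto simp: trans_def image_subset_iff)
qed

lemma scanned_subset:
  assumes "\<And>j i. j < length Ts \<Longrightarrow> fst (Ts ! j) i < s"
  shows "set (map read_tape Ts) \<subseteq> {..<s}"
proof
  fix y assume "y \<in> set (map read_tape Ts)"
  then obtain j where "j < length Ts" "y = read_tape (Ts ! j)" by (auto simp: in_set_conv_nth)
  then show "y \<in> {..<s}" using assms by (simp add: read_tape_def)
qed

type_synonym cell = "(nat \<times> bool) list"
type_synonym tile = "nat \<times> nat list \<times> cell \<times> cell \<times> cell"

text \<open>A tile consists of the state, the
  symbols scanned anywhere in its row, and the cells at the left neighbour, the site itself and the right
  neighbour.\<close>

definition cell_at :: "tape list \<Rightarrow> int \<Rightarrow> cell" where
  "cell_at Ts i = map (\<lambda>T. (fst T i, snd T = i)) Ts"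

text \<open>The moves are known at every site since a tile carries all scanned symbols; on
  \<open>MoveLeft\<close> a head arrives from the right neighbour, on \<open>MoveRight\<close> from
  the left one.\<close>

definition next_cell :: "(nat \<times> move) list \<Rightarrow> cell \<Rightarrow> cell \<Rightarrow> cell \<Rightarrow> cell" where
  "next_cell as x y z = map (\<lambda>j. (if snd (y ! j) then fst (as ! j) else fst (y ! j),
     (case snd (as ! j) of MoveLeft \<Rightarrow> snd (z ! j) | Stay \<Rightarrow> snd (y ! j) | MoveRight \<Rightarrow> snd (x ! j)))) [0..<length as]"

lemma next_cell_at:
  assumes "length as = length Ts"
  shows "next_cell as (cell_at Ts (i - 1)) (cell_at Ts i) (cell_at Ts (i + 1)) = cell_at (map2 act_tape as Ts) i"
  using assms
  by (intro nth_equalityI) (auto simp: next_cell_def cell_at_def act_tape_def split: move.splits)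

text \<open>Any number below \<open>n_tiles M\<close> serves as a tile, whether or not it decodes to
  a member of \<open>tiles M\<close>; what is needed of a tile is enforced by \<open>good\<close>,
  the border conditions and the colours.\<close>

definition tq :: "nat \<Rightarrow> nat" where "tq a = fst (from_nat a :: tile)"
definition tss :: "nat \<Rightarrow> nat list" where "tss a = fst (snd (from_nat a :: tile))"
definition tx :: "nat \<Rightarrow> cell" where "tx a = fst (snd (snd (from_nat a :: tile)))"
definition ty :: "nat \<Rightarrow> cell" where "ty a = fst (snd (snd (snd (from_nat a :: tile))))"
definition tz :: "nat \<Rightarrow> cell" where "tz a = snd (snd (snd (snd (from_nat a :: tile))))"

lemma tile_sel [simp]:
  "tq (to_nat (q, ss, x, y, z)) = q" "tss (to_nat (q, ss, x, y, z)) = ss"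
  "tx (to_nat (q, ss, x, y, z)) = x" "ty (to_nat (q, ss, x, y, z)) = y" "tz (to_nat (q, ss, x, y, z)) = z"
  for x y z :: cell
  by (simp_all add: tq_def tss_def tx_def ty_def tz_def)

text \<open>Horizontal matching makes overlapping views agree and spreads the state and the scanned
  symbols along the row. Matching \<open>ucol\<close> with \<open>dcol\<close> makes the row above
  the successor configuration.\<close>

definition rcol :: "nat \<Rightarrow> nat" where "rcol a = to_nat (tq a, tss a, ty a, tz a)"
definition lcol :: "nat \<Rightarrow> nat" where "lcol a = to_nat (tq a, tss a, tx a, ty a)"
definition ucol :: "turing_machine \<Rightarrow> nat \<Rightarrow> nat" where
  "ucol M a = to_nat (fst (trans M (tq a) (tss a)), next_cell (snd (trans M (tq a) (tss a))) (tx a) (ty a) (tz a))"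
definition dcol :: "nat \<Rightarrow> nat" where "dcol a = to_nat (tq a, ty a)"

definition cells :: "turing_machine \<Rightarrow> cell set" where
  "cells M = {c. set c \<subseteq> {..<symbols M} \<times> UNIV \<and> length c = tapes M}"

definition tiles :: "turing_machine \<Rightarrow> tile set" where
  "tiles M = {..states M} \<times> {ss. set ss \<subseteq> {..<symbols M} \<and> length ss = tapes M} \<times> cells M \<times> cells M \<times> cells M"

lemma finite_tiles: "finite (tiles M)"
  unfolding tiles_def cells_def by (intro finite_cartesian_product finite_lists_length_eq) auto

definition n_tiles :: "turing_machine \<Rightarrow> nat" where
  "n_tiles M = Suc (Max (insert 0 (to_nat ` tiles M)))"

definition n_colours :: "turing_machine \<Rightarrow> nat" where
  "n_colours M = Suc (Max (rcol ` {..<n_tiles M} \<union> ucol M ` {..<n_tiles M}))"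

lemma n_tiles: "\<tau> \<in> tiles M \<Longrightarrow> to_nat \<tau> < n_tiles M"
  unfolding n_tiles_def less_Suc_eq_le by (rule Max_ge) (auto simp: finite_tiles)

lemma n_colours: "a < n_tiles M \<Longrightarrow> rcol a < n_colours M" "a < n_tiles M \<Longrightarrow> ucol M a < n_colours M"
  unfolding n_colours_def less_Suc_eq_le by (rule Max_ge; simp)+

text \<open>The scanned symbols are guessed; the site at which a head stands verifies the guess, and
  the horizontal colours make it common to the row.\<close>

definition good :: "turing_machine \<Rightarrow> nat \<Rightarrow> bool" where
  "good M a \<longleftrightarrow> tq a \<le> states M \<and> length (tss a) = tapes M \<and> length (ty a) = tapes M \<and>
     (\<forall>j<tapes M. snd (ty a ! j) \<longrightarrow> tss a ! j = fst (ty a ! j))"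

definition blank :: "turing_machine \<Rightarrow> cell" where
  "blank M = replicate (tapes M) (0, False)"

text \<open>Inside the window \<open>w\<close> the second tape is free, except that after a blank
  only blanks follow. It thus carries a word no longer than the window, which realises the
  quantifier over certificates.\<close>

definition start :: "turing_machine \<Rightarrow> bool \<Rightarrow> nat \<Rightarrow> bool \<Rightarrow> nat \<Rightarrow> bool" where
  "start M h s w a \<longleftrightarrow> tq a = 0 \<and> (\<forall>j<tapes M. snd (ty a ! j) = h) \<and> fst (ty a ! 0) = s \<and>
     (\<forall>j<tapes M. 2 \<le> j \<longrightarrow> fst (ty a ! j) = 0) \<and>
     (if w then fst (ty a ! 1) < 3 \<and> (fst (ty a ! 1) = 0 \<longrightarrow> fst (tz a ! 1) = 0) else fst (ty a ! 1) = 0)"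

definition accept :: "turing_machine \<Rightarrow> bool \<Rightarrow> nat \<Rightarrow> bool" where
  "accept M h a \<longleftrightarrow> tq a = states M \<and> (h \<longrightarrow> fst (ty a ! 0) = 2)"

text \<open>\<open>word_content\<close> shifted by \<open>org\<close>, phrased with natural numbers
  and single input bits so that counters can evaluate it.\<close>

definition input_at :: "bool list \<Rightarrow> nat \<Rightarrow> nat \<Rightarrow> nat" where
  "input_at x org i = (if org \<le> i then (if i - org < length x \<and> x ! (i - org) then 2 else if i - org < length x then 1 else 0) else 0)"

definition allowed :: "turing_machine \<Rightarrow> bool list \<Rightarrow> nat \<Rightarrow> nat \<Rightarrow> nat \<Rightarrow> nat \<Rightarrow> nat \<Rightarrow> nat \<Rightarrow> bool" where
  "allowed M x T I org q p a \<longleftrightarrow> good M a \<and> (p mod I = 0 \<longrightarrow> tx a = blank M) \<and>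
     (p mod I + 1 = I \<longrightarrow> tz a = blank M) \<and>
     (p < I \<longrightarrow> start M (p mod I = org) (input_at x org (p mod I)) (org \<le> p mod I \<and> p mod I < org + q) a) \<and>
     (T * I \<le> p + I \<longrightarrow> accept M (p mod I = org) a)"

text \<open>Column \<open>org\<close> is tape cell \<open>0\<close>. In \<open>Tm\<close> steps no
  head gets farther than \<open>Tm < org\<close>, and both words fit into \<open>org\<close> cells,
  so all tapes stay blank outside the strip.\<close>

locale tableau =
  fixes M :: turing_machine and x :: "bool list" and Tm org q :: nat
  assumes wf: "wf_turing_machine M" and tapes: "tapes M \<ge> 2"
    and org: "org > Tm" "org \<ge> length x" "org \<ge> q"
begin

abbreviation I :: nat where "I \<equiv> 2 * org + 1"
abbreviation T :: nat where "T \<equiv> Tm + 1"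

sublocale tiling T I "n_tiles M" "n_colours M" "allowed M x T I org q" rcol lcol "ucol M" dcol
  by standard (use org in \<open>auto simp: n_colours n_tiles_def\<close>)

section \<open>Configurations of the verifier inside the strip\<close>

definition cfg :: "bool list \<Rightarrow> nat \<Rightarrow> config" where
  "cfg w t = (step M ^^ t) (init_config M [x, w])"

definition initial :: "bool list \<Rightarrow> nat \<Rightarrow> int \<Rightarrow> nat" where
  "initial w j = word_content (if j = 0 then x else if j = 1 then w else [])"

abbreviation cell :: "bool list \<Rightarrow> nat \<Rightarrow> int \<Rightarrow> cell" where "cell w t \<equiv> cell_at (snd (cfg w t))"
abbreviation scanned :: "bool list \<Rightarrow> nat \<Rightarrow> nat list" where "scanned w t \<equiv> map read_tape (snd (cfg w t))"

lemma cfg_0: "cfg w 0 = (0, map (\<lambda>j. (initial w j, 0)) [0..<tapes M])"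
proof -
  have "map (\<lambda>w. (word_content w, 0 :: int)) ([x, w] @ replicate (tapes M - 2) []) =
      map (\<lambda>j. (initial w j, 0)) [0..<tapes M]"
    using tapes by (intro nth_equalityI) (auto simp: initial_def nth_append nth_Cons' )
  then show ?thesis by (simp add: cfg_def init_config_def numeral_2_eq_2)
qed

lemma cfg_Suc: "cfg w (Suc t) = step M (cfg w t)"
  by (simp add: cfg_def)

lemma word_content_lt: "word_content w i < symbols M"
proof -
  have "3 \<le> symbols M" using wf by (simp add: wf_turing_machine_def)
  then show ?thesis by (auto simp: word_content_def)
qed

lemma cfg_inv:
  "fst (cfg w t) \<le> states M \<and> length (snd (cfg w t)) = tapes M \<and>
     (\<forall>j<tapes M. (\<forall>i. fst (snd (cfg w t) ! j) i < symbols M) \<and> \<bar>snd (snd (cfg w t) ! j)\<bar> \<le> int t \<and>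
       (\<forall>i. int t \<le> \<bar>i\<bar> \<longrightarrow> fst (snd (cfg w t) ! j) i = initial w j i))"
proof (induction t)
  case 0
  show ?case by (simp add: cfg_0 initial_def word_content_lt)
next
  case (Suc t)
  obtain s Ts where c: "cfg w t = (s, Ts)" by fastforce
  have len: "length Ts = tapes M" using Suc c by simp
  have inv: "\<forall>i. fst (Ts ! j) i < symbols M" "\<bar>snd (Ts ! j)\<bar> \<le> int t"
      "\<forall>i. int t \<le> \<bar>i\<bar> \<longrightarrow> fst (Ts ! j) i = initial w j i" if "j < tapes M" for j
    using Suc c that by auto
  define as where "as = snd (trans M s (map read_tape Ts))"
  have "set (map read_tape Ts) \<subseteq> {..<symbols M}"
    using inv(1) len by (intro scanned_subset) auto
  then have tr: "fst (trans M s (map read_tape Ts)) \<le> states M" "length as = tapes M"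
      "\<And>j. j < tapes M \<Longrightarrow> fst (as ! j) < symbols M"
    using trans_wf[OF wf, of s "map read_tape Ts"] Suc c len by (auto simp: as_def)
  have "cfg w (Suc t) = (fst (trans M s (map read_tape Ts)), map2 act_tape as Ts)"
    by (simp add: cfg_Suc c step_trans as_def)
  moreover have "(\<forall>i. fst (act_tape (as ! j) (Ts ! j)) i < symbols M) \<and>
      \<bar>snd (act_tape (as ! j) (Ts ! j))\<bar> \<le> int (Suc t) \<and>
      (\<forall>i. int (Suc t) \<le> \<bar>i\<bar> \<longrightarrow> fst (act_tape (as ! j) (Ts ! j)) i = initial w j i)" if j: "j < tapes M" for j
    using inv[OF j] tr(3)[OF j] by (auto simp: act_tape_def split: move.splits)
  ultimately show ?case using tr len by simp
qed

lemmas cfg_state = cfg_inv[THEN conjunct1]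
lemmas cfg_len = cfg_inv[THEN conjunct2, THEN conjunct1]

lemma cfg_symbol: "j < tapes M \<Longrightarrow> fst (snd (cfg w t) ! j) i < symbols M"
  and cfg_head: "j < tapes M \<Longrightarrow> \<bar>snd (snd (cfg w t) ! j)\<bar> \<le> int t"
  and cfg_far: "j < tapes M \<Longrightarrow> int t \<le> \<bar>i\<bar> \<Longrightarrow> fst (snd (cfg w t) ! j) i = initial w j i"
  using cfg_inv[of w t] by auto

lemma cfg_scanned: "set (scanned w t) \<subseteq> {..<symbols M}"
  using cfg_symbol[of _ w t] cfg_len[of w t] by (intro scanned_subset) auto

lemma cell_outside:
  assumes "t \<le> Tm" "length w \<le> q" "\<bar>i\<bar> = int org + 1"
  shows "cell w t i = blank M"
proof (rule nth_equalityI)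
  show "length (cell w t i) = length (blank M)"
    by (simp add: cell_at_def cfg_len blank_def)
  fix j assume "j < length (cell w t i)"
  then have j: "j < tapes M" by (simp add: cell_at_def cfg_len)
  have "snd (snd (cfg w t) ! j) \<noteq> i" using cfg_head[OF j, of w t] assms org by auto
  moreover have "fst (snd (cfg w t) ! j) i = 0"
    using cfg_far[OF j, of t i w] assms org by (auto simp: initial_def word_content_def)
  ultimately show "cell w t i ! j = blank M ! j"
    using j by (simp add: cell_at_def cfg_len blank_def)
qed

lemma cell_at_in_cells: "cell w t i \<in> cells M"
  using cfg_symbol[of _ w t i] cfg_len[of w t]
  by (force simp: cells_def cell_at_def in_set_conv_nth)

lemma cell_at_step:
  "cell w (Suc t) i =
    next_cell (snd (trans M (fst (cfg w t)) (scanned w t)))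
      (cell w t (i - 1)) (cell w t i) (cell w t (i + 1))" (is ?cell)
  and state_step: "fst (cfg w (Suc t)) = fst (trans M (fst (cfg w t)) (scanned w t))" (is ?state)
proof -
  have len: "length (snd (trans M (fst (cfg w t)) (scanned w t))) = length (snd (cfg w t))"
    using trans_wf[OF wf cfg_state _ cfg_scanned] by (simp add: cfg_len)
  have "cfg w (Suc t) = step M (fst (cfg w t), snd (cfg w t))" by (simp add: cfg_Suc)
  note eq = this[unfolded step_trans]
  show ?cell
    unfolding next_cell_at[OF len] eq by simp
  show ?state
    unfolding eq by simp
qed

lemma input_at_eq: "input_at x org i = word_content x (int i - int org)"
  by (auto simp: input_at_def word_content_def nat_diff_distrib' )

definition accepting :: "config \<Rightarrow> bool" where
  "accepting c \<longleftrightarrow> fst c = states M \<and> fst (snd c ! 0) 0 = 2"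

lemma run_imp_tiling:
  assumes w: "length w \<le> q" and acc: "accepting (cfg w Tm)"
  shows "\<exists>v. valid v"
proof -
  define tile where "tile t i = (fst (cfg w t), scanned w t,
    cell w t (i - 1), cell w t i, cell w t (i + 1))" for t i
  define v where "v p = to_nat (tile (p div I) (int (p mod I) - int org))" for p
  have sel: "tq (v p) = fst (cfg w (p div I))" "tss (v p) = scanned w (p div I)"
    "tx (v p) = cell w (p div I) (int (p mod I) - int org - 1)"
    "ty (v p) = cell w (p div I) (int (p mod I) - int org)"
    "tz (v p) = cell w (p div I) (int (p mod I) - int org + 1)" for p
    by (simp_all only: v_def tile_def tile_sel)
  have "valid v"
    unfolding valid_def
  proof (intro allI impI conjI)
    fix p assume p: "p < T * I"
    define t i where "t = p div I" and "i = p mod I"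
    have t: "t \<le> Tm" using p less_mult_imp_div_less[of p T I] by (simp add: t_def)
    have i: "i < I" by (simp add: i_def)
    have pti: "p = t * I + i" by (simp only: t_def i_def div_mult_mod_eq)
    note sel' = sel[of p, folded t_def i_def]
    have "tile t (int i - int org) \<in> tiles M"
      using cfg_scanned[of w t] by (auto simp: tile_def tiles_def cfg_state cfg_len cell_at_in_cells)
    then show "v p < n_tiles M" unfolding v_def t_def i_def by (rule n_tiles)
    show "allowed M x T I org q p (v p)"
      unfolding allowed_def i_def[symmetric]
    proof (intro conjI impI)
      show "good M (v p)"
        unfolding good_def sel' by (auto simp: cfg_state cfg_len cell_at_def read_tape_def)
      show "tx (v p) = blank M" if "i = 0"
        unfolding sel' using t w that by (intro cell_outside) auto
      show "tz (v p) = blank M" if "i + 1 = I"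
        unfolding sel' using t w that by (intro cell_outside) auto
      show "start M (i = org) (input_at x org i) (org \<le> i \<and> i < org + q) (v p)" if "p < I"
      proof -
        have t0: "t = 0" using that by (simp add: t_def)
        have nth: "cell w 0 m ! j = (initial w j m, 0 = m)" if "j < tapes M" for j m
          using that by (simp add: cfg_0 cell_at_def)
        have y: "ty (v p) ! j = (initial w j (int i - int org), 0 = int i - int org)" if "j < tapes M" for j
          unfolding sel' t0 using that by (rule nth)
        have z: "tz (v p) ! 1 = (initial w 1 (int i - int org + 1), 0 = int i - int org + 1)"
          unfolding sel' t0 using tapes by (intro nth) simp
        have st: "tq (v p) = 0" unfolding sel' t0 by (simp add: cfg_0)
        have "(0 = int i - int org) \<longleftrightarrow> i = org" by auto
        moreover have "word_content w (int i - int org) = 0" if "\<not> (org \<le> i \<and> i < org + q)"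
          using that w by (auto simp: word_content_def)
        moreover have "word_content w (int i - int org + 1) = 0" if "org \<le> i" "word_content w (int i - int org) = 0"
          using that by (auto simp: word_content_def split: if_splits)
        moreover have "word_content w (int i - int org) < 3" by (simp add: word_content_def)
        ultimately show ?thesis
          unfolding start_def using tapes
          by (auto simp: y z[simplified] st input_at_eq initial_def word_content_def[of "[]"])
      qed
      show "accept M (i = org) (v p)" if "T * I \<le> p + I"
      proof -
        have "Tm * I \<le> p" using that by (simp add: algebra_simps)
        then have "Tm * I div I \<le> p div I" by (rule div_le_mono)
        moreover have "Tm * I div I = Tm" by (intro nonzero_mult_div_cancel_right) simp
        ultimately have "Tm \<le> t" by (simp only: t_def)
        then have "t = Tm" using t by simp
        then show ?thesis
          unfolding accept_def sel' using acc tapes cfg_len[of w Tm]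
          by (auto simp: accepting_def cell_at_def)
      qed
    qed
    show "rcol (v p) = lcol (v (p + 1))" if "p mod I + 1 < I"
    proof -
      have "i + 1 < I" using that by (simp add: i_def)
      then have "(t * I + (i + 1)) div I = t" "(t * I + (i + 1)) mod I = i + 1"
        by (simp_all only: div_mult_self3 div_less mod_mult_self3 mod_less)
      moreover have "p + 1 = t * I + (i + 1)" by (simp add: pti)
      ultimately have "(p + 1) div I = t" "(p + 1) mod I = i + 1" by simp_all
      note sel2 = sel[of "p + 1", unfolded this]
      show ?thesis unfolding rcol_def lcol_def sel' sel2 by (simp add: algebra_simps)
    qed
    show "ucol M (v p) = dcol (v (p + I))"
    proof -
      have "(p + I) div I = Suc t" unfolding t_def by (subst div_add_self2) simp_all
      moreover have "(p + I) mod I = i" unfolding i_def by (rule mod_add_self2)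
      ultimately have "(p + I) div I = Suc t" "(p + I) mod I = i" by blast+
      note sel2 = sel[of "p + I", unfolded this]
      show ?thesis unfolding ucol_def dcol_def sel' sel2 cell_at_step state_step ..
    qed
  qed
  then show ?thesis by blast
qed

lemma tiling_imp_run:
  assumes "valid v"
  shows "\<exists>w. length w \<le> q \<and> accepting (cfg w Tm)"
proof -
  define a where "a t i = v (t * I + i)" for t i
  have idx: "(t * I + i) div I = t" "(t * I + i) mod I = i" if "i < I" for t i
    using that by (simp_all only: div_mult_self3 mod_mult_self3 mod_less div_less)
  have less: "t * I + i < T * I" if "t \<le> Tm" "i < I" for t i
    using that by (intro mult_add_less) auto
  have al: "allowed M x T I org q (t * I + i) (a t i)" if "t \<le> Tm" "i < I" for t i
    using assms less[OF that] unfolding valid_def a_def by blast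
  have good: "good M (a t i)" if "t \<le> Tm" "i < I" for t i
    using al[OF that] by (simp add: allowed_def)
  have left: "tx (a t 0) = blank M" if "t \<le> Tm" for t
    using al[OF that, of 0] idx[of 0 t] by (simp add: allowed_def)
  have right: "tz (a t (2 * org)) = blank M" if "t \<le> Tm" for t
    using al[OF that, of "2 * org"] idx[of "2 * org" t] by (simp add: allowed_def)
  have hor: "tq (a t i) = tq (a t (i + 1)) \<and> tss (a t i) = tss (a t (i + 1)) \<and>
      ty (a t i) = tx (a t (i + 1)) \<and> tz (a t i) = ty (a t (i + 1))" if "t \<le> Tm" "i + 1 < I" for t i
  proof -
    have "(t * I + i) mod I + 1 < I" using idx(2)[of i t] that by simp
    then have "rcol (v (t * I + i)) = lcol (v (t * I + i + 1))"
      using assms less[of t i] that unfolding valid_def by simp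
    then show ?thesis by (simp add: rcol_def lcol_def a_def add.assoc)
  qed
  have ver: "fst (trans M (tq (a t i)) (tss (a t i))) = tq (a (Suc t) i) \<and>
      next_cell (snd (trans M (tq (a t i)) (tss (a t i)))) (tx (a t i)) (ty (a t i)) (tz (a t i)) = ty (a (Suc t) i)"
    if "Suc t \<le> Tm" "i < I" for t i
  proof -
    have "t * I + i + I < T * I" using less[of "Suc t" i] that by (simp add: algebra_simps)
    then have "ucol M (v (t * I + i)) = dcol (v (t * I + i + I))"
      using assms less[of t i] that unfolding valid_def by simp
    then show ?thesis by (simp add: ucol_def dcol_def a_def algebra_simps)
  qed
  have row: "tq (a t i) = tq (a t 0) \<and> tss (a t i) = tss (a t 0)" if "t \<le> Tm" "i < I" for t i
    using that(2)
  proof (induction i)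
    case (Suc i)
    then show ?case using hor[OF that(1), of i] by simp
  qed simp
  have st: "start M (i = org) (input_at x org i) (org \<le> i \<and> i < org + q) (a 0 i)" if "i < I" for i
    using al[of 0 i] that by (simp add: allowed_def)
  define s where "s m = fst (ty (a 0 (org + m)) ! 1)" for m
  \<comment> \<open>The certificate ends at its first blank or fills the window of length
    \<open>q\<close>.\<close>
  define len where "len = (LEAST m. m = q \<or> s m = 0)"
  have len: "len = q \<or> s len = 0" unfolding len_def by (rule LeastI[of _ q]) simp
  have len_le: "len \<le> q" unfolding len_def by (rule Least_le) simp
  have before: "s m \<noteq> 0" if "m < len" for m using not_less_Least[of m] that unfolding len_def by blast
  have s3: "s m < 3" if "m < q" for m
    using st[of "org + m"] that org by (simp add: start_def s_def)
  have after: "s m = 0" if "len \<le> m" "m < q" for m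
    using that
  proof (induction m)
    case 0
    then show ?case using len by simp
  next
    case (Suc m)
    show ?case
    proof (cases "len = Suc m")
      case True
      then show ?thesis using len Suc by simp
    next
      case False
      then have "s m = 0" using Suc by simp
      then have "fst (tz (a 0 (org + m)) ! 1) = 0"
        using st[of "org + m"] Suc.prems org by (simp add: start_def s_def)
      then show ?thesis using hor[of 0 "org + m"] Suc.prems org by (simp add: s_def)
    qed
  qed
  define w where "w = map (\<lambda>m. s m = 2) [0..<len]"
  have lenw: "length w = len" by (simp add: w_def)
  have wc: "word_content w (int m) = s m" if "m < q" for m
  proof (cases "m < len")
    case True
    then have "s m = 1 \<or> s m = 2" using before[OF True] s3[OF that] by linarith
    then show ?thesis using True by (auto simp: word_content_def w_def)
  next
    case False
    then show ?thesis using after[of m] that by (simp add: word_content_def w_def)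
  qed
  have row0: "ty (a 0 i) = cell w 0 (int i - int org)" if i: "i < I" for i
  proof (rule nth_equalityI)
    show "length (ty (a 0 i)) = length (cell w 0 (int i - int org))"
      using good[OF _ i, of 0] by (simp add: good_def cell_at_def cfg_len)
    fix j assume "j < length (ty (a 0 i))"
    then have j: "j < tapes M" using good[OF _ i, of 0] by (simp add: good_def)
    have tape1: "fst (ty (a 0 i) ! 1) = word_content w (int i - int org)"
    proof (cases "org \<le> i \<and> i < org + q")
      case True
      then have "i - org < q" "org + (i - org) = i" "int (i - org) = int i - int org" by auto
      then show ?thesis using wc[of "i - org"] by (simp add: s_def)
    next
      case False
      then have "fst (ty (a 0 i) ! 1) = 0" using st[OF i] by (auto simp: start_def)
      moreover have "word_content w (int i - int org) = 0"
        using False lenw len_le by (auto simp: word_content_def)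
      ultimately show ?thesis by simp
    qed
    have h: "(i = org) \<longleftrightarrow> (0 = int i - int org)" by auto
    have "fst (ty (a 0 i) ! j) = initial w j (int i - int org)"
    proof -
      consider "j = 0" | "j = 1" | "2 \<le> j" by linarith
      then show ?thesis
        using st[OF i] tape1 j by cases (auto simp: start_def initial_def input_at_eq word_content_def[of "[]"])
    qed
    moreover have "snd (ty (a 0 i) ! j) \<longleftrightarrow> 0 = int i - int org"
      using st[OF i] j h unfolding start_def by blast
    ultimately show "ty (a 0 i) ! j = cell w 0 (int i - int org) ! j"
      using j by (simp add: cell_at_def cfg_0 prod_eq_iff)
  qed
  have main: "\<forall>i<I. tq (a t i) = fst (cfg w t) \<and> ty (a t i) = cell w t (int i - int org)"
    if "t \<le> Tm" for t
    using that
  proof (induction t)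
    case 0
    show ?case using row0 st by (simp add: start_def cfg_0)
  next
    case (Suc t)
    then have t: "t \<le> Tm" by simp
    have IH: "tq (a t i) = fst (cfg w t)" "ty (a t i) = cell w t (int i - int org)" if "i < I" for i
      using Suc that by auto
    \<comment> \<open>The head of tape \<open>j\<close> stands in some column \<open>i0\<close> of
      the strip. There \<open>good\<close> ties the guessed symbol to the cell, and
      \<open>row\<close> carries it to column \<open>i\<close>.\<close>
    have scan: "tss (a t i) = scanned w t" if i: "i < I" for i
    proof (rule nth_equalityI)
      show len: "length (tss (a t i)) = length (scanned w t)"
        using good[OF t i] by (simp add: good_def cfg_len)
      fix j assume "j < length (tss (a t i))"
      then have j: "j < tapes M" using good[OF t i] by (simp add: good_def)
      define h where "h = snd (snd (cfg w t) ! j)"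
      have h: "\<bar>h\<bar> \<le> int t" using cfg_head[OF j] by (simp add: h_def)
      define i0 where "i0 = nat (h + int org)"
      have i0: "int i0 = h + int org" "i0 < I" using h t org by (auto simp: i0_def)
      have "ty (a t i0) ! j = (fst (snd (cfg w t) ! j) h, True)"
        using IH(2)[OF i0(2)] i0(1) j by (simp add: cell_at_def cfg_len h_def)
      then have "tss (a t i0) ! j = fst (snd (cfg w t) ! j) h"
        using good[OF t i0(2)] j by (simp add: good_def)
      moreover have "tss (a t i) = tss (a t i0)" using row[OF t i] row[OF t i0(2)] by simp
      ultimately show "tss (a t i) ! j = scanned w t ! j"
        using j by (simp add: cfg_len read_tape_def h_def)
    qed
    have tx: "tx (a t i) = cell w t (int i - int org - 1)" if i: "i < I" for i
    proof (cases i)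
      case 0
      then show ?thesis using left[OF t] t lenw len_le by (simp add: cell_outside)
    next
      case (Suc i')
      then show ?thesis using hor[OF t, of i'] IH(2)[of i'] i by (simp add: algebra_simps)
    qed
    have tz: "tz (a t i) = cell w t (int i - int org + 1)" if i: "i < I" for i
    proof (cases "i + 1 = I")
      case True
      then have "i = 2 * org" by simp
      then show ?thesis using right[OF t] t lenw len_le by (simp add: cell_outside)
    next
      case False
      then show ?thesis using hor[OF t, of i] IH(2)[of "i + 1"] i by (simp add: algebra_simps)
    qed
    show ?case
    proof (intro allI impI conjI)
      fix i assume i: "i < I"
      show "tq (a (Suc t) i) = fst (cfg w (Suc t))"
        unfolding state_step using ver[OF Suc.prems i] IH(1)[OF i] scan[OF i] by simp
      show "ty (a (Suc t) i) = cell w (Suc t) (int i - int org)"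
        unfolding cell_at_step using ver[OF Suc.prems i] IH[OF i] scan[OF i] tx[OF i] tz[OF i] by simp
    qed
  qed
  have "accept M True (a Tm org)"
    using al[of Tm org] idx[of org Tm] by (simp add: allowed_def)
  moreover have "tq (a Tm org) = fst (cfg w Tm)" "ty (a Tm org) = cell w Tm 0"
    using main[of Tm] by auto
  ultimately have "accepting (cfg w Tm)"
    using cfg_len[of w Tm] tapes by (simp add: accept_def accepting_def cell_at_def)
  then show ?thesis using lenw len_le by auto
qed

theorem valid_iff_accepting: "(\<exists>v. valid v) \<longleftrightarrow> (\<exists>w. length w \<le> q \<and> accepting (cfg w Tm))"
  using run_imp_tiling tiling_imp_run by blast

end

section \<open>The reduction is computable\<close>

lemma decidable_If [intro, simp]:
  assumes "decidable b" "decidable c" "decidable e"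
  shows "decidable (\<lambda>x i j. if b x i j then c x i j else e x i j)"
proof -
  have "(\<lambda>x i j. if b x i j then c x i j else e x i j) = (\<lambda>x i j. b x i j \<and> c x i j \<or> \<not> b x i j \<and> e x i j)"
    by (auto simp: fun_eq_iff)
  then show ?thesis using assms by (simp only:) (intro decidable_disj decidable_conj decidable_not)
qed

lemma computable_sum: "(\<And>c. c \<in> S \<Longrightarrow> computable (f c)) \<Longrightarrow> computable (\<lambda>x i j. \<Sum>c\<in>S. f c x i j)"
  by (induction S rule: infinite_finite_induct) auto

text \<open>A function of a number below a constant is a finite table, written as a sum over its
  entries. In this way the fixed verifier enters the reduction.\<close>

lemma computable_table:
  assumes "computable f" "\<And>x i j. f x i j < A"
  shows "computable (\<lambda>x i j. h (f x i j))"
proof -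
  have "h (f x i j) = (\<Sum>c<A. of_bool (f x i j = c) * h c)" for x i j
  proof -
    have "(\<Sum>c<A. of_bool (f x i j = c) * h c) = (\<Sum>c<A. if c = f x i j then h c else 0)"
      by (intro sum.cong) auto
    then show ?thesis using assms(2)[of x i j] by (simp add: sum.delta)
  qed
  moreover have "computable (\<lambda>x i j. \<Sum>c<A. of_bool (f x i j = c) * h c)"
    using assms(1) decidable_eq[OF assms(1) computable_const]
    by (intro computable_sum computable_mult) (auto simp: decidable_def)
  ultimately show ?thesis by (simp only:)
qed

lemma decidable_finite:
  assumes "computable f" "\<And>x i j. f x i j < A"
  shows "decidable (\<lambda>x i j. Q (f x i j))"
  unfolding decidable_def using assms by (rule computable_table[where h = "\<lambda>a. of_bool (Q a)"])

lemma decidable_finite2: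
  assumes "computable f" "\<And>x i j. f x i j < A" "computable g" "\<And>x i j. g x i j < B"
  shows "decidable (\<lambda>x i j. Q (f x i j) (g x i j))"
proof -
  have "decidable (\<lambda>x i j. (\<lambda>n. Q (n div B) (n mod B)) (f x i j * B + g x i j))"
    using assms by (intro decidable_finite[where A = "A * B"] computable_add computable_mult mult_add_less) auto
  moreover have "(f x i j * B + g x i j) div B = f x i j" "(f x i j * B + g x i j) mod B = g x i j" for x i j
    using assms(4)[of x i j] by simp_all
  ultimately show ?thesis by (simp only:)
qed

lemma decidable_bool_arg:
  assumes "decidable b" "\<And>h. decidable (Q h)"
  shows "decidable (\<lambda>x i j. Q (b x i j) x i j)"
proof -
  have "(\<lambda>x i j. Q (b x i j) x i j) = (\<lambda>x i j. if b x i j then Q True x i j else Q False x i j)"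
    by (auto simp: fun_eq_iff)
  then show ?thesis using assms by (simp only:) (intro decidable_If)
qed

lemmas comp_intros = decidable_input decidable_conj decidable_disj decidable_imp decidable_not decidable_If
  decidable_less decidable_le decidable_eq
  computable_length computable_fst computable_snd computable_add computable_Suc computable_diff
  computable_mult computable_div computable_mod computable_poly computable_If computable_const

text \<open>Unfolded to closed arithmetic formulas, to which the introduction rules apply
  syntactically once the locale parameters depend on the input.\<close>

lemmas (in wire_system) adj_unfolded = adj_def[unfolded link_def gap_def nw_def M_def]
lemmas (in wire_system) nv_unfolded = nv_def[unfolded nw_def M_def]

lemma decidable_adj:
  assumes ws: "\<And>x. wire_system d (wn x) (K x)"
    and wn: "computable (\<lambda>x i j. wn x)" and K: "computable (\<lambda>x i j. K x)"
    and used: "\<And>f. computable f \<Longrightarrow> decidable (\<lambda>x i j. used x (f x i j))"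
  shows "decidable (\<lambda>x i j. wire_system.adj d (wn x) (K x) (used x) i j)"
proof -
  have pos: "0 < K x * (d - 1)" "0 < d - 1" for x
    using ws[of x] by (auto simp: wire_system_def)
  show ?thesis
    unfolding wire_system.adj_unfolded[OF ws]
    by (intro used wn K comp_intros) (use pos in auto)
qed

lemma computable_nv:
  assumes ws: "\<And>x. wire_system d (wn x) (K x)"
    and wn: "computable (\<lambda>x i j. wn x)" and K: "computable (\<lambda>x i j. K x)"
  shows "computable (\<lambda>x i j. wire_system.nv d (wn x) (K x))"
  unfolding wire_system.nv_unfolded[OF ws] by (intro wn K comp_intros)

lemmas (in cover_system) cused_unfolded =
  cused_def[unfolded slots_def incident_def member_def inw_def outw_def sw_def tw_def xw_def P_def Let_def]
lemmas (in cover_system) wn_unfolded = wn_def[unfolded P_def]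

lemma decidable_cused:
  assumes cs: "\<And>x. cover_system d (C x) (W x) (inc x)"
    and C: "computable (\<lambda>x i j. C x)" and W: "computable (\<lambda>x i j. W x)"
    and inc: "\<And>f g. computable f \<Longrightarrow> computable g \<Longrightarrow> decidable (\<lambda>x i j. inc x (f x i j) (g x i j))"
    and f: "computable f"
  shows "decidable (\<lambda>x i j. cover_system.cused d (C x) (W x) (inc x) (f x i j))"
proof -
  have pos: "0 < C x" "0 < W x" "0 < d - 1" for x
    using cs[of x] by (auto simp: cover_system_def)
  then have pos': "0 < 2 * (C x * W x) * (d - 1)" for x by simp
  show ?thesis
    unfolding cover_system.cused_unfolded[OF cs]
    by (intro f C W inc comp_intros) (use pos pos' in auto)
qed

lemmas (in tiling) tinc_unfolded = tinc_def[unfolded covers_def E_def]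

lemma decidable_tinc:
  assumes tl: "\<And>x. tiling (T x) (I x) A Kc rc uc"
    and T: "computable (\<lambda>x i j. T x)" and I: "computable (\<lambda>x i j. I x)"
    and al: "\<And>f g. computable f \<Longrightarrow> computable g \<Longrightarrow> (\<And>x i j. g x i j < A) \<Longrightarrow>
        decidable (\<lambda>x i j. al x (f x i j) (g x i j))"
    and f: "computable f" and g: "computable g"
  shows "decidable (\<lambda>x i j. tiling.tinc (T x) (I x) A Kc (al x) rc lc uc dc (f x i j) (g x i j))"
proof -
  have pos: "0 < I x" "0 < A" for x
    using tl[of x] by (auto simp: tiling_def)
  have ga: "computable (\<lambda>x i j. g x i j mod A)"
    by (intro g comp_intros) (use pos in auto)
  note table = computable_table[OF ga, of A, where h = rc] computable_table[OF ga, of A, where h = lc]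
    computable_table[OF ga, of A, where h = uc] computable_table[OF ga, of A, where h = dc]
  show ?thesis
    unfolding tiling.tinc_unfolded[OF tl]
    by (intro f g T I al table comp_intros) (use pos in auto)
qed

lemma decidable_allowed:
  assumes T: "computable (\<lambda>x i j. T x)" and org: "computable (\<lambda>x i j. org x)" and q: "computable (\<lambda>x i j. q x)"
    and f: "computable f" and g: "computable g" "\<And>x i j. g x i j < A"
  shows "decidable (\<lambda>x i j. allowed M x (T x) (2 * org x + 1) (org x) (q x) (f x i j) (g x i j))"
proof -
  let ?i = "\<lambda>x i j. f x i j mod (2 * org x + 1)"
  let ?s = "\<lambda>x i j. input_at x (org x) (?i x i j)" and ?w = "\<lambda>x i j. org x \<le> ?i x i j \<and> ?i x i j < org x + q x"
  have i: "computable (\<lambda>x i j. ?i x i j)"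
    by (intro f org comp_intros) simp
  have inp: "computable (\<lambda>x i j. ?s x i j)"
    unfolding input_at_def by (intro i org comp_intros)
  have start: "decidable (\<lambda>x i j. start M (?i x i j = org x)
      (?s x i j)
      (?w x i j) (g x i j))"
  proof (rule decidable_bool_arg[where Q = "\<lambda>h x i j. start M h
        (?s x i j)
        (?w x i j) (g x i j)"])
    show "decidable (\<lambda>x i j. ?i x i j = org x)"
      by (intro i org comp_intros)
    fix h
    show "decidable (\<lambda>x i j. start M h (?s x i j)
        (?w x i j) (g x i j))"
    proof (rule decidable_bool_arg[where Q = "\<lambda>w x i j. start M h
          (?s x i j) w (g x i j)"])
      show "decidable (\<lambda>x i j. ?w x i j)"
        by (intro i org q comp_intros)
      show "decidable (\<lambda>x i j. start M h (?s x i j) w (g x i j))" for w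
        by (rule decidable_finite2[where Q = "\<lambda>s a. start M h s w a" and A = 3, OF inp _ g]) (simp add: input_at_def)
    qed
  qed
  have accept: "decidable (\<lambda>x i j. accept M (?i x i j = org x) (g x i j))"
    by (rule decidable_bool_arg[where Q = "\<lambda>h x i j. accept M h (g x i j)"],
      rule decidable_eq[OF i org], rule decidable_finite[OF g])
  show ?thesis
    unfolding allowed_def
    by (intro start accept i f T org q decidable_finite[OF g, where Q = "good M"]
        decidable_finite[OF g, where Q = "\<lambda>a. tx a = blank M"]
        decidable_finite[OF g, where Q = "\<lambda>a. tz a = blank M"] comp_intros)
qed

section \<open>NP-hardness\<close>

lemma (in wire_system) encode_graph: "encode_graph graph = concat (map (\<lambda>i. map (adj i) [0..<nv]) [0..<nv])"
  by (auto simp: encode_graph_def graph_def Let_def intro!: arg_cong[where f = concat])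

lemma halted_step: "fst c = states M \<Longrightarrow> (step M ^^ n) c = c"
  by (induction n) (auto simp: step_def split: prod.splits)

theorem theorem5p6:
  fixes d :: nat
  assumes "d \<ge> 3"
  shows "NP_hard encode_graph (graphs_of_max_degree (d + 1))
           (\<lambda>G. spectral_degeneracy G \<ge> real d)"
  unfolding NP_hard_def
proof (intro allI impI)
  fix L assume "in_NP L"
  then obtain R p where R: "poly_time_computable 2 (\<lambda>ws. [R (ws ! 0) (ws ! 1)])"
    and L: "\<And>x. x \<in> L \<longleftrightarrow> (\<exists>w. length w \<le> poly (p :: nat poly) (length x) \<and> R x w)"
    unfolding in_NP_def by blast
  obtain M r where M: "wf_turing_machine M" "2 \<le> tapes M"
    and halt: "\<And>x w. \<exists>t \<le> poly (r :: nat poly) (length x + length w).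
       halts_with M ((step M ^^ t) (init_config M [x, w])) [R x w]"
  proof -
    obtain M r where "wf_turing_machine M" "2 \<le> tapes M"
      "\<forall>ws. length ws = 2 \<longrightarrow> (\<exists>t \<le> poly (r :: nat poly) (sum_list (map length ws)).
         halts_with M ((step M ^^ t) (init_config M ws)) [R (ws ! 0) (ws ! 1)])"
      using R unfolding poly_time_computable_def by blast
    then show thesis by (intro that[of M r]) (auto dest!: spec[of _ "[_, _]"])
  qed
  define q where "q x = poly p (length x)" for x :: "bool list"
  \<comment> \<open>Certificates have length at most \<open>q x\<close>, so this is a common time
    bound for all of them.\<close>
  define Tm where "Tm x = poly r (length x + q x)" for x
  define org where "org x = Tm x + length x + q x + 1" for x
  have tab: "tableau M x (Tm x) (org x) (q x)" for x
    by standard (use M in \<open>auto simp: org_def\<close>)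
  define al where "al x = allowed M x (Tm x + 1) (2 * org x + 1) (org x) (q x)" for x
  have tl: "tiling (Tm x + 1) (2 * org x + 1) (n_tiles M) (n_colours M) rcol (ucol M)" for x
  proof -
    interpret tableau M x "Tm x" "org x" "q x" by (rule tab)
    show ?thesis unfolding al_def by (rule tiling_axioms)
  qed
  define C where "C x = (Tm x + 1) * (2 * org x + 1) * (2 + 2 * n_colours M)" for x
  define W where "W x = (Tm x + 1) * (2 * org x + 1) * n_tiles M" for x
  define inc where "inc x = tiling.tinc (Tm x + 1) (2 * org x + 1) (n_tiles M) (n_colours M) (al x) rcol lcol (ucol M) dcol" for x
  have cs: "cover_system d (C x) (W x) (inc x)" for x
    using tiling.cover_system[OF tl assms, of x] unfolding C_def W_def inc_def tiling.E_def[OF tl] .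
  have accept: "x \<in> L \<longleftrightarrow> (\<exists>X. cover_system.exact_cover (C x) (W x) (inc x) X)" for x
  proof -
    interpret tableau M x "Tm x" "org x" "q x" by (rule tab)
    interpret cs: cover_system d "C x" "W x" "inc x" by (rule cs)
    \<comment> \<open>By time \<open>Tm x\<close> the verifier has halted and its configuration no
      longer changes, so the last row shows the output bit in cell \<open>0\<close>.\<close>
    have "accepting (cfg w (Tm x)) \<longleftrightarrow> R x w" if w: "length w \<le> q x" for w
    proof -
      obtain t where t: "t \<le> poly r (length x + length w)" "halts_with M (cfg w t) [R x w]"
        using halt[of x w] unfolding cfg_def by blast
      have "t \<le> Tm x" unfolding Tm_def
        by (rule order_trans[OF t(1) poly_nat_mono]) (use w in simp)
      then have "cfg w (Tm x) = (step M ^^ (Tm x - t)) (cfg w t)"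
        unfolding cfg_def by (metis comp_apply funpow_add le_add_diff_inverse2)
      also have "\<dots> = cfg w t" using t(2) by (intro halted_step) (simp add: halts_with_def)
      finally have eq: "cfg w (Tm x) = cfg w t" .
      have "snd (cfg w t) \<noteq> []" using cfg_len[of w t] tapes by auto
      then have "fst (snd (cfg w t) ! 0) 0 = word_content [R x w] 0"
        using t(2) by (auto simp: halts_with_def hd_conv_nth)
      then show ?thesis using t(2) unfolding eq accepting_def
        by (auto simp: halts_with_def word_content_def)
    qed
    then have "x \<in> L \<longleftrightarrow> (\<exists>v. valid v)"
      unfolding valid_iff_accepting L q_def[symmetric] by blast
    also have "\<dots> \<longleftrightarrow> (\<exists>X. \<forall>c<C x. card {l. l < W x \<and> X l \<and> inc x c l} = 1)"
      using valid_imp_cover cover_imp_valid unfolding C_def W_def inc_def al_def E_def by blast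
    finally show ?thesis unfolding cs.exact_cover_def .
  qed
  have cq: "computable (\<lambda>x i j. q x)" unfolding q_def by (intro comp_intros)
  have cT: "computable (\<lambda>x i j. Tm x)" unfolding Tm_def by (intro cq comp_intros)
  have corg: "computable (\<lambda>x i j. org x)" unfolding org_def by (intro cq cT comp_intros)
  have cC: "computable (\<lambda>x i j. C x)" unfolding C_def by (intro cT corg comp_intros)
  have cW: "computable (\<lambda>x i j. W x)" unfolding W_def by (intro cT corg comp_intros)
  have cinc: "decidable (\<lambda>x i j. inc x (f x i j) (g x i j))" if "computable f" "computable g" for f g
    unfolding inc_def
  proof (rule decidable_tinc[OF tl _ _ _ that])
    show "computable (\<lambda>x i j. Tm x + 1)" "computable (\<lambda>x i j. 2 * org x + 1)"
      by (intro cT corg comp_intros)+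
    fix f g assume "computable f" "computable g" "\<And>x i j. g x i j < n_tiles M"
    then show "decidable (\<lambda>x i j. al x (f x i j) (g x i j))"
      unfolding al_def by (intro decidable_allowed cT corg cq comp_intros)
  qed
  define nw nk us where nw_eq: "nw x = cover_system.wn (C x) (W x)" and nk_eq: "nk x = 2 * cover_system.P (C x) (W x)"
    and us_eq: "us x = cover_system.cused d (C x) (W x) (inc x)" for x
  have ws: "regular_wire_system d (nw x) (nk x) (us x)" for x
  proof -
    interpret cover_system d "C x" "W x" "inc x" by (rule cs)
    show ?thesis unfolding nw_eq nk_eq us_eq by (rule regular_wire_system_axioms)
  qed
  then have ws': "wire_system d (nw x) (nk x)" for x
    by (simp add: regular_wire_system_def)
  have cwn: "computable (\<lambda>x i j. nw x)"
    unfolding nw_eq cover_system.wn_unfolded[OF cs] by (intro cC cW comp_intros)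
  have cK: "computable (\<lambda>x i j. nk x)"
    unfolding nk_eq cover_system.P_def[OF cs] by (intro cC cW comp_intros)
  have cused: "decidable (\<lambda>x i j. us x (f x i j))" if "computable f" for f
    unfolding us_eq by (rule decidable_cused[OF cs cC cW cinc that])
  define G where "G x = wire_system.graph d (nw x) (nk x) (us x)" for x
  have enc: "encode_graph (G x) = concat (map (\<lambda>i. map (\<lambda>j. wire_system.adj d (nw x) (nk x) (us x) i j)
      [0..<wire_system.nv d (nw x) (nk x)]) [0..<wire_system.nv d (nw x) (nk x)])" for x
    unfolding G_def by (rule wire_system.encode_graph[OF ws'])
  have "poly_time_computable 1 (\<lambda>ws. encode_graph (G (ws ! 0)))"
    unfolding enc by (intro poly_time_computable_matrix computable_nv decidable_adj ws' cwn cK cused)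
  \<comment> \<open>Every constraint vertex has degree exactly \<open>d + 1\<close>, so
    \<open>G x\<close> is a legitimate instance for each word \<open>x\<close>, in \<open>L\<close>
    or not.\<close>
  moreover have "G x \<in> graphs_of_max_degree (d + 1) \<and> (x \<in> L \<longleftrightarrow> spectral_degeneracy (G x) \<ge> real d)" for x
  proof -
    interpret cs: cover_system d "C x" "W x" "inc x" by (rule cs)
    have G: "G x = cs.graph" by (simp only: G_def nw_eq nk_eq us_eq)
    show ?thesis
      unfolding G accept cs.spectral_degeneracy_iff_exact_cover graphs_of_max_degree_def
      using cs.simple_graph cs.max_degree_graph by auto
  qed
  ultimately show "\<exists>f. poly_time_computable 1 (\<lambda>ws. f (ws ! 0)) \<and>
      (\<forall>x. \<exists>G\<in>graphs_of_max_degree (d + 1). f x = encode_graph G \<and> (x \<in> L \<longleftrightarrow> real d \<le> spectral_degeneracy G))"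
    by (intro exI[of _ "\<lambda>x. encode_graph (G x)"]) blast
qed

end
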